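(* Let $0<q\le p<\infty$, let $(\mathcal{X},\rho,\mu)$ be a space of homogeneous type satisfying the weak reverse doubling (WRD) condition, let $Y(\mathcal{X})$ be a ball quasi-Banach function space, and let $Y(\Omega)$ be the restriction of $Y(\mathcal{X})$ to $\Omega$, where $\Omega\subseteq\mathcal{X}$ is a measurable set satisfying the weak measure density (WMD) condition. Assume that $Y^{\frac1p}(\mathcal{X})$ is a ball Banach function space and the Hardy--Littlewood maximal operator $\mathcal{M}$ is endpoint bounded on $[Y^{\frac1p}(\mathcal{X})]'$, that is, there exists a sequence $\{\theta_m\}_{m\in\mathbb{N}}$ in $(0,1)$ with $\lim_{m\to\infty}\theta_m=1$ such that, for any $m\in\mathbb{N}$, $Y^{\frac1{p\theta_m}}(\mathcal{X})$ is a ball Banach function space, $\mathcal{M}$ is bounded on $[Y^{\frac1{p\theta_m}}(\mathcal{X})]'$, and $\lim_{m\to\infty}\|\mathcal{M}\|_{[Y^{\frac1{p\theta_m}}(\mathcal{X})]'\to[Y^{\frac1{p\theta_m}}(\mathcal{X})]'}<\infty$. Then there exist two positive constants $C$ and $\widetilde{C}$, independent of $f$, such that the following hold. (i) Let $\beta\in(0,\infty)$. For any $f\in C^\beta_{\mathrm b}(\Omega)\cap\bigcup_{s\in(0,1)}\dot{W}^{s,q}_Y(\Omega)$, $$C\|f\|_{Y(\Omega)}\le\liminf_{s\to0^+}s^{\frac1q}\left\|\left\{\int_{\Omega}\frac{|f(\cdot)-f(y)|^q}{U(\cdot,y)[\rho(\cdot,y)]^{sq}}\,d\mu(y)\right\}^{\frac1q}\right\|_{Y(\Omega)}\le\limsup_{s\to0^+}s^{\frac1q}\left\|\left\{\int_{\Omega}\frac{|f(\cdot)-f(y)|^q}{U(\cdot,y)[\rho(\cdot,y)]^{sq}}\,d\mu(y)\right\}^{\frac1q}\right\|_{Y(\Omega)}\le\widetilde{C}\|f\|_{Y(\Omega)}.$$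 (ii) If $Y(\mathcal{X})$ has an absolutely continuous quasi-norm and $\mu$ is Borel-semiregular, then, for any $f\in[Y(\Omega)/\mathbb{R}]\cap\bigcup_{s\in(0,1)}\dot{W}^{s,q}_Y(\Omega)$, the same chain of inequalities holds with $\|f\|_{Y(\Omega)}$ at both ends replaced by $\|f\|_{Y(\Omega)/\mathbb{R}}$.
   Context: A quasi-metric on a nonempty set $\mathcal{X}$ is $\rho:\mathcal{X}\times\mathcal{X}\to[0,\infty)$ with $\rho(x,y)=0$ iff $x=y$, $\rho(x,y)=\rho(y,x)$, and $\rho(x,z)\le K_0[\rho(x,y)+\rho(y,z)]$ for some constant $K_0\in[1,\infty)$. Balls: $B(x,r):=\{y:\rho(x,y)<r\}$. $(\mathcal{X},\rho,\mu)$ is a space of homogeneous type if $\rho$ is a quasi-metric, $\mu$ is a nonnegative measure on a $\sigma$-algebra containing all balls, and there is $L_{(\mu)}\in[1,\infty)$ with $0<\mu(B(x,2r))\le L_{(\mu)}\mu(B(x,r))<\infty$ for all $x\in\mathcal{X}$, $r\in(0,\infty)$. WRD condition: there exist $x_0\in\mathcal{X}$ and $\lambda,C_{(\mu)}\in(1,\infty)$ with $\liminf_{r\to\infty}\frac{\mu(B(x_0,\lambda r))}{\mu(B(x_0,r))}\ge C_{(\mu)}$. A measurable set $\Omega\subseteq\mathcal{X}$ satisfies the WMD condition if there exist $x_0\in\mathcal{X}$ and $C_0\in(0,1]$ with $\liminf_{r\to\infty}\frac{\mu(B(x_0,r)\cap\Omega)}{\mu(B(x_0,r))}\ge C_0$.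 $\mu$ is Borel-semiregular if it is a Borel measure on $\mathcal{X}$ and for every measurable $E\subseteq\mathcal{X}$ there is a Borel set $F$ with $\mu(E\setminus F)+\mu(F\setminus E)=0$. Put $U(x,y):=\min\{\mu(B(x,\rho(x,y))),\mu(B(y,\rho(x,y)))\}$. The integrand $|f(x)-f(y)|^q/(U(x,y)[\rho(x,y)]^{sq})$ is read as $0$ at $y=x$. $\mathscr{M}(\mathcal{X})$, $\mathscr{M}(\Omega)$ are the sets of $\mu$-measurable functions on $\mathcal{X}$, $\Omega$. A ball quasi-Banach function space $Y(\mathcal{X})$ is a quasi-Banach space of functions in $\mathscr{M}(\mathcal{X})$ whose quasi-norm makes sense (with values in $[0,\infty]$) for all $f\in\mathscr{M}(\mathcal{X})$, such that: (i) $\|f\|_{Y(\mathcal{X})}=0$ implies $f=0$ $\mu$-a.e.; (ii) $|g|\le|f|$ $\mu$-a.e. implies $\|g\|_{Y(\mathcal{X})}\le\|f\|_{Y(\mathcal{X})}$; (iii) $0\le f_m\uparrow f$ $\mu$-a.e. implies $\|f_m\|_{Y(\mathcal{X})}\uparrow\|f\|_{Y(\mathcal{X})}$; (iv) $\mathbf{1}_B\in Y(\mathcal{X})$ for every ball $B$. It is a ball Banach function space if moreover (v) the triangle inequality holds and (vi) for each ball $B$ there is $C_{(B)}\in(0,\infty)$ with $\int_B|f|\,d\mu\le C_{(B)}\|f\|_{Y(\mathcal{X})}$ for all $f\in Y(\mathcal{X})$. For $t\in(0,\infty)$, $Y^t(\mathcal{X}):=\{f\in\mathscr{M}(\mathcal{X}):|f|^t\in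 Y(\mathcal{X})\}$ with $\|f\|_{Y^t(\mathcal{X})}:=\||f|^t\|_{Y(\mathcal{X})}^{1/t}$. For a ball Banach function space $Z(\mathcal{X})$, $[Z(\mathcal{X})]':=\{f\in\mathscr{M}(\mathcal{X}):\|f\|_{[Z(\mathcal{X})]'}:=\sup_{\|g\|_{Z(\mathcal{X})}\le1}\|fg\|_{L^1(\mathcal{X})}<\infty\}$. $\mathcal{M}f(x):=\sup_{B\ni x}\frac1{\mu(B)}\int_B|f|\,d\mu$, supremum over all balls containing $x$; $\|\mathcal{M}\|_{Z\to Z}$ is its operator norm. $Y(\mathcal{X})$ has an absolutely continuous quasi-norm if $\|f\mathbf{1}_{E_j}\|_{Y(\mathcal{X})}\to0$ whenever $f\in Y(\mathcal{X})$ and $\{E_j\}$ are measurable sets with $\mathbf{1}_{E_j}\to0$ $\mu$-a.e. $Y(\Omega):=\{f\in\mathscr{M}(\Omega): f=g|_\Omega\text{ for some }g\in Y(\mathcal{X})\}$ with $\|f\|_{Y(\Omega)}:=\inf\{\|g\|_{Y(\mathcal{X})}:g\in Y(\mathcal{X}),g|_\Omega=f\}$ (and $\infty$ if no such $g$). $\dot W^{s,q}_Y(\Omega)$: all $f\in\mathscr{M}(\Omega)$ with $\big\|\{\int_{\Omega}\frac{|f(\cdot)-f(y)|^q}{U(\cdot,y)[\rho(\cdot,y)]^{sq}}d\mu(y)\}^{1/q}\big\|_{Y(\Omega)}<\infty$. $Y(\Omega)/\mathbb{R}$: (classes modulo additive real constants of) measurable $f$ on $\Omega$ with $\|f\|_{Y(\Omega)/\mathbb{R}}:=\inf_{a\in\mathbb{R}}\|f+a\|_{Y(\Omega)}<\infty$.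 $C^\beta_{\mathrm b}(\mathcal{X})$: complex-valued functions $g$ on $\mathcal{X}$ with bounded support $\{g\ne0\}$ and $\sup_{x\ne y}|g(x)-g(y)|/[\rho(x,y)]^\beta<\infty$. $C^\beta_{\mathrm b}(\Omega)$: functions $f$ on $\Omega$ for which there is $g\in C^\beta_{\mathrm b}(\mathcal{X})$ with $g=f$ on $\Omega$ and $g\equiv0$ on $\mathcal{X}\setminus\Omega$. $s\to0^+$ means $s\in(0,1)$, $s\to0$. *)

theory Defs
  imports "HOL-Analysis.Analysis"
begin

text \<open>The underlying set is the space of the measure \<open>M\<close>. Functions on a measurable
  \<open>\<Omega>\<close> are total functions of which only the values on \<open>\<Omega>\<close> are used; quasi-norms take
  values in \<^typ>\<open>ennreal\<close>.\<close>

definition quasi_metric :: "'a set \<Rightarrow> ('a \<Rightarrow> 'a \<Rightarrow> real) \<Rightarrow> bool" where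
  "quasi_metric X \<rho> \<longleftrightarrow> X \<noteq> {} \<and>
     (\<forall>x\<in>X. \<forall>y\<in>X. 0 \<le> \<rho> x y \<and> (\<rho> x y = 0 \<longleftrightarrow> x = y) \<and> \<rho> x y = \<rho> y x) \<and>
     (\<exists>K\<ge>1. \<forall>x\<in>X. \<forall>y\<in>X. \<forall>z\<in>X. \<rho> x z \<le> K * (\<rho> x y + \<rho> y z))"

definition qball :: "'a set \<Rightarrow> ('a \<Rightarrow> 'a \<Rightarrow> real) \<Rightarrow> 'a \<Rightarrow> real \<Rightarrow> 'a set" where
  "qball X \<rho> x r = {y\<in>X. \<rho> x y < r}"

definition homogeneous_type :: "'a measure \<Rightarrow> ('a \<Rightarrow> 'a \<Rightarrow> real) \<Rightarrow> bool" where
  "homogeneous_type M \<rho> \<longleftrightarrow> quasi_metric (space M) \<rho> \<and>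
     (\<forall>x\<in>space M. \<forall>r>0. qball (space M) \<rho> x r \<in> sets M) \<and>
     (\<exists>L::real. 1 \<le> L \<and> (\<forall>x\<in>space M. \<forall>r>0.
        0 < emeasure M (qball (space M) \<rho> x (2 * r)) \<and>
        emeasure M (qball (space M) \<rho> x (2 * r)) \<le> ennreal L * emeasure M (qball (space M) \<rho> x r) \<and>
        ennreal L * emeasure M (qball (space M) \<rho> x r) < \<infinity>))"

definition weak_reverse_doubling :: "'a measure \<Rightarrow> ('a \<Rightarrow> 'a \<Rightarrow> real) \<Rightarrow> bool" where
  "weak_reverse_doubling M \<rho> \<longleftrightarrow> (\<exists>x0\<in>space M. \<exists>lam>1. \<exists>C>1::real.
     ennreal C \<le> Liminf at_top (\<lambda>r::real.
       emeasure M (qball (space M) \<rho> x0 (lam * r)) / emeasure M (qball (space M) \<rho> x0 r)))"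

definition weak_measure_density :: "'a measure \<Rightarrow> ('a \<Rightarrow> 'a \<Rightarrow> real) \<Rightarrow> 'a set \<Rightarrow> bool" where
  "weak_measure_density M \<rho> \<Omega> \<longleftrightarrow> (\<exists>x0\<in>space M. \<exists>C0::real. 0 < C0 \<and> C0 \<le> 1 \<and>
     ennreal C0 \<le> Liminf at_top (\<lambda>r::real.
       emeasure M (qball (space M) \<rho> x0 r \<inter> \<Omega>) / emeasure M (qball (space M) \<rho> x0 r)))"

definition qm_open :: "'a set \<Rightarrow> ('a \<Rightarrow> 'a \<Rightarrow> real) \<Rightarrow> 'a set \<Rightarrow> bool" where
  "qm_open X \<rho> S \<longleftrightarrow> S \<subseteq> X \<and> (\<forall>x\<in>S. \<exists>r>0. qball X \<rho> x r \<subseteq> S)"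

definition qm_borel_sets :: "'a set \<Rightarrow> ('a \<Rightarrow> 'a \<Rightarrow> real) \<Rightarrow> 'a set set" where
  "qm_borel_sets X \<rho> = sigma_sets X {S. qm_open X \<rho> S}"

definition borel_semiregular :: "'a measure \<Rightarrow> ('a \<Rightarrow> 'a \<Rightarrow> real) \<Rightarrow> bool" where
  "borel_semiregular M \<rho> \<longleftrightarrow> qm_borel_sets (space M) \<rho> \<subseteq> sets M \<and>
     (\<forall>E\<in>sets M. \<exists>F\<in>qm_borel_sets (space M) \<rho>. emeasure M (E - F) + emeasure M (F - E) = 0)"

definition ennpowr :: "ennreal \<Rightarrow> real \<Rightarrow> ennreal" where
  "ennpowr x a = (if x = \<infinity> then \<infinity> else ennreal (enn2real x powr a))"
  \<comment> \<open>only used with exponents \<open>a > 0\<close>\<close>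

text \<open>A function space \<open>Y\<close> is given by its quasi-norm \<open>N\<close>, defined on all measurable functions;
  its elements are those of finite quasi-norm.\<close>

definition fspace :: "'a measure \<Rightarrow> (('a \<Rightarrow> complex) \<Rightarrow> ennreal) \<Rightarrow> ('a \<Rightarrow> complex) set" where
  "fspace M N = {f \<in> borel_measurable M. N f < \<infinity>}"

definition quasi_banach_norm :: "'a measure \<Rightarrow> (('a \<Rightarrow> complex) \<Rightarrow> ennreal) \<Rightarrow> bool" where
  "quasi_banach_norm M N \<longleftrightarrow>
     (\<forall>f\<in>borel_measurable M. \<forall>c. N (\<lambda>x. c * f x) = ennreal (cmod c) * N f) \<and>
     (\<exists>K::real. 1 \<le> K \<and> (\<forall>f\<in>borel_measurable M. \<forall>g\<in>borel_measurable M.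
        N (\<lambda>x. f x + g x) \<le> ennreal K * (N f + N g))) \<and>
     (\<forall>F. (\<forall>n::nat. F n \<in> fspace M N) \<and>
          (\<forall>e>0. \<exists>n0. \<forall>m\<ge>n0. \<forall>n\<ge>n0. N (\<lambda>x. F m x - F n x) < e) \<longrightarrow>
          (\<exists>f\<in>fspace M N. (\<lambda>n. N (\<lambda>x. F n x - f x)) \<longlonglongrightarrow> 0))"

definition ball_quasi_banach ::
    "'a measure \<Rightarrow> ('a \<Rightarrow> 'a \<Rightarrow> real) \<Rightarrow> (('a \<Rightarrow> complex) \<Rightarrow> ennreal) \<Rightarrow> bool" where
  "ball_quasi_banach M \<rho> N \<longleftrightarrow> quasi_banach_norm M N \<and>
     (\<forall>f\<in>borel_measurable M. N f = 0 \<longrightarrow> (AE x in M. f x = 0)) \<and>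
     (\<forall>f\<in>borel_measurable M. \<forall>g\<in>borel_measurable M.
        (AE x in M. cmod (g x) \<le> cmod (f x)) \<longrightarrow> N g \<le> N f) \<and>
     (\<forall>F f. (\<forall>m::nat. F m \<in> borel_measurable M) \<and> f \<in> borel_measurable M \<and>
        (AE x in M. (\<forall>m. 0 \<le> F m x) \<and> incseq (\<lambda>m. F m x) \<and> (\<lambda>m. F m x) \<longlonglongrightarrow> f x) \<longrightarrow>
        incseq (\<lambda>m. N (\<lambda>x. complex_of_real (F m x))) \<and>
        (\<lambda>m. N (\<lambda>x. complex_of_real (F m x))) \<longlonglongrightarrow> N (\<lambda>x. complex_of_real (f x))) \<and>
     (\<forall>x\<in>space M. \<forall>r>0. indicator (qball (space M) \<rho> x r) \<in> fspace M N)"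

definition ball_banach ::
    "'a measure \<Rightarrow> ('a \<Rightarrow> 'a \<Rightarrow> real) \<Rightarrow> (('a \<Rightarrow> complex) \<Rightarrow> ennreal) \<Rightarrow> bool" where
  "ball_banach M \<rho> N \<longleftrightarrow> ball_quasi_banach M \<rho> N \<and>
     (\<forall>f\<in>borel_measurable M. \<forall>g\<in>borel_measurable M. N (\<lambda>x. f x + g x) \<le> N f + N g) \<and>
     (\<forall>x\<in>space M. \<forall>r>0. \<exists>C::real. 0 < C \<and> (\<forall>f\<in>fspace M N.
        (\<integral>\<^sup>+y\<in>qball (space M) \<rho> x r. ennreal (cmod (f y)) \<partial>M) \<le> ennreal C * N f))"

definition abs_cont_norm :: "'a measure \<Rightarrow> (('a \<Rightarrow> complex) \<Rightarrow> ennreal) \<Rightarrow> bool" where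
  "abs_cont_norm M N \<longleftrightarrow> (\<forall>f\<in>fspace M N. \<forall>E::nat \<Rightarrow> 'a set.
     (\<forall>j. E j \<in> sets M) \<and> (AE x in M. (\<lambda>j. indicator (E j) x :: real) \<longlonglongrightarrow> 0) \<longrightarrow>
     (\<lambda>j. N (\<lambda>x. f x * indicator (E j) x)) \<longlonglongrightarrow> 0)"

definition pow_norm :: "real \<Rightarrow> (('a \<Rightarrow> complex) \<Rightarrow> ennreal) \<Rightarrow> ('a \<Rightarrow> complex) \<Rightarrow> ennreal" where
  "pow_norm t N f = ennpowr (N (\<lambda>x. complex_of_real (cmod (f x) powr t))) (1 / t)"

text \<open>The norm of the associate space, as a function of \<open>|f|\<close>, so that it also applies to the
  \<open>[0,\<infinity>]\<close>-valued maximal function.\<close>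

definition assoc_norm ::
    "'a measure \<Rightarrow> (('a \<Rightarrow> complex) \<Rightarrow> ennreal) \<Rightarrow> ('a \<Rightarrow> ennreal) \<Rightarrow> ennreal" where
  "assoc_norm M N h =
     (SUP g\<in>{g \<in> borel_measurable M. N g \<le> 1}. \<integral>\<^sup>+x. h x * ennreal (cmod (g x)) \<partial>M)"

definition hl_maximal ::
    "'a measure \<Rightarrow> ('a \<Rightarrow> 'a \<Rightarrow> real) \<Rightarrow> ('a \<Rightarrow> complex) \<Rightarrow> 'a \<Rightarrow> ennreal" where
  "hl_maximal M \<rho> f x =
     (SUP B\<in>{qball (space M) \<rho> z r |z r. z \<in> space M \<and> 0 < r \<and> x \<in> qball (space M) \<rho> z r}.
        (\<integral>\<^sup>+y\<in>B. ennreal (cmod (f y)) \<partial>M) / emeasure M B)"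

definition hl_opnorm_assoc ::
    "'a measure \<Rightarrow> ('a \<Rightarrow> 'a \<Rightarrow> real) \<Rightarrow> (('a \<Rightarrow> complex) \<Rightarrow> ennreal) \<Rightarrow> ennreal" where
  "hl_opnorm_assoc M \<rho> N =
     (SUP f\<in>{f \<in> borel_measurable M. assoc_norm M N (\<lambda>x. ennreal (cmod (f x))) \<le> 1}.
        assoc_norm M N (hl_maximal M \<rho> f))"

definition hl_endpoint_bounded ::
    "'a measure \<Rightarrow> ('a \<Rightarrow> 'a \<Rightarrow> real) \<Rightarrow> (('a \<Rightarrow> complex) \<Rightarrow> ennreal) \<Rightarrow> real \<Rightarrow> bool" where
  "hl_endpoint_bounded M \<rho> N p \<longleftrightarrow> (\<exists>\<theta>::nat \<Rightarrow> real.
     (\<forall>m. 0 < \<theta> m \<and> \<theta> m < 1) \<and> \<theta> \<longlonglongrightarrow> 1 \<and>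
     (\<forall>m. ball_banach M \<rho> (pow_norm (1 / (p * \<theta> m)) N) \<and>
          hl_opnorm_assoc M \<rho> (pow_norm (1 / (p * \<theta> m)) N) < \<infinity>) \<and>
     (\<exists>L<\<infinity>. (\<lambda>m. hl_opnorm_assoc M \<rho> (pow_norm (1 / (p * \<theta> m)) N)) \<longlonglongrightarrow> L))"

definition restr_norm ::
    "'a measure \<Rightarrow> (('a \<Rightarrow> complex) \<Rightarrow> ennreal) \<Rightarrow> 'a set \<Rightarrow> ('a \<Rightarrow> complex) \<Rightarrow> ennreal" where
  "restr_norm M N \<Omega> f = (INF g\<in>{g \<in> fspace M N. \<forall>x\<in>\<Omega>. g x = f x}. N g)"

text \<open>The restricted quasi-norm of a \<open>[0,\<infinity>]\<close>-valued function \<open>h\<close> on \<open>\<Omega>\<close>. For \<open>h\<close> a.e. equal to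
  \<open>|f|\<close> with \<open>f\<close> measurable it is \<^term>\<open>restr_norm M N \<Omega> f\<close> (lemma \<open>restr_norm_ext_eq\<close> below), and
  it is \<open>\<infinity>\<close> if \<open>h = \<infinity>\<close> on a set of positive measure. Majorants matter only for
  non-measurable \<open>h\<close>: since \<open>\<rho>\<close> need not be jointly measurable, the function to which this norm is
  applied in the theorem is only known to be comparable to a measurable one.\<close>

definition restr_norm_ext ::
    "'a measure \<Rightarrow> (('a \<Rightarrow> complex) \<Rightarrow> ennreal) \<Rightarrow> 'a set \<Rightarrow> ('a \<Rightarrow> ennreal) \<Rightarrow> ennreal" where
  "restr_norm_ext M N \<Omega> h =
     (INF k\<in>{k \<in> borel_measurable (restrict_space M \<Omega>).
             AE x in restrict_space M \<Omega>. h x \<le> ennreal (cmod (k x))}. restr_norm M N \<Omega> k)"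

lemma restr_norm_mono:
  assumes Y: "ball_quasi_banach M \<rho> N" and \<Omega>: "\<Omega> \<in> sets M"
    and f: "f \<in> borel_measurable (restrict_space M \<Omega>)"
    and le: "AE x in restrict_space M \<Omega>. cmod (f x) \<le> cmod (k x)"
  shows "restr_norm M N \<Omega> f \<le> restr_norm M N \<Omega> k"
  unfolding restr_norm_def[of M N \<Omega> k]
proof (rule INF_greatest)
  fix g assume "g \<in> {g \<in> fspace M N. \<forall>x\<in>\<Omega>. g x = k x}"
  then have g: "g \<in> borel_measurable M" "N g < \<infinity>" and gk: "\<forall>x\<in>\<Omega>. g x = k x"
    by (auto simp: fspace_def)
  define g' where "g' = (\<lambda>x. if x \<in> \<Omega> then f x else 0)"
  have \<Omega>': "\<Omega> \<inter> space M \<in> sets M"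
    using \<Omega> by auto
  have g': "g' \<in> borel_measurable M"
    unfolding g'_def by (rule iffD1[OF measurable_restrict_space_iff[OF \<Omega>'] f]) simp
  have "AE x in M. x \<in> \<Omega> \<longrightarrow> cmod (f x) \<le> cmod (k x)"
    using le by (simp add: AE_restrict_space_iff[OF \<Omega>'])
  then have "AE x in M. cmod (g' x) \<le> cmod (g x)"
    by eventually_elim (auto simp: g'_def gk)
  then have "N g' \<le> N g"
    using Y g g' by (auto simp: ball_quasi_banach_def)
  moreover have "restr_norm M N \<Omega> f \<le> N g'"
    unfolding restr_norm_def using g' \<open>N g' \<le> N g\<close> g(2)
    by (intro INF_lower) (auto simp: fspace_def g'_def intro: le_less_trans)
  ultimately show "restr_norm M N \<Omega> f \<le> N g" by simp
qed

lemma restr_norm_ext_eq: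
  assumes Y: "ball_quasi_banach M \<rho> N" and \<Omega>: "\<Omega> \<in> sets M"
    and f: "f \<in> borel_measurable (restrict_space M \<Omega>)"
    and h: "AE x in restrict_space M \<Omega>. h x = ennreal (cmod (f x))"
  shows "restr_norm_ext M N \<Omega> h = restr_norm M N \<Omega> f"
proof (rule antisym)
  have "AE x in restrict_space M \<Omega>. h x \<le> ennreal (cmod (f x))"
    using h by eventually_elim simp
  then show "restr_norm_ext M N \<Omega> h \<le> restr_norm M N \<Omega> f"
    unfolding restr_norm_ext_def using f by (intro INF_lower) auto
  show "restr_norm M N \<Omega> f \<le> restr_norm_ext M N \<Omega> h"
    unfolding restr_norm_ext_def
  proof (rule INF_greatest)
    fix k assume "k \<in> {k \<in> borel_measurable (restrict_space M \<Omega>).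
             AE x in restrict_space M \<Omega>. h x \<le> ennreal (cmod (k x))}"
    then have "AE x in restrict_space M \<Omega>. h x \<le> ennreal (cmod (k x))" by simp
    with h have "AE x in restrict_space M \<Omega>. cmod (f x) \<le> cmod (k x)"
      by eventually_elim simp
    then show "restr_norm M N \<Omega> f \<le> restr_norm M N \<Omega> k"
      by (rule restr_norm_mono[OF Y \<Omega> f])
  qed
qed

definition U_kernel :: "'a measure \<Rightarrow> ('a \<Rightarrow> 'a \<Rightarrow> real) \<Rightarrow> 'a \<Rightarrow> 'a \<Rightarrow> ennreal" where
  "U_kernel M \<rho> x y =
     min (emeasure M (qball (space M) \<rho> x (\<rho> x y))) (emeasure M (qball (space M) \<rho> y (\<rho> x y)))"

definition gagliardo_fun ::
    "'a measure \<Rightarrow> ('a \<Rightarrow> 'a \<Rightarrow> real) \<Rightarrow> 'a set \<Rightarrow> real \<Rightarrow> real \<Rightarrow> ('a \<Rightarrow> complex) \<Rightarrow> 'a \<Rightarrow> ennreal" where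
  "gagliardo_fun M \<rho> \<Omega> s q f x = ennpowr
     (\<integral>\<^sup>+y\<in>\<Omega>. (if y = x then 0
        else ennreal (cmod (f x - f y) powr q) / (U_kernel M \<rho> x y * ennreal (\<rho> x y powr (s * q)))) \<partial>M)
     (1 / q)"

definition sobolev_seminorm ::
    "'a measure \<Rightarrow> ('a \<Rightarrow> 'a \<Rightarrow> real) \<Rightarrow> (('a \<Rightarrow> complex) \<Rightarrow> ennreal) \<Rightarrow> 'a set \<Rightarrow> real \<Rightarrow> real \<Rightarrow>
     ('a \<Rightarrow> complex) \<Rightarrow> ennreal" where
  "sobolev_seminorm M \<rho> N \<Omega> s q f = restr_norm_ext M N \<Omega> (gagliardo_fun M \<rho> \<Omega> s q f)"

definition sobolev_space ::
    "'a measure \<Rightarrow> ('a \<Rightarrow> 'a \<Rightarrow> real) \<Rightarrow> (('a \<Rightarrow> complex) \<Rightarrow> ennreal) \<Rightarrow> 'a set \<Rightarrow> real \<Rightarrow> real \<Rightarrow>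
     ('a \<Rightarrow> complex) set" where
  "sobolev_space M \<rho> N \<Omega> s q =
     {f \<in> borel_measurable (restrict_space M \<Omega>). sobolev_seminorm M \<rho> N \<Omega> s q f < \<infinity>}"

definition restr_quot_norm ::
    "'a measure \<Rightarrow> (('a \<Rightarrow> complex) \<Rightarrow> ennreal) \<Rightarrow> 'a set \<Rightarrow> ('a \<Rightarrow> complex) \<Rightarrow> ennreal" where
  "restr_quot_norm M N \<Omega> f = (INF a::real. restr_norm M N \<Omega> (\<lambda>x. f x + complex_of_real a))"

definition restr_quot_space ::
    "'a measure \<Rightarrow> (('a \<Rightarrow> complex) \<Rightarrow> ennreal) \<Rightarrow> 'a set \<Rightarrow> ('a \<Rightarrow> complex) set" where
  "restr_quot_space M N \<Omega> =
     {f \<in> borel_measurable (restrict_space M \<Omega>). restr_quot_norm M N \<Omega> f < \<infinity>}"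

definition holder_bs :: "'a set \<Rightarrow> ('a \<Rightarrow> 'a \<Rightarrow> real) \<Rightarrow> real \<Rightarrow> ('a \<Rightarrow> complex) set" where
  "holder_bs X \<rho> \<beta> = {g.
     (\<exists>x\<in>X. \<exists>r>0. {y\<in>X. g y \<noteq> 0} \<subseteq> qball X \<rho> x r) \<and>
     (\<exists>L. \<forall>x\<in>X. \<forall>y\<in>X. x \<noteq> y \<longrightarrow> cmod (g x - g y) / \<rho> x y powr \<beta> \<le> L)}"

definition holder_bs_on :: "'a set \<Rightarrow> ('a \<Rightarrow> 'a \<Rightarrow> real) \<Rightarrow> 'a set \<Rightarrow> real \<Rightarrow> ('a \<Rightarrow> complex) set" where
  "holder_bs_on X \<rho> \<Omega> \<beta> =
     {f. \<exists>g\<in>holder_bs X \<rho> \<beta>. (\<forall>x\<in>\<Omega>. g x = f x) \<and> (\<forall>x\<in>X - \<Omega>. g x = 0)}"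

end

theory Submission
  imports Defs
begin

text \<open>Why the theorem holds. Split the integral that defines the Gagliardo function of \<open>f\<close> at
  \<open>\<rho>(x, y) = 1\<close>. For \<open>s\<close> below a fixed exponent the near part is dominated by the near part for that
  exponent, so the factor \<open>s\<^bsup>1/q\<^esup>\<close> makes it vanish in the limit. In the far part
  the kernel \<open>1 / (U \<rho>\<^bsup>sq\<^esup>)\<close> has, on the dyadic shell \<open>\<rho> \<approx> 2\<^sup>k\<close>, mass at most of the order \<open>2\<^bsup>-ksq\<^esup>\<close>;
  the total mass is at most of the order \<open>1 / s\<close>, which the factor \<open>s\<^bsup>1/q\<^esup>\<close> compensates.

  For the bound from above, \<open>\<bar>f(x) - f(y)\<bar>\<^sup>q\<close> is estimated by \<open>\<bar>f(x)\<bar>\<^sup>q + \<bar>f(y)\<bar>\<^sup>q\<close>. The first term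
  contributes \<open>\<bar>f\<bar>\<close>, the second one \<open>(T \<bar>f\<bar>\<^sup>q)\<^bsup>1/q\<^esup>\<close> with an average \<open>T\<close> over large balls, and the
  point is that the latter is bounded on \<open>Y\<close> uniformly in \<open>s\<close>
  (\<open>power_mean_bounded_if_endpoint_bounded\<close>). The operator \<open>T\<close> is self-adjoint and pointwise below
  the maximal operator, so it is bounded on the associate space of each \<open>Y\<^bsup>1/(p\<theta>)\<^esup>\<close> and, by
  duality, on \<open>Y\<^bsup>1/(p\<theta>)\<^esup>\<close> itself. On bounded functions Fatou's lemma allows \<open>\<theta> \<rightarrow> 1\<close>, and Jensen's
  inequality passes from the exponent \<open>p\<close> to \<open>q \<le> p\<close>. The duality that is used is the
  Lorentz--Luxemburg theorem \<open>norm_le_if_dual_le\<close>; its separation step is a projection in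
  \<open>L\<^sup>2\<close> onto a ball of the norm.

  For the bound from below, let \<open>x\<close> lie in a ball. Reverse doubling and measure density put
  mass \<open>c / s\<close> of the kernel on points \<open>y\<close> of \<open>\<Omega>\<close> far from this ball (\<open>far_kernel_minorant\<close>). There
  \<open>\<bar>f(x)\<bar>\<^sup>q\<close> is at most a constant times \<open>\<bar>f(x) - f(y)\<bar>\<^sup>q + \<bar>f(y)\<bar>\<^sup>q\<close>, so \<open>\<bar>f\<bar>\<close> on the ball is controlled
  by \<open>s\<^bsup>1/q\<^esup>\<close> times the Gagliardo function, up to \<open>(T \<bar>f'\<bar>\<^sup>q)\<^bsup>1/q\<^esup>\<close> with \<open>f'\<close> the part of \<open>f\<close>
  outside the ball. The norm of this error is at most a constant times the norm of \<open>f'\<close>. As the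
  ball grows it vanishes, in case (i) because \<open>f\<close> has bounded support and in case (ii) because the
  quasi-norm is absolutely continuous; in case (ii) this is applied to \<open>f + a\<close>, which has the same
  Gagliardo function as \<open>f\<close>.

  The function \<open>x \<mapsto> \<mu>(B(x, r))\<close> need not be measurable. Therefore \<open>T\<close> is built from countably many
  balls with fixed centres, which makes its kernel measurable in both variables, and the Gagliardo
  integrand enters only through lower integrals.\<close>

section \<open>Powers of extended nonnegative reals\<close>

lemma ennpowr_top [simp]: "ennpowr top a = top"
  by (simp add: ennpowr_def)

lemma ennpowr_0 [simp]: "ennpowr 0 a = 0"
  by (simp add: ennpowr_def)

lemma ennpowr_ennreal: "0 \<le> r \<Longrightarrow> ennpowr (ennreal r) a = ennreal (r powr a)"
  by (simp add: ennpowr_def)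

lemma ennpowr_mono:
  assumes "0 \<le> a" "x \<le> y" shows "ennpowr x a \<le> ennpowr y a"
  using assms by (cases x; cases y) (auto simp: ennpowr_ennreal powr_mono2 top_unique intro!: ennreal_leI)

lemma ennpowr_ennpowr: "ennpowr (ennpowr x a) b = ennpowr x (a * b)"
  by (cases x) (auto simp: ennpowr_ennreal powr_powr)

lemma ennpowr_1 [simp]: "ennpowr x 1 = x"
  by (cases x) (auto simp: ennpowr_ennreal)

lemma ennpowr_inverse [simp]:
  assumes "0 < a" shows "ennpowr (ennpowr x a) (1 / a) = x" "ennpowr (ennpowr x (1 / a)) a = x"
  using assms by (simp_all add: ennpowr_ennpowr)

lemma ennpowr_mult:
  assumes "0 < a" shows "ennpowr (x * y) a = ennpowr x a * ennpowr y a"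
proof (cases x; cases y)
  fix r s :: real assume "0 \<le> r" "x = ennreal r" "0 \<le> s" "y = ennreal s"
  then show ?thesis by (simp add: ennpowr_ennreal powr_mult flip: ennreal_mult)
next
  fix r :: real assume "0 \<le> r" "x = ennreal r" "y = top"
  then show ?thesis by (cases "r = 0") (simp_all add: ennpowr_ennreal ennreal_mult_top)
next
  fix r :: real assume "0 \<le> r" "y = ennreal r" "x = top"
  then show ?thesis by (cases "r = 0") (simp_all add: ennpowr_ennreal ennreal_top_mult)
next
  assume "x = top" "y = top" then show ?thesis by simp
qed

text \<open>The power is an order isomorphism of \<open>[0,\<infinity>]\<close>, with the reciprocal power as its inverse.\<close>

lemma ennpowr_SUP:
  assumes a: "0 < a"
  shows "ennpowr (SUP i\<in>I. f i) a = (SUP i\<in>I. ennpowr (f i) a)"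
proof (rule antisym)
  have "f i \<le> ennpowr (SUP i\<in>I. ennpowr (f i) a) (1 / a)" if "i \<in> I" for i
  proof -
    have "ennpowr (ennpowr (f i) a) (1 / a) \<le> ennpowr (SUP i\<in>I. ennpowr (f i) a) (1 / a)"
      using a that by (intro ennpowr_mono SUP_upper) auto
    then show ?thesis using a by simp
  qed
  then have "(SUP i\<in>I. f i) \<le> ennpowr (SUP i\<in>I. ennpowr (f i) a) (1 / a)"
    by (rule SUP_least)
  then have "ennpowr (SUP i\<in>I. f i) a \<le> ennpowr (ennpowr (SUP i\<in>I. ennpowr (f i) a) (1 / a)) a"
    using a by (intro ennpowr_mono) auto
  then show "ennpowr (SUP i\<in>I. f i) a \<le> (SUP i\<in>I. ennpowr (f i) a)" using a by simp
  show "(SUP i\<in>I. ennpowr (f i) a) \<le> ennpowr (SUP i\<in>I. f i) a"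
    using a by (intro SUP_least ennpowr_mono SUP_upper) auto
qed

lemma ennpowr_measurable [measurable (raw)]:
  assumes [measurable]: "f \<in> borel_measurable M"
  shows "(\<lambda>x. ennpowr (f x) a) \<in> borel_measurable M"
  unfolding ennpowr_def by measurable

lemma ennreal_add_le_twice_max: "x + y \<le> 2 * max x (y::ennreal)"
  by (metis add_mono max.cobounded1 max.cobounded2 mult_2)

lemma ennpowr_add_le:
  assumes a: "0 < a"
  shows "ennpowr (x + y) a \<le> ennreal (2 powr a) * (ennpowr x a + ennpowr y a)"
proof -
  have "ennpowr (x + y) a \<le> ennpowr (2 * max x y) a"
    using a by (intro ennpowr_mono ennreal_add_le_twice_max) auto
  also have "\<dots> = ennreal (2 powr a) * ennpowr (max x y) a"
    using a ennpowr_ennreal[of 2 a] by (simp add: ennpowr_mult)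
  also have "ennpowr (max x y) a \<le> ennpowr x a + ennpowr y a"
    by (cases "x \<le> y") (auto simp: max_def)
  finally show ?thesis by (simp add: mult_left_mono)
qed

lemma ennpowr_tendsto_exponent:
  assumes b: "b \<longlonglongrightarrow> c" and c: "0 < c"
  shows "(\<lambda>m. ennpowr x (b m)) \<longlonglongrightarrow> ennpowr x c"
proof (cases x)
  case (real r)
  show ?thesis
  proof (cases "r = 0")
    case False
    then have "(\<lambda>m. r powr b m) \<longlonglongrightarrow> r powr c"
      using b by (intro tendsto_powr tendsto_const) auto
    then show ?thesis using real by (simp add: ennpowr_ennreal)
  qed (use real in simp)
qed simp

lemma ennpowr_antimono_exponent:
  assumes "x \<le> 1" "a \<le> b" "0 < a" shows "ennpowr x b \<le> ennpowr x a"
proof (cases x)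
  case (real r)
  with assms have "r powr b \<le> r powr a"
    by (cases "r = 0") (auto simp: powr_le_cancel_iff intro: powr_mono')
  with real show ?thesis by (simp add: ennpowr_ennreal ennreal_leI)
qed (use assms in \<open>auto simp: top_unique\<close>)

section \<open>Lower integrals\<close>

text \<open>The Gagliardo integrand is not known to be measurable. For a function that is not measurable, \<^const>\<open>nn_integral\<close> is a lower integral. It is then no
  longer subadditive, but it still is when one of the two summands is measurable, because a
  measurable minorant of \<open>u + v\<close> minus \<open>v\<close> is a measurable minorant of \<open>u\<close>.\<close>

lemma nn_integral_add_le:
  assumes v [measurable]: "v \<in> borel_measurable M"
  shows "(\<integral>\<^sup>+x. u x + v x \<partial>M) \<le> (\<integral>\<^sup>+x. u x \<partial>M) + (\<integral>\<^sup>+x. v x \<partial>M)"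
  unfolding nn_integral_def_finite[of M "\<lambda>x. u x + v x"]
proof (rule SUP_least)
  fix g assume g: "g \<in> {g. simple_function M g \<and> g \<le> (\<lambda>x. u x + v x) \<and> (\<forall>x. g x < top)}"
  then have gm: "simple_function M g" by simp
  then have [measurable]: "g \<in> borel_measurable M" by (rule borel_measurable_simple_function)
  have "integral\<^sup>S M g = (\<integral>\<^sup>+x. g x \<partial>M)"
    using gm by (rule nn_integral_eq_simple_integral[symmetric])
  also have "\<dots> \<le> (\<integral>\<^sup>+x. (g x - v x) + v x \<partial>M)"
    by (intro nn_integral_mono) (auto simp: diff_add_self_ennreal)
  also have "\<dots> = (\<integral>\<^sup>+x. g x - v x \<partial>M) + (\<integral>\<^sup>+x. v x \<partial>M)"
    by (intro nn_integral_add) auto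
  also have "(\<integral>\<^sup>+x. g x - v x \<partial>M) \<le> (\<integral>\<^sup>+x. u x \<partial>M)"
  proof (rule nn_integral_mono)
    fix x
    have "g x \<le> u x + v x" "g x \<noteq> top" using g by (auto simp: le_fun_def less_top)
    then show "g x - v x \<le> u x" by (auto simp: ennreal_minus_le_iff add.commute)
  qed
  finally show "integral\<^sup>S M g \<le> (\<integral>\<^sup>+x. u x \<partial>M) + (\<integral>\<^sup>+x. v x \<partial>M)" by (simp add: add_right_mono)
qed

lemma nn_integral_cmult_le:
  assumes "0 < c"
  shows "(\<integral>\<^sup>+x. ennreal c * u x \<partial>M) \<le> ennreal c * (\<integral>\<^sup>+x. u x \<partial>M)"
  unfolding nn_integral_def_finite[of M "\<lambda>x. ennreal c * u x"]
proof (rule SUP_least)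
  fix g assume g: "g \<in> {g. simple_function M g \<and> g \<le> (\<lambda>x. ennreal c * u x) \<and> (\<forall>x. g x < top)}"
  then have gm: "simple_function M g" by simp
  then have [measurable]: "g \<in> borel_measurable M" by (rule borel_measurable_simple_function)
  have inv: "ennreal c * (ennreal (1 / c) * t) = t" for t
    using assms by (simp flip: mult.assoc ennreal_mult)
  have "integral\<^sup>S M g = (\<integral>\<^sup>+x. ennreal c * (ennreal (1 / c) * g x) \<partial>M)"
    using gm by (simp add: nn_integral_eq_simple_integral inv)
  also have "\<dots> = ennreal c * (\<integral>\<^sup>+x. ennreal (1 / c) * g x \<partial>M)"
    by (intro nn_integral_cmult) auto
  also have "(\<integral>\<^sup>+x. ennreal (1 / c) * g x \<partial>M) \<le> (\<integral>\<^sup>+x. u x \<partial>M)"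
  proof (rule nn_integral_mono)
    fix x
    have "g x \<le> ennreal c * u x" using g by (auto simp: le_fun_def)
    then have "ennreal (1 / c) * g x \<le> ennreal (1 / c) * (ennreal c * u x)"
      by (rule mult_left_mono) simp
    also have "\<dots> = u x" using assms by (simp flip: mult.assoc ennreal_mult)
    finally show "ennreal (1 / c) * g x \<le> u x" .
  qed
  finally show "integral\<^sup>S M g \<le> ennreal c * (\<integral>\<^sup>+x. u x \<partial>M)" by (simp add: mult_left_mono)
qed

section \<open>Function norms\<close>

text \<open>A function norm in the sense of Luxemburg and Zaanen, with a quasi-triangle inequality.\<close>

locale function_quasinorm =
  fixes M :: "'a measure" and P :: "('a \<Rightarrow> ennreal) \<Rightarrow> ennreal" and K :: real
  assumes K_ge_1: "1 \<le> K"
    and mono_AE: "\<And>f g. f \<in> borel_measurable M \<Longrightarrow> g \<in> borel_measurable M \<Longrightarrow>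
      (AE x in M. f x \<le> g x) \<Longrightarrow> P f \<le> P g"
    and scale: "\<And>f c. f \<in> borel_measurable M \<Longrightarrow> 0 \<le> c \<Longrightarrow>
      P (\<lambda>x. ennreal c * f x) = ennreal c * P f"
    and add_le: "\<And>f g. f \<in> borel_measurable M \<Longrightarrow> g \<in> borel_measurable M \<Longrightarrow>
      P (\<lambda>x. f x + g x) \<le> ennreal K * (P f + P g)"
    and SUP_eq: "\<And>f :: nat \<Rightarrow> 'a \<Rightarrow> ennreal. (\<And>n. f n \<in> borel_measurable M) \<Longrightarrow>
      (\<And>x. incseq (\<lambda>n. f n x)) \<Longrightarrow> P (\<lambda>x. SUP n. f n x) = (SUP n. P (f n))"
begin

lemma mono: "f \<in> borel_measurable M \<Longrightarrow> g \<in> borel_measurable M \<Longrightarrow>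
    (\<And>x. x \<in> space M \<Longrightarrow> f x \<le> g x) \<Longrightarrow> P f \<le> P g"
  by (rule mono_AE) auto

lemma zero: "P (\<lambda>x. 0) = 0"
  using scale[of "\<lambda>x. 0" 0] by simp

lemma Fatou:
  fixes f :: "nat \<Rightarrow> 'a \<Rightarrow> ennreal"
  assumes [measurable]: "\<And>n. f n \<in> borel_measurable M"
  shows "P (\<lambda>x. liminf (\<lambda>n. f n x)) \<le> liminf (\<lambda>n. P (f n))"
proof -
  have m [measurable]: "(\<lambda>x. INF k\<in>{n..}. f k x) \<in> borel_measurable M" for n
    by (rule borel_measurable_INF) auto
  have "P (\<lambda>x. liminf (\<lambda>n. f n x)) = P (\<lambda>x. SUP n. INF k\<in>{n..}. f k x)"
    by (simp add: liminf_SUP_INF)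
  also have "\<dots> = (SUP n. P (\<lambda>x. INF k\<in>{n..}. f k x))"
    by (intro SUP_eq m) (auto intro!: incseq_SucI INF_superset_mono)
  also have "\<dots> \<le> liminf (\<lambda>n. P (f n))"
    unfolding liminf_SUP_INF
    by (intro SUP_mono' INF_greatest mono m) (auto intro: INF_lower)
  finally show ?thesis .
qed

lemma add3_le:
  assumes [measurable]: "f \<in> borel_measurable M" "g \<in> borel_measurable M" "h \<in> borel_measurable M"
  shows "P (\<lambda>x. f x + g x + h x) \<le> ennreal (K * K) * (P f + P g + P h)"
proof -
  have "P (\<lambda>x. f x + g x + h x) \<le> ennreal K * (P (\<lambda>x. f x + g x) + P h)"
    by (intro add_le) auto
  also have "\<dots> \<le> ennreal K * (ennreal K * (P f + P g) + ennreal K * P h)"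
  proof (intro mult_left_mono add_mono add_le)
    have "1 * P h \<le> ennreal K * P h" using K_ge_1 by (intro mult_right_mono) auto
    then show "P h \<le> ennreal K * P h" by simp
  qed auto
  also have "\<dots> = ennreal (K * K) * (P f + P g + P h)"
    using K_ge_1 by (simp add: ennreal_mult distrib_left mult.assoc)
  finally show ?thesis .
qed

end

text \<open>The quasi-norms of the theorem act on complex functions. The operators below
  produce \<open>[0,\<infinity>]\<close>-valued functions, so the norms are first extended to such functions. Truncation
  reduces everything to bounded functions, and by the Fatou property the extension inherits the
  lattice and convergence properties of the norm.\<close>

definition trunc :: "('a \<Rightarrow> ennreal) \<Rightarrow> nat \<Rightarrow> 'a \<Rightarrow> real" where
  "trunc u n x = enn2real (min (u x) (of_nat n))"

definition ext_norm :: "(('a \<Rightarrow> complex) \<Rightarrow> ennreal) \<Rightarrow> ('a \<Rightarrow> ennreal) \<Rightarrow> ennreal" where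
  "ext_norm N u = (SUP n. N (\<lambda>x. complex_of_real (trunc u n x)))"

lemma trunc_nonneg [simp]: "0 \<le> trunc u n x"
  by (simp add: trunc_def)

lemma ennreal_trunc: "ennreal (trunc u n x) = min (u x) (of_nat n)"
  unfolding trunc_def by (rule ennreal_enn2real) (simp add: min_less_iff_disj of_nat_less_top)

lemma trunc_le: "trunc u n x \<le> real n"
proof -
  have "ennreal (trunc u n x) \<le> of_nat n" by (simp add: ennreal_trunc)
  then show ?thesis by (simp only: ennreal_le_of_nat_iff)
qed

lemma trunc_measurable [measurable]:
  "u \<in> borel_measurable M \<Longrightarrow> trunc u n \<in> borel_measurable M"
  unfolding trunc_def[abs_def] by measurable

lemma trunc_mono: "u x \<le> v x \<Longrightarrow> m \<le> n \<Longrightarrow> trunc u m x \<le> trunc v n x"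
  unfolding trunc_def
  by (intro enn2real_mono min.mono) (auto simp: min_less_iff_disj of_nat_less_top)

lemma SUP_min_ennreal: "(SUP k\<in>I. min (f k) c) = min (SUP k\<in>I. f k) (c::ennreal)"
  by (simp add: SUP_inf flip: inf_min)

lemma SUP_min_of_nat: "(SUP n. min x (of_nat n)) = (x::ennreal)"
  using SUP_min_ennreal[of "\<lambda>n::nat. of_nat n" x UNIV]
  by (simp add: ennreal_SUP_of_nat_eq_top min.commute)

lemma SUP_ennreal_trunc: "(SUP n. ennreal (trunc u n x)) = u x"
  by (simp add: ennreal_trunc SUP_min_of_nat)

lemma incseq_trunc: "incseq (\<lambda>n. trunc u n x)"
  by (intro monoI trunc_mono) auto

context
  fixes M :: "'a measure" and \<rho> :: "'a \<Rightarrow> 'a \<Rightarrow> real" and N :: "('a \<Rightarrow> complex) \<Rightarrow> ennreal"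
  assumes bqb: "ball_quasi_banach M \<rho> N"
begin

lemma ball_norm_mono:
  "f \<in> borel_measurable M \<Longrightarrow> g \<in> borel_measurable M \<Longrightarrow>
    AE x in M. cmod (g x) \<le> cmod (f x) \<Longrightarrow> N g \<le> N f"
  using bqb by (auto simp: ball_quasi_banach_def)

lemma ball_norm_scale:
  "f \<in> borel_measurable M \<Longrightarrow> N (\<lambda>x. c * f x) = ennreal (cmod c) * N f"
  using bqb by (auto simp: ball_quasi_banach_def quasi_banach_norm_def)

lemma ball_norm_SUP:
  assumes F: "\<And>m::nat. F m \<in> borel_measurable M" and f: "f \<in> borel_measurable M"
    and nonneg: "\<And>m x. 0 \<le> F m x" "\<And>x. 0 \<le> f x" and inc: "\<And>x. incseq (\<lambda>m. F m x)"
    and SUP: "\<And>x. (SUP m. ennreal (F m x)) = ennreal (f x)"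
  shows "N (\<lambda>x. complex_of_real (f x)) = (SUP m. N (\<lambda>x. complex_of_real (F m x)))"
proof -
  have "(\<lambda>m. F m x) \<longlonglongrightarrow> f x" for x
  proof -
    have "(\<lambda>m. ennreal (F m x)) \<longlonglongrightarrow> (SUP m. ennreal (F m x))"
      using inc[of x] by (intro LIMSEQ_SUP) (auto simp: incseq_def intro: ennreal_leI)
    then show ?thesis using nonneg by (simp add: SUP)
  qed
  then have prem: "(\<forall>m. F m \<in> borel_measurable M) \<and> f \<in> borel_measurable M \<and>
      (AE x in M. (\<forall>m. 0 \<le> F m x) \<and> incseq (\<lambda>m. F m x) \<and> (\<lambda>m. F m x) \<longlonglongrightarrow> f x)"
    using F f nonneg inc by auto
  have "\<forall>F f. (\<forall>m::nat. F m \<in> borel_measurable M) \<and> f \<in> borel_measurable M \<and>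
        (AE x in M. (\<forall>m. 0 \<le> F m x) \<and> incseq (\<lambda>m. F m x) \<and> (\<lambda>m. F m x) \<longlonglongrightarrow> f x) \<longrightarrow>
        incseq (\<lambda>m. N (\<lambda>x. complex_of_real (F m x))) \<and>
        (\<lambda>m. N (\<lambda>x. complex_of_real (F m x))) \<longlonglongrightarrow> N (\<lambda>x. complex_of_real (f x))"
    using bqb unfolding ball_quasi_banach_def by (elim conjE)
  from this[THEN spec[of _ F], THEN spec[of _ f], THEN mp, OF prem]
  have "incseq (\<lambda>m. N (\<lambda>x. complex_of_real (F m x)))"
    and "(\<lambda>m. N (\<lambda>x. complex_of_real (F m x))) \<longlonglongrightarrow> N (\<lambda>x. complex_of_real (f x))"
    by (rule conjunct1, rule conjunct2)
  then show ?thesis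
    using LIMSEQ_SUP LIMSEQ_unique by blast
qed

lemma ext_norm_real:
  assumes [measurable]: "f \<in> borel_measurable M" and nonneg: "\<And>x. 0 \<le> f x"
  shows "ext_norm N (\<lambda>x. ennreal (f x)) = N (\<lambda>x. complex_of_real (f x))"
  unfolding ext_norm_def
  by (rule ball_norm_SUP[symmetric]) (auto simp: nonneg incseq_trunc SUP_ennreal_trunc)

lemma ext_norm_cmod:
  assumes [measurable]: "f \<in> borel_measurable M"
  shows "ext_norm N (\<lambda>x. ennreal (cmod (f x))) = N f"
proof -
  have "N (\<lambda>x. complex_of_real (cmod (f x))) = N f"
    by (intro antisym ball_norm_mono) auto
  then show ?thesis by (simp add: ext_norm_real)
qed

lemma ext_norm_SUP:
  fixes f :: "nat \<Rightarrow> 'a \<Rightarrow> ennreal"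
  assumes [measurable]: "\<And>n. f n \<in> borel_measurable M" and inc: "\<And>x. incseq (\<lambda>n. f n x)"
  shows "ext_norm N (\<lambda>x. SUP n. f n x) = (SUP n. ext_norm N (f n))"
proof -
  have "N (\<lambda>x. complex_of_real (trunc (\<lambda>x. SUP k. f k x) n x))
      = (SUP k. N (\<lambda>x. complex_of_real (trunc (f k) n x)))" for n
    using inc by (intro ball_norm_SUP)
      (auto simp: ennreal_trunc SUP_min_ennreal incseq_def intro!: trunc_mono)
  then show ?thesis
    unfolding ext_norm_def by (simp only: SUP_commute[of "\<lambda>n k. N (\<lambda>x. complex_of_real (trunc (f k) n x))" UNIV UNIV])
qed

lemma ext_norm_mono_AE:
  assumes [measurable]: "f \<in> borel_measurable M" "g \<in> borel_measurable M"
    and le: "AE x in M. f x \<le> g x"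
  shows "ext_norm N f \<le> ext_norm N g"
  unfolding ext_norm_def
proof (intro SUP_mono' ball_norm_mono)
  show "AE x in M. cmod (complex_of_real (trunc f n x)) \<le> cmod (complex_of_real (trunc g n x))" for n
    using le by eventually_elim (auto intro: trunc_mono)
qed auto

lemma ext_norm_scale:
  assumes [measurable]: "f \<in> borel_measurable M" and c: "0 \<le> c"
  shows "ext_norm N (\<lambda>x. ennreal c * f x) = ennreal c * ext_norm N f"
proof -
  have "ext_norm N (\<lambda>x. ennreal c * f x) = ext_norm N (\<lambda>x. SUP n. ennreal (c * trunc f n x))"
    using c by (simp add: ennreal_mult SUP_ennreal_trunc flip: SUP_mult_left_ennreal)
  also have "\<dots> = (SUP n. ext_norm N (\<lambda>x. ennreal (c * trunc f n x)))"
    using c by (intro ext_norm_SUP)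
      (auto intro!: ennreal_leI mult_left_mono trunc_mono simp: incseq_def)
  also have "\<dots> = (SUP n. ennreal c * N (\<lambda>x. complex_of_real (trunc f n x)))"
    using c by (subst ext_norm_real) (auto simp: ball_norm_scale)
  also have "\<dots> = ennreal c * ext_norm N f"
    by (simp add: ext_norm_def SUP_mult_left_ennreal)
  finally show ?thesis .
qed

lemma ext_norm_add:
  assumes [measurable]: "f \<in> borel_measurable M" "g \<in> borel_measurable M"
    and tri: "\<And>f g. f \<in> borel_measurable M \<Longrightarrow> g \<in> borel_measurable M \<Longrightarrow>
      N (\<lambda>x. f x + g x) \<le> ennreal K * (N f + N g)"
  shows "ext_norm N (\<lambda>x. f x + g x) \<le> ennreal K * (ext_norm N f + ext_norm N g)"
proof -
  have inc: "incseq (\<lambda>n. ennreal (trunc u n x))" for u and x :: 'a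
    by (auto intro!: ennreal_leI trunc_mono simp: incseq_def)
  have "ext_norm N (\<lambda>x. f x + g x)
      = ext_norm N (\<lambda>x. SUP n. ennreal (trunc f n x + trunc g n x))"
    by (simp add: SUP_ennreal_trunc ennreal_SUP_add inc)
  also have "\<dots> = (SUP n. ext_norm N (\<lambda>x. ennreal (trunc f n x + trunc g n x)))"
    by (intro ext_norm_SUP) (auto intro!: ennreal_leI add_mono trunc_mono simp: incseq_def simp del: ennreal_plus)
  also have "\<dots> = (SUP n. N (\<lambda>x. complex_of_real (trunc f n x) + complex_of_real (trunc g n x)))"
    by (subst ext_norm_real) auto
  also have "\<dots> \<le> ennreal K * (ext_norm N f + ext_norm N g)"
  proof (rule SUP_least)
    fix n
    have "N (\<lambda>x. complex_of_real (trunc f n x) + complex_of_real (trunc g n x))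
        \<le> ennreal K * (N (\<lambda>x. complex_of_real (trunc f n x)) + N (\<lambda>x. complex_of_real (trunc g n x)))"
      by (rule tri) auto
    also have "\<dots> \<le> ennreal K * (ext_norm N f + ext_norm N g)"
      unfolding ext_norm_def by (intro mult_left_mono add_mono SUP_upper) auto
    finally show "N (\<lambda>x. complex_of_real (trunc f n x) + complex_of_real (trunc g n x))
      \<le> ennreal K * (ext_norm N f + ext_norm N g)" .
  qed
  finally show ?thesis .
qed

lemma function_quasinorm_ext_norm_if:
  assumes "1 \<le> K" and "\<And>f g. f \<in> borel_measurable M \<Longrightarrow> g \<in> borel_measurable M \<Longrightarrow>
      N (\<lambda>x. f x + g x) \<le> ennreal K * (N f + N g)"
  shows "function_quasinorm M (ext_norm N) K"
  by unfold_locales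
    (use assms in \<open>auto intro: ext_norm_mono_AE ext_norm_scale ext_norm_add ext_norm_SUP\<close>)

lemma function_quasinorm_ext_norm: "\<exists>K. function_quasinorm M (ext_norm N) K"
proof -
  obtain K where "1 \<le> K" "\<forall>f\<in>borel_measurable M. \<forall>g\<in>borel_measurable M.
        N (\<lambda>x. f x + g x) \<le> ennreal K * (N f + N g)"
    using bqb by (auto simp: ball_quasi_banach_def quasi_banach_norm_def)
  then show ?thesis by (intro exI function_quasinorm_ext_norm_if) auto
qed

text \<open>If \<open>f = \<infinity>\<close> on \<open>E\<close>, then \<open>n 1\<^sub>E \<le> f\<close> for all \<open>n\<close>, so that \<open>n\<close> times the norm of \<open>1\<^sub>E\<close> is bounded in \<open>n\<close>.\<close>

lemma ext_norm_finite_imp_AE: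
  assumes [measurable]: "f \<in> borel_measurable M" and fin: "ext_norm N f < \<infinity>"
  shows "AE x in M. f x < \<infinity>"
proof -
  define e :: "'a \<Rightarrow> ennreal" where "e = indicator {x \<in> space M. f x = \<infinity>}"
  have [measurable]: "e \<in> borel_measurable M" unfolding e_def by measurable
  have "of_nat n * ext_norm N e \<le> ext_norm N f" for n
  proof -
    have "ext_norm N (\<lambda>x. ennreal (real n) * e x) \<le> ext_norm N f"
      by (intro ext_norm_mono_AE) (auto simp: e_def indicator_def)
    then show ?thesis
      by (simp add: ext_norm_scale ennreal_of_nat_eq_real_of_nat)
  qed
  then have "(SUP n. of_nat n) * ext_norm N e \<le> ext_norm N f"
    unfolding SUP_mult_right_ennreal by (intro SUP_least)
  then have "ext_norm N e = 0"
    using fin by (cases "ext_norm N e = 0") (auto simp: ennreal_SUP_of_nat_eq_top top_unique)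
  moreover have "ext_norm N e = N (indicator {x \<in> space M. f x = \<infinity>})"
  proof -
    have "e = (\<lambda>x. ennreal (cmod (indicator {x \<in> space M. f x = \<infinity>} x)))"
      by (auto simp: e_def indicator_def)
    then show ?thesis by (simp add: ext_norm_cmod)
  qed
  ultimately have "AE x in M. indicator {x \<in> space M. f x = \<infinity>} x = (0::complex)"
    using bqb by (auto simp: ball_quasi_banach_def)
  then show ?thesis
    by (rule AE_mp) (auto intro!: AE_I2 simp: indicator_def less_top split: if_splits)
qed

end

text \<open>Truncating before or after taking the power leads to the same supremum, by the Fatou property.\<close>

lemma ext_norm_pow_norm:
  assumes bqb: "ball_quasi_banach M \<rho> N" and t: "0 < t"
    and [measurable]: "f \<in> borel_measurable M"
  shows "ext_norm (pow_norm t N) f = ennpowr (ext_norm N (\<lambda>x. ennpowr (f x) t)) (1 / t)"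
proof -
  have "(SUP n. N (\<lambda>x. complex_of_real (trunc f n x powr t)))
      = (SUP n. ext_norm N (\<lambda>x. ennreal (trunc f n x powr t)))"
    by (subst ext_norm_real[OF bqb]) auto
  also have "\<dots> = ext_norm N (\<lambda>x. SUP n. ennreal (trunc f n x powr t))"
    using t by (intro ext_norm_SUP[OF bqb, symmetric])
      (auto intro!: ennreal_leI powr_mono2 trunc_mono simp: incseq_def)
  also have "\<dots> = ext_norm N (\<lambda>x. ennpowr (f x) t)"
    using t by (simp add: SUP_ennreal_trunc flip: ennpowr_ennreal ennpowr_SUP)
  finally show ?thesis
    using t unfolding ext_norm_def[of "pow_norm t N"] pow_norm_def
    by (simp flip: ennpowr_SUP)
qed

section \<open>Duality for function norms\<close>

definition bounded_on :: "'a measure \<Rightarrow> 'a set \<Rightarrow> ('a \<Rightarrow> real) \<Rightarrow> bool" where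
  "bounded_on M B u \<longleftrightarrow> u \<in> borel_measurable M \<and> (\<exists>a. \<forall>x. \<bar>u x\<bar> \<le> a * indicator B x)"

lemma integrable_if_bounded_on:
  assumes B: "B \<in> sets M" "emeasure M B < \<infinity>" and u: "bounded_on M B u"
  shows "integrable M u"
proof -
  obtain a where a: "\<And>x. \<bar>u x\<bar> \<le> a * indicator B x" using u by (auto simp: bounded_on_def)
  show ?thesis
  proof (rule Bochner_Integration.integrable_bound)
    show "integrable M (\<lambda>x. a * indicator B x :: real)"
      using B by (intro integrable_mult_right integrable_real_indicator) auto
    show "AE x in M. norm (u x) \<le> norm (a * indicator B x :: real)"
      using a by (auto intro!: AE_I2 order_trans[OF _ abs_ge_self])
  qed (use u in \<open>simp add: bounded_on_def\<close>)
qed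

lemma bounded_on_nonneg:
  "u \<in> borel_measurable M \<Longrightarrow> (\<And>x. 0 \<le> u x) \<Longrightarrow> (\<And>x. u x \<le> a * indicator B x) \<Longrightarrow> bounded_on M B u"
  by (auto simp: bounded_on_def)

lemma bounded_on_diff:
  assumes "bounded_on M B u" "bounded_on M B v" shows "bounded_on M B (\<lambda>x. u x - v x)"
proof -
  obtain a c where "\<And>x. \<bar>u x\<bar> \<le> a * indicator B x" "\<And>x. \<bar>v x\<bar> \<le> c * indicator B x"
    using assms by (auto simp: bounded_on_def)
  then have "\<bar>u x - v x\<bar> \<le> (a + c) * indicator B x" for x
    unfolding distrib_right by (intro order_trans[OF abs_triangle_ineq4] add_mono)
  then show ?thesis using assms by (auto simp: bounded_on_def)
qed

lemma bounded_on_mult: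
  assumes "bounded_on M B u" "bounded_on M B v" shows "bounded_on M B (\<lambda>x. u x * v x)"
proof -
  obtain a c where ac: "\<And>x. \<bar>u x\<bar> \<le> a * indicator B x" "\<And>x. \<bar>v x\<bar> \<le> c * indicator B x"
    using assms by (auto simp: bounded_on_def)
  have "\<bar>u x * v x\<bar> \<le> (a * c) * indicator B x" for x
    using mult_mono[OF ac(1)[of x] ac(2)[of x]] ac(1)[of x]
    by (cases "x \<in> B") (auto simp: abs_mult)
  then show ?thesis using assms by (auto simp: bounded_on_def)
qed

lemma bounded_on_square: "bounded_on M B u \<Longrightarrow> bounded_on M B (\<lambda>x. (u x)^2)"
  unfolding power2_eq_square by (rule bounded_on_mult)

lemmas bounded_on_intros = bounded_on_diff bounded_on_mult bounded_on_square

lemma nonpos_if_le_small_multiple: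
  fixes A D :: real
  assumes "\<And>t. 0 < t \<Longrightarrow> t < 1 \<Longrightarrow> A \<le> t * D"
  shows "A \<le> 0"
proof (rule tendsto_lowerbound)
  show "((\<lambda>t. t * D) \<longlongrightarrow> 0) (at_right 0)"
    by (auto intro!: tendsto_eq_intros)
  show "\<forall>\<^sub>F t in at_right 0. A \<le> t * D"
    unfolding eventually_at_right_field using assms by (intro exI[of _ 1]) auto
qed simp

text \<open>Let \<open>h0\<close> be the function closest to \<open>F\<close> in \<open>L\<^sup>2\<close> among those of norm at most \<open>c\<close>. Such a
  function exists because this set is convex and, by the Fatou property, closed; truncation at \<open>F\<close>
  brings a function closer to \<open>F\<close>, so only functions between \<open>0\<close> and \<open>F\<close> have to be considered. The
  last property is the usual characterization of a projection: \<open>F - h0\<close> separates \<open>F\<close> from the ball.\<close>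

lemma norm_ball_projection:
  fixes F :: "'a \<Rightarrow> real"
  assumes P: "function_quasinorm M P 1"
    and F [measurable]: "F \<in> borel_measurable M" and F_nonneg: "\<And>x. 0 \<le> F x"
    and F_le: "\<And>x. F x \<le> b * indicator B x"
    and B [measurable]: "B \<in> sets M" and finB: "emeasure M B < \<infinity>"
    and c: "0 \<le> c" "ennreal c < P (\<lambda>x. ennreal (F x))"
  obtains h0 where "h0 \<in> borel_measurable M" "\<And>x. 0 \<le> h0 x" "\<And>x. h0 x \<le> F x"
    "0 < (LINT x|M. (F x - h0 x)^2)"
    "\<And>h. h \<in> borel_measurable M \<Longrightarrow> P h \<le> ennreal c \<Longrightarrow>
       (\<integral>\<^sup>+x. ennreal (F x - h0 x) * h x \<partial>M) \<le> ennreal (LINT x|M. (F x - h0 x) * h0 x)"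
proof -
  interpret function_quasinorm M P 1 by (rule P)
  have F0: "F x = 0" if "x \<notin> B" for x
    using F_nonneg[of x] F_le[of x] that by simp
  have Fb: "F x \<le> \<bar>b\<bar>" for x
    using F_nonneg[of x] F_le[of x] by (cases "x \<in> B") auto
  note int = integrable_if_bounded_on[OF B finB]
  have bF: "bounded_on M B F" by (rule bounded_on_nonneg[OF F F_nonneg F_le])
  define S where "S = {h \<in> borel_measurable M. (\<forall>x. 0 \<le> h x \<and> h x \<le> F x) \<and> P (\<lambda>x. ennreal (h x)) \<le> ennreal c}"
  define J where "J h = (LINT x|M. (F x - h x)^2)" for h
  define d where "d = (INF h\<in>S. J h)"
  have Sm [measurable_dest]: "h \<in> borel_measurable M" and S0: "0 \<le> h x" and SF: "h x \<le> F x"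
    and SP: "P (\<lambda>x. ennreal (h x)) \<le> ennreal c" if "h \<in> S" for h x
    using that by (auto simp: S_def)
  have S00: "h x = 0" if "h \<in> S" "x \<notin> B" for h x
    using S0[OF that(1), of x] SF[OF that(1), of x] F0[OF that(2)] by simp
  have bS: "bounded_on M B h" if "h \<in> S" for h
    by (rule bounded_on_nonneg[OF Sm[OF that] S0[OF that] order_trans[OF SF[OF that] F_le]])
  have intF: "integrable M (\<lambda>x. (F x - h x)^2)" if "h \<in> S" for h
    by (intro int bounded_on_intros bF bS that)
  have zeroS: "(\<lambda>x. 0) \<in> S"
    using c F_nonneg by (auto simp: S_def zero)
  have J_nonneg: "0 \<le> J h" for h by (auto simp: J_def)
  have bdd: "bdd_below (J ` S)" using J_nonneg by (auto intro!: bdd_belowI2[where m=0])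
  have d_le: "d \<le> J h" if "h \<in> S" for h
    unfolding d_def using bdd that by (rule cINF_lower)
  have convex_P: "P (\<lambda>x. ennreal ((1 - t) * h x + t * k x)) \<le> ennreal c"
    if [measurable]: "h \<in> borel_measurable M" "k \<in> borel_measurable M"
      and hk: "\<And>x. 0 \<le> h x" "\<And>x. 0 \<le> k x" "P (\<lambda>x. ennreal (h x)) \<le> ennreal c" "P (\<lambda>x. ennreal (k x)) \<le> ennreal c"
      and t: "0 \<le> t" "t \<le> 1" for t and h k :: "'a \<Rightarrow> real"
  proof -
    have "P (\<lambda>x. ennreal ((1 - t) * h x + t * k x))
        = P (\<lambda>x. ennreal (1 - t) * ennreal (h x) + ennreal t * ennreal (k x))"
      using t hk by (simp add: ennreal_mult)
    also have "\<dots> \<le> ennreal 1 * (P (\<lambda>x. ennreal (1 - t) * ennreal (h x)) + P (\<lambda>x. ennreal t * ennreal (k x)))"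
      by (rule add_le) auto
    also have "\<dots> = ennreal (1 - t) * P (\<lambda>x. ennreal (h x)) + ennreal t * P (\<lambda>x. ennreal (k x))"
      using t by (simp add: scale)
    also have "\<dots> \<le> ennreal (1 - t) * ennreal c + ennreal t * ennreal c"
      using hk by (intro add_mono mult_left_mono) auto
    also have "\<dots> = ennreal c"
      using t c by (simp flip: distrib_right ennreal_plus)
    finally show ?thesis .
  qed
  have "\<exists>h\<in>S. J h < d + 1 / real (Suc n)" for n
    using cINF_less_iff[OF _ bdd, of "d + 1 / real (Suc n)"] zeroS unfolding d_def by auto
  then obtain h where hS: "h n \<in> S" and hJ: "J (h n) < d + 1 / real (Suc n)" for n by metis
  note [measurable] = Sm[OF hS]
  \<comment> \<open>parallelogram law for a minimizing sequence\<close>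
  have sq_dist: "(LINT x|M. (h i x - h j x)^2) \<le> 4 / real (Suc n)" if "n \<le> i" "n \<le> j" for i j n
  proof -
    define m where "m = (\<lambda>x. (1 - 1/2) * h i x + (1/2) * h j x)"
    have "m \<in> S"
      unfolding S_def
    proof (intro CollectI conjI allI)
      show "P (\<lambda>x. ennreal (m x)) \<le> ennreal c"
        unfolding m_def by (rule convex_P) (auto simp: S0[OF hS] SP[OF hS])
      show "m \<in> borel_measurable M" unfolding m_def by measurable
      show "0 \<le> m x" "m x \<le> F x" for x
        using S0[OF hS[of i], of x] S0[OF hS[of j], of x] SF[OF hS[of i], of x] SF[OF hS[of j], of x] by (auto simp: m_def)
    qed
    have "(LINT x|M. (h i x - h j x)^2)
        = (LINT x|M. 2 * (F x - h i x)^2 + 2 * (F x - h j x)^2 - 4 * (F x - m x)^2)"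
      by (intro Bochner_Integration.integral_cong) (auto simp: m_def power2_eq_square field_simps)
    also have "\<dots> = 2 * J (h i) + 2 * J (h j) - 4 * J m"
      using intF[OF hS[of i]] intF[OF hS[of j]] intF[OF \<open>m \<in> S\<close>] by (simp add: J_def)
    also have "\<dots> \<le> 2 * (d + 1 / real (Suc i)) + 2 * (d + 1 / real (Suc j)) - 4 * d"
      using less_imp_le[OF hJ] d_le[OF \<open>m \<in> S\<close>] by (intro diff_mono add_mono mult_left_mono) auto
    also have "\<dots> = 2 / real (Suc i) + 2 / real (Suc j)" by simp
    also have "\<dots> \<le> 2 / real (Suc n) + 2 / real (Suc n)"
      using that by (intro add_mono divide_left_mono) auto
    also have "\<dots> = 4 / real (Suc n)" by simp
    finally show ?thesis .
  qed
  have inth: "integrable M (h n)" for n by (intro int bS hS)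
  have intsq: "integrable M (\<lambda>x. (h i x - h j x)^2)" for i j
    by (intro int bounded_on_intros bS hS)
  have L1_Cauchy: "\<exists>n. \<forall>i\<ge>n. \<forall>j\<ge>n. (LINT x|M. norm (h i x - h j x)) < e" if e: "0 < e" for e
  proof -
    define \<epsilon> where "\<epsilon> = e / (2 * (measure M B + 1))"
    have \<epsilon>: "0 < \<epsilon>" unfolding \<epsilon>_def using e by (intro divide_pos_pos) (auto intro: add_nonneg_pos)
    have \<epsilon>B: "\<epsilon> * measure M B \<le> e / 2"
    proof -
      have "\<epsilon> * (measure M B + 1) = e / 2"
      proof -
        have "e / (2 * k) * k = e / 2" if "k \<noteq> 0" for k :: real using that by simp
        moreover have "measure M B + 1 \<noteq> 0" using measure_nonneg[of M B] by linarith
        ultimately show ?thesis unfolding \<epsilon>_def by blast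
      qed
      moreover have "\<epsilon> * measure M B \<le> \<epsilon> * (measure M B + 1)" using \<epsilon> by simp
      ultimately show ?thesis by simp
    qed
    obtain n where "8 / (\<epsilon> * e) < real n" using reals_Archimedean2 by blast
    then have n: "8 / (\<epsilon> * e) < real (Suc n)" by simp
    have "(LINT x|M. norm (h i x - h j x)) < e" if "n \<le> i" "n \<le> j" for i j
    proof -
      \<comment> \<open>this turns the Cauchy property in \<open>L\<^sup>2\<close> into the one in \<open>L\<^sup>1\<close>\<close>
      have "\<bar>u\<bar> \<le> \<epsilon> + u^2 / \<epsilon>" for u :: real
      proof (cases "\<bar>u\<bar> \<le> \<epsilon>")
        case False
        then have "\<epsilon> * \<bar>u\<bar> \<le> \<bar>u\<bar> * \<bar>u\<bar>" by (intro mult_right_mono) auto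
        then have "\<bar>u\<bar> \<le> u^2 / \<epsilon>" using \<epsilon> by (simp add: field_simps power2_eq_square)
        then show ?thesis using \<epsilon> by linarith
      qed (use \<epsilon> in \<open>auto intro: order_trans\<close>)
      then have "(LINT x|M. norm (h i x - h j x)) \<le> (LINT x|M. \<epsilon> * indicator B x + (h i x - h j x)^2 / \<epsilon>)"
        by (intro integral_mono Bochner_Integration.integrable_add integrable_divide intsq
            integrable_norm Bochner_Integration.integrable_diff inth integrable_mult_right integrable_real_indicator)
           (use finB S00[OF hS] in \<open>auto simp: indicator_def\<close>)
      also have "\<dots> = \<epsilon> * measure M B + (LINT x|M. (h i x - h j x)^2) / \<epsilon>"
        using finB intsq by (subst Bochner_Integration.integral_add) (auto simp: sets.Int_space_eq2)
      also have "\<dots> \<le> e / 2 + (4 / real (Suc n)) / \<epsilon>"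
        using sq_dist[OF that] \<epsilon> \<epsilon>B by (intro add_mono divide_right_mono) auto
      also have "4 / real (Suc n) / \<epsilon> < e / 2"
      proof -
        have "4 / k / \<epsilon> < e / 2" if "8 / (\<epsilon> * e) < k" "0 < k" for k
          using that \<epsilon> e by (simp add: field_simps)
        from this[OF n] show ?thesis by simp
      qed
      finally show ?thesis by simp
    qed
    then show ?thesis by blast
  qed
  obtain r where r: "strict_mono r" and Cau: "AE x in M. Cauchy (\<lambda>i. h (r i) x)"
    using cauchy_L1_AE_cauchy_subseq[of M h, OF inth L1_Cauchy] by blast
  \<comment> \<open>clipping makes the bounds hold also where the sequence does not converge\<close>
  define h0 where "h0 x = max 0 (min (F x) (lim (\<lambda>i. h (r i) x)))" for x
  have [measurable]: "h0 \<in> borel_measurable M"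
    unfolding h0_def[abs_def] by (intro borel_measurable_max borel_measurable_min borel_measurable_lim_metric) auto
  have h0_nonneg: "0 \<le> h0 x" and h0_F: "h0 x \<le> F x" for x
    using F_nonneg by (auto simp: h0_def)
  have lim: "AE x in M. (\<lambda>i. h (r i) x) \<longlonglongrightarrow> h0 x"
    using Cau
  proof eventually_elim
    case (elim x)
    then obtain l where l: "(\<lambda>i. h (r i) x) \<longlonglongrightarrow> l"
      using Cauchy_convergent_iff convergent_def by blast
    then have "0 \<le> l" "l \<le> F x"
      using S0[OF hS] SF[OF hS] by (auto intro: LIMSEQ_le_const LIMSEQ_le_const2)
    with l show ?case by (simp add: h0_def limI)
  qed
  have Ph0: "P (\<lambda>x. ennreal (h0 x)) \<le> ennreal c"
  proof -
    have "P (\<lambda>x. ennreal (h0 x)) \<le> P (\<lambda>x. liminf (\<lambda>i. ennreal (h (r i) x)))"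
    proof (rule mono_AE)
      show "AE x in M. ennreal (h0 x) \<le> liminf (\<lambda>i. ennreal (h (r i) x))"
        using lim
      proof eventually_elim
        case (elim x)
        then have "(\<lambda>i. ennreal (h (r i) x)) \<longlonglongrightarrow> ennreal (h0 x)" by (rule tendsto_ennrealI)
        then show ?case by (simp add: lim_imp_Liminf)
      qed
    qed measurable
    also have "\<dots> \<le> liminf (\<lambda>i. P (\<lambda>x. ennreal (h (r i) x)))"
      by (rule Fatou) auto
    also have "\<dots> \<le> liminf (\<lambda>i. ennreal c)"
      by (intro Liminf_mono always_eventually allI SP[OF hS])
    finally show ?thesis by (simp add: Liminf_const)
  qed
  have h0S: "h0 \<in> S"
    using Ph0 h0_nonneg h0_F by (auto simp: S_def)
  have Jh0: "J h0 \<le> d"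
  proof (rule LIMSEQ_le)
    show "(\<lambda>i. J (h (r i))) \<longlonglongrightarrow> J h0"
      unfolding J_def
    proof (rule integral_dominated_convergence)
      show "integrable M (\<lambda>x. b^2 * indicator B x)"
        using finB by (intro integrable_mult_right integrable_real_indicator) auto
      show "AE x in M. (\<lambda>i. (F x - h (r i) x)\<^sup>2) \<longlonglongrightarrow> (F x - h0 x)\<^sup>2"
        using lim by eventually_elim (intro tendsto_intros)
      show "AE x in M. norm ((F x - h (r i) x)\<^sup>2) \<le> b\<^sup>2 * indicator B x" for i
      proof (intro AE_I2)
        fix x
        have "\<bar>F x - h (r i) x\<bar> \<le> \<bar>b\<bar>"
          using S0[OF hS[of "r i"], of x] SF[OF hS[of "r i"], of x] Fb[of x] by linarith
        then show "norm ((F x - h (r i) x)\<^sup>2) \<le> b\<^sup>2 * indicator B x"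
          using F0[of x] S00[OF hS[of "r i"], of x] by (cases "x \<in> B") (auto simp: abs_le_square_iff)
      qed
    qed auto
    show "(\<lambda>i. d + 1 / real (Suc (r i))) \<longlonglongrightarrow> d"
      using LIMSEQ_subseq_LIMSEQ[OF LIMSEQ_inverse_real_of_nat_add[of d] r]
      by (simp add: o_def inverse_eq_divide)
    show "\<exists>n. \<forall>i\<ge>n. J (h (r i)) \<le> d + 1 / real (Suc (r i))"
      using hJ by (auto intro: less_imp_le)
  qed
  have pos: "0 < J h0"
  proof (rule ccontr)
    assume "\<not> 0 < J h0"
    then have "(LINT x|M. (F x - h0 x)^2) = 0" using J_nonneg[of h0] unfolding J_def by linarith
    then have "AE x in M. (F x - h0 x)^2 = 0"
      using integral_nonneg_eq_0_iff_AE[OF intF[OF h0S]] by simp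
    then have "AE x in M. ennreal (F x) \<le> ennreal (h0 x)" by eventually_elim simp
    then have "P (\<lambda>x. ennreal (F x)) \<le> P (\<lambda>x. ennreal (h0 x))" by (intro mono_AE) auto
    with Ph0 c show False by simp
  qed
  have var: "(LINT x|M. (F x - h0 x) * k x) \<le> (LINT x|M. (F x - h0 x) * h0 x)"
    if [measurable]: "k \<in> borel_measurable M" and k: "\<And>x. 0 \<le> k x" "\<And>x. k x \<le> a * indicator B x"
      and Pk: "P (\<lambda>x. ennreal (k x)) \<le> ennreal c" for k a
  proof -
    have bk: "bounded_on M B k" by (rule bounded_on_nonneg[OF \<open>k \<in> _\<close> k])
    have i1: "integrable M (\<lambda>x. (F x - h0 x) * (k x - h0 x))" and i2: "integrable M (\<lambda>x. (k x - h0 x)^2)"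
      and i3: "integrable M (\<lambda>x. (F x - h0 x) * k x)" and i4: "integrable M (\<lambda>x. (F x - h0 x) * h0 x)"
      by (intro int bounded_on_intros bF bk bS[OF h0S])+
    have "2 * (LINT x|M. (F x - h0 x) * (k x - h0 x)) \<le> t * (LINT x|M. (k x - h0 x)^2)"
      if t: "0 < t" "t < 1" for t
    proof -
      define kt where "kt x = (1 - t) * h0 x + t * k x" for x
      have [measurable]: "kt \<in> borel_measurable M" unfolding kt_def[abs_def] by measurable
      have kt0: "0 \<le> kt x" for x using t h0_nonneg k by (simp add: kt_def)
      have Pkt: "P (\<lambda>x. ennreal (kt x)) \<le> ennreal c"
        unfolding kt_def using t h0_nonneg k Ph0 Pk by (intro convex_P) auto
      \<comment> \<open>the segment from \<open>h0\<close> to \<open>k\<close> may leave the functions below \<open>F\<close>, so it is cut off at \<open>F\<close>\<close>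
      have mS: "(\<lambda>x. min (F x) (kt x)) \<in> S"
      proof -
        have "P (\<lambda>x. ennreal (min (F x) (kt x))) \<le> P (\<lambda>x. ennreal (kt x))"
          by (intro mono) (auto intro: ennreal_leI)
        with Pkt show ?thesis using F_nonneg kt0 by (auto simp: S_def)
      qed
      have iq: "integrable M (\<lambda>x. (F x - h0 x)^2 - 2 * t * ((F x - h0 x) * (k x - h0 x)) + t^2 * (k x - h0 x)^2)"
        using i1 i2 intF[OF h0S] by simp
      have "d \<le> J (\<lambda>x. min (F x) (kt x))" by (rule d_le[OF mS])
      also have "\<dots> \<le> (LINT x|M. (F x - h0 x)^2 - 2 * t * ((F x - h0 x) * (k x - h0 x)) + t^2 * (k x - h0 x)^2)"
        unfolding J_def
      proof (rule integral_mono[OF intF[OF mS] iq])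
        fix x
        have "(F x - min (F x) (kt x))^2 \<le> (F x - kt x)^2"
          by (auto simp: min_def)
        also have "\<dots> = (F x - h0 x)^2 - 2 * t * ((F x - h0 x) * (k x - h0 x)) + t^2 * (k x - h0 x)^2"
          by (simp add: kt_def power2_eq_square algebra_simps)
        finally show "(F x - min (F x) (kt x))^2 \<le> (F x - h0 x)^2 - 2 * t * ((F x - h0 x) * (k x - h0 x)) + t^2 * (k x - h0 x)^2" .
      qed
      also have "\<dots> = J h0 - 2 * t * (LINT x|M. (F x - h0 x) * (k x - h0 x)) + t^2 * (LINT x|M. (k x - h0 x)^2)"
        using i1 i2 intF[OF h0S] by (simp add: J_def)
      finally have "t * (2 * (LINT x|M. (F x - h0 x) * (k x - h0 x))) \<le> t * (t * (LINT x|M. (k x - h0 x)^2))"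
        using Jh0 by (simp add: power2_eq_square)
      then show ?thesis using t by simp
    qed
    then have "2 * (LINT x|M. (F x - h0 x) * (k x - h0 x)) \<le> 0"
      by (rule nonpos_if_le_small_multiple)
    moreover have "(LINT x|M. (F x - h0 x) * (k x - h0 x))
        = (LINT x|M. (F x - h0 x) * k x) - (LINT x|M. (F x - h0 x) * h0 x)"
      using i3 i4 by (simp add: right_diff_distrib)
    ultimately show ?thesis by simp
  qed
  show thesis
  proof (rule that)
    show "0 < (LINT x|M. (F x - h0 x)^2)" using pos by (simp add: J_def)
    fix u :: "'a \<Rightarrow> ennreal" assume [measurable]: "u \<in> borel_measurable M" and Pu: "P u \<le> ennreal c"
    have "(\<integral>\<^sup>+x. ennreal (F x - h0 x) * u x \<partial>M)
        = (\<integral>\<^sup>+x. (SUP n. ennreal ((F x - h0 x) * (trunc u n x * indicator B x))) \<partial>M)"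
    proof (intro nn_integral_cong)
      fix x
      show "ennreal (F x - h0 x) * u x = (SUP n. ennreal ((F x - h0 x) * (trunc u n x * indicator B x)))"
        using F0[of x] h0_nonneg[of x] h0_F[of x]
        by (cases "x \<in> B") (auto simp: ennreal_mult SUP_ennreal_trunc simp flip: SUP_mult_left_ennreal)
    qed
    also have "\<dots> = (SUP n. \<integral>\<^sup>+x. ennreal ((F x - h0 x) * (trunc u n x * indicator B x)) \<partial>M)"
      using h0_F by (intro nn_integral_monotone_convergence_SUP)
        (auto simp: incseq_def le_fun_def intro!: ennreal_leI mult_left_mono mult_right_mono trunc_mono)
    also have "\<dots> \<le> ennreal (LINT x|M. (F x - h0 x) * h0 x)"
    proof (rule SUP_least)
      fix n
      have le: "(LINT x|M. (F x - h0 x) * (trunc u n x * indicator B x)) \<le> (LINT x|M. (F x - h0 x) * h0 x)"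
      proof (rule var)
        have "P (\<lambda>x. ennreal (trunc u n x * indicator B x)) \<le> P u"
          by (intro mono) (auto simp: ennreal_trunc indicator_def)
        with Pu show "P (\<lambda>x. ennreal (trunc u n x * indicator B x)) \<le> ennreal c" by simp
        show "trunc u n x * indicator B x \<le> real n * indicator B x" for x
          by (intro mult_right_mono trunc_le) auto
      qed auto
      have "(\<integral>\<^sup>+x. ennreal ((F x - h0 x) * (trunc u n x * indicator B x)) \<partial>M)
          = ennreal (LINT x|M. (F x - h0 x) * (trunc u n x * indicator B x))"
      proof (rule nn_integral_eq_integral)
        show "integrable M (\<lambda>x. (F x - h0 x) * (trunc u n x * indicator B x))"
          by (intro int bounded_on_intros bF bS[OF h0S] bounded_on_nonneg[where a = "real n"] mult_right_mono trunc_le) auto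
      qed (use h0_F in auto)
      with le show "(\<integral>\<^sup>+x. ennreal ((F x - h0 x) * (trunc u n x * indicator B x)) \<partial>M)
          \<le> ennreal (LINT x|M. (F x - h0 x) * h0 x)"
        by (simp add: ennreal_leI)
    qed
    finally show "(\<integral>\<^sup>+x. ennreal (F x - h0 x) * u x \<partial>M) \<le> ennreal (LINT x|M. (F x - h0 x) * h0 x)" .
  qed (use h0_nonneg h0_F in auto)
qed

text \<open>The nontrivial half of the Lorentz--Luxemburg theorem. The numbers \<open>a\<close> in the hypothesis are the
  bounds for the associate norm of \<open>g\<close>. If the norm of \<open>F\<close> exceeded \<open>c\<close>, then so would
  that of a bounded function below \<open>F\<close> supported in a set of finite measure, and the
  function \<open>g\<close> that separates it from the ball of radius \<open>c\<close> contradicts the hypothesis.\<close>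

lemma norm_le_if_dual_le:
  fixes F :: "'a \<Rightarrow> ennreal"
  assumes P: "function_quasinorm M P 1" and sf: "sigma_finite_measure M"
    and F [measurable]: "F \<in> borel_measurable M"
    and dual: "\<And>g a. g \<in> borel_measurable M \<Longrightarrow> (\<And>x. 0 \<le> g x) \<Longrightarrow> 0 < a \<Longrightarrow>
      (\<And>h. h \<in> borel_measurable M \<Longrightarrow> P h \<le> 1 \<Longrightarrow> (\<integral>\<^sup>+x. h x * ennreal (g x) \<partial>M) \<le> ennreal a) \<Longrightarrow>
      (\<integral>\<^sup>+x. F x * ennreal (g x) \<partial>M) \<le> c * ennreal a"
  shows "P F \<le> c"
proof (rule ccontr)
  interpret function_quasinorm M P 1 by (rule P)
  interpret sigma_finite_measure M by (rule sf)
  assume "\<not> P F \<le> c"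
  then have "c < P F" by simp
  then obtain c1 where c1: "c < c1" "c1 < P F" using dense by blast
  then obtain r where r: "c1 = ennreal r" "0 \<le> r" by (cases c1) auto
  then have r0: "0 < r" using c1 by (cases "r = 0") auto
  obtain A :: "nat \<Rightarrow> 'a set" where A: "range A \<subseteq> sets M" "(\<Union>i. A i) = space M"
    "\<And>i. emeasure M (A i) \<noteq> \<infinity>" "incseq A"
    using sigma_finite_incseq by metis
  have [measurable]: "A n \<in> sets M" for n using A by auto
  have "P F = P (\<lambda>x. SUP n. ennreal (trunc F n x * indicator (A n) x))"
  proof (intro antisym mono)
    have lim: "(\<lambda>n. ennreal (trunc F n x * indicator (A n) x)) \<longlonglongrightarrow> F x" if "x \<in> space M" for x
    proof -
      from that obtain i where i: "x \<in> A i" using A by blast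
      have "(\<lambda>n. ennreal (trunc F n x)) \<longlonglongrightarrow> F x"
        using LIMSEQ_SUP[of "\<lambda>n. ennreal (trunc F n x)"] SUP_ennreal_trunc[of F x]
        by (auto simp: incseq_def intro!: ennreal_leI trunc_mono)
      moreover have "\<forall>\<^sub>F n in sequentially. ennreal (trunc F n x) = ennreal (trunc F n x * indicator (A n) x)"
        using eventually_ge_at_top[of i]
      proof eventually_elim
        case (elim n) then show ?case using i A(4) by (auto simp: incseq_def indicator_def)
      qed
      ultimately show ?thesis by (rule Lim_transform_eventually)
    qed
    show "F x \<le> (SUP n. ennreal (trunc F n x * indicator (A n) x))" if "x \<in> space M" for x
      by (rule LIMSEQ_le_const2[OF lim[OF that]]) (intro exI allI impI SUP_upper UNIV_I)
    show "(SUP n. ennreal (trunc F n x * indicator (A n) x)) \<le> F x" for x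
      by (intro SUP_least) (simp add: indicator_def ennreal_trunc)
  qed auto
  also have "\<dots> = (SUP n. P (\<lambda>x. ennreal (trunc F n x * indicator (A n) x)))"
    using A(4) by (intro SUP_eq) (auto simp: incseq_def indicator_def intro!: ennreal_leI trunc_mono)
  finally obtain n where n: "c1 < P (\<lambda>x. ennreal (trunc F n x * indicator (A n) x))"
    using c1 by (auto simp: less_SUP_iff)
  define F1 where "F1 x = trunc F n x * indicator (A n) x" for x
  have [measurable]: "F1 \<in> borel_measurable M" unfolding F1_def[abs_def] by measurable
  have F1: "0 \<le> F1 x" "F1 x \<le> real n * indicator (A n) x" for x
    unfolding F1_def by (auto intro!: mult_right_mono trunc_le)
  obtain h0 where [measurable]: "h0 \<in> borel_measurable M" and h0: "\<And>x. 0 \<le> h0 x" "\<And>x. h0 x \<le> F1 x"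
    and pos: "0 < (LINT x|M. (F1 x - h0 x)^2)"
    and proj: "\<And>h. h \<in> borel_measurable M \<Longrightarrow> P h \<le> ennreal r \<Longrightarrow>
       (\<integral>\<^sup>+x. ennreal (F1 x - h0 x) * h x \<partial>M) \<le> ennreal (LINT x|M. (F1 x - h0 x) * h0 x)"
    using norm_ball_projection[OF P \<open>F1 \<in> _\<close> F1, of r] n A(3)[of n] r
    by (auto simp: F1_def less_top)
  note int = integrable_if_bounded_on[of "A n" M]
  have bF: "bounded_on M (A n) F1" by (rule bounded_on_nonneg[OF \<open>F1 \<in> _\<close> F1])
  have bh: "bounded_on M (A n) h0" by (rule bounded_on_nonneg[OF \<open>h0 \<in> _\<close> h0(1) order_trans[OF h0(2) F1(2)]])
  define I where "I = (LINT x|M. (F1 x - h0 x) * h0 x)"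
  have I0: "0 \<le> I" unfolding I_def using h0 by auto
  have i: "integrable M (\<lambda>x. (F1 x - h0 x) * h0 x)" "integrable M (\<lambda>x. (F1 x - h0 x)^2)" "integrable M (\<lambda>x. (F1 x - h0 x) * F1 x)"
    using A(3)[of n] by (auto intro!: int bounded_on_intros bF bh simp: less_top)
  define D where "D = (LINT x|M. (F1 x - h0 x)^2)"
  \<comment> \<open>strictly between the bound \<open>I / r\<close> for \<open>\<integral>g h\<close> over the unit ball and \<open>(\<integral>g F1) / r = (I + D) / r\<close>, with \<open>g = F1 - h0\<close>\<close>
  define a where "a = (I + D / 2) / r"
  have a0: "0 < a" using I0 pos r0 by (simp add: a_def D_def)
  have "(\<integral>\<^sup>+x. F x * ennreal (F1 x - h0 x) \<partial>M) \<le> c * ennreal a"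
  proof (rule dual)
    fix h :: "'a \<Rightarrow> ennreal" assume [measurable]: "h \<in> borel_measurable M" and "P h \<le> 1"
    have "ennreal r * (\<integral>\<^sup>+x. h x * ennreal (F1 x - h0 x) \<partial>M) = (\<integral>\<^sup>+x. ennreal (F1 x - h0 x) * (ennreal r * h x) \<partial>M)"
      by (simp add: ac_simps flip: nn_integral_cmult)
    also have "\<dots> \<le> ennreal I"
      unfolding I_def
    proof (rule proj)
      have "P (\<lambda>x. ennreal r * h x) = ennreal r * P h" using r0 by (intro scale) auto
      also have "\<dots> \<le> ennreal r * 1" using \<open>P h \<le> 1\<close> by (rule mult_left_mono) simp
      finally show "P (\<lambda>x. ennreal r * h x) \<le> ennreal r" by simp
    qed auto
    also have "\<dots> \<le> ennreal r * ennreal a"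
      using r0 pos I0 by (simp add: a_def D_def ennreal_leI flip: ennreal_mult)
    finally show "(\<integral>\<^sup>+x. h x * ennreal (F1 x - h0 x) \<partial>M) \<le> ennreal a"
      using r0 by (subst (asm) ennreal_mult_le_mult_iff) auto
  qed (use h0 a0 in auto)
  also have "\<dots> \<le> ennreal r * ennreal a" using c1 r by (intro mult_right_mono) auto
  also have "\<dots> = ennreal (I + D / 2)" using r0 by (simp add: a_def flip: ennreal_mult')
  finally have le: "(\<integral>\<^sup>+x. F x * ennreal (F1 x - h0 x) \<partial>M) \<le> ennreal (I + D / 2)" .
  have "ennreal (I + D) = ennreal (LINT x|M. (F1 x - h0 x) * h0 x + (F1 x - h0 x)^2)"
    unfolding I_def D_def using i by (subst Bochner_Integration.integral_add) auto
  also have "\<dots> = ennreal (LINT x|M. (F1 x - h0 x) * F1 x)"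
    by (simp add: power2_eq_square algebra_simps)
  also have "\<dots> = (\<integral>\<^sup>+x. ennreal ((F1 x - h0 x) * F1 x) \<partial>M)"
    using i(3) h0 F1 by (intro nn_integral_eq_integral[symmetric]) auto
  also have "\<dots> \<le> (\<integral>\<^sup>+x. F x * ennreal (F1 x - h0 x) \<partial>M)"
  proof (rule nn_integral_mono)
    fix x
    have "ennreal (F1 x) \<le> F x" by (simp add: F1_def ennreal_trunc indicator_def)
    then show "ennreal ((F1 x - h0 x) * F1 x) \<le> F x * ennreal (F1 x - h0 x)"
      using h0[of x] F1[of x] by (simp add: ennreal_mult mult.commute mult_right_mono)
  qed
  finally have "ennreal (I + D) \<le> ennreal (I + D / 2)" using le by (rule order_trans)
  then show False using I0 pos by (simp add: D_def)
qed

section \<open>Averaging operators\<close>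

definition kernel_op :: "'a measure \<Rightarrow> ('a \<Rightarrow> 'a \<Rightarrow> ennreal) \<Rightarrow> ('a \<Rightarrow> ennreal) \<Rightarrow> 'a \<Rightarrow> ennreal" where
  "kernel_op M k u x = (\<integral>\<^sup>+y. k x y * u y \<partial>M)"

locale symmetric_submarkov = sigma_finite_measure M for M :: "'a measure" +
  fixes k :: "'a \<Rightarrow> 'a \<Rightarrow> ennreal"
  assumes kernel_measurable [measurable]: "case_prod k \<in> borel_measurable (M \<Otimes>\<^sub>M M)"
    and kernel_sym: "k x y = k y x"
    and kernel_mass: "x \<in> space M \<Longrightarrow> (\<integral>\<^sup>+y. k x y \<partial>M) \<le> 1"
begin

abbreviation T :: "('a \<Rightarrow> ennreal) \<Rightarrow> 'a \<Rightarrow> ennreal" where "T \<equiv> kernel_op M k"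

lemma section_measurable [measurable]: "x \<in> space M \<Longrightarrow> k x \<in> borel_measurable M"
  using measurable_Pair2[OF kernel_measurable, of x] by simp

lemma op_measurable [measurable]:
  assumes [measurable]: "u \<in> borel_measurable M" shows "T u \<in> borel_measurable M"
  unfolding kernel_op_def[abs_def] by measurable

lemma op_mono: "(\<And>y. y \<in> space M \<Longrightarrow> u y \<le> v y) \<Longrightarrow> T u x \<le> T v x"
  unfolding kernel_op_def by (intro nn_integral_mono mult_left_mono) auto

lemma op_cmult:
  assumes [measurable]: "u \<in> borel_measurable M" and x: "x \<in> space M"
  shows "T (\<lambda>y. c * u y) x = c * T u x"
  unfolding kernel_op_def using x
  by (subst nn_integral_cmult[symmetric]) (auto simp: ac_simps)

lemma op_add:
  assumes [measurable]: "u \<in> borel_measurable M" "v \<in> borel_measurable M" and x: "x \<in> space M"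
  shows "T (\<lambda>y. u y + v y) x = T u x + T v x"
  unfolding kernel_op_def using x by (simp add: distrib_left nn_integral_add)

lemma op_const_le:
  assumes x: "x \<in> space M" shows "T (\<lambda>y. c) x \<le> c"
proof -
  have "T (\<lambda>y. c) x = (\<integral>\<^sup>+y. k x y \<partial>M) * c"
    unfolding kernel_op_def using x by (intro nn_integral_multc) auto
  also have "\<dots> \<le> 1 * c" using kernel_mass[OF x] by (rule mult_right_mono) simp
  finally show ?thesis by simp
qed

lemma op_SUP:
  fixes u :: "nat \<Rightarrow> 'a \<Rightarrow> ennreal"
  assumes [measurable]: "\<And>n. u n \<in> borel_measurable M" and inc: "\<And>y. incseq (\<lambda>n. u n y)"
    and x: "x \<in> space M"
  shows "T (\<lambda>y. SUP n. u n y) x = (SUP n. T (u n) x)"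
proof -
  have "(\<integral>\<^sup>+y. (SUP n. k x y * u n y) \<partial>M) = (SUP n. \<integral>\<^sup>+y. k x y * u n y \<partial>M)"
    using inc x by (intro nn_integral_monotone_convergence_SUP)
      (auto simp: incseq_def le_fun_def intro: mult_left_mono)
  then show ?thesis by (simp add: kernel_op_def SUP_mult_left_ennreal)
qed

lemma op_symmetric:
  assumes [measurable]: "u \<in> borel_measurable M" "v \<in> borel_measurable M"
  shows "(\<integral>\<^sup>+x. T u x * v x \<partial>M) = (\<integral>\<^sup>+x. u x * T v x \<partial>M)"
proof -
  interpret pair_sigma_finite M M ..
  have "(\<integral>\<^sup>+x. T u x * v x \<partial>M) = (\<integral>\<^sup>+x. \<integral>\<^sup>+y. k x y * u y * v x \<partial>M \<partial>M)"
    unfolding kernel_op_def by (intro nn_integral_cong nn_integral_multc[symmetric]) auto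
  also have "\<dots> = (\<integral>\<^sup>+y. \<integral>\<^sup>+x. k x y * u y * v x \<partial>M \<partial>M)"
    by (rule Fubini') measurable
  also have "\<dots> = (\<integral>\<^sup>+y. \<integral>\<^sup>+x. u y * (k y x * v x) \<partial>M \<partial>M)"
    by (intro nn_integral_cong) (simp add: kernel_sym ac_simps)
  also have "\<dots> = (\<integral>\<^sup>+y. u y * T v y \<partial>M)"
    unfolding kernel_op_def by (intro nn_integral_cong nn_integral_cmult) auto
  finally show ?thesis .
qed

text \<open>Jensen's inequality up to a factor \<open>2\<close>, which follows from \<open>t \<le> \<lambda>\<^bsup>1-r\<^esup> t\<^bsup>r\<^esup> + \<lambda>\<close>
  upon choosing \<open>\<lambda>\<^bsup>r\<^esup> = T (u\<^bsup>r\<^esup>) x\<close>.\<close>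

lemma op_Jensen:
  assumes u [measurable]: "u \<in> borel_measurable M" and x: "x \<in> space M" and r: "1 \<le> r"
  shows "T u x \<le> 2 * ennpowr (T (\<lambda>y. ennpowr (u y) r) x) (1 / r)"
proof (cases "T (\<lambda>y. ennpowr (u y) r) x")
  case (real a)
  have young: "t \<le> ennreal (l powr (1 - r)) * ennpowr t r + ennreal l" if l: "0 < l" for t l
  proof (cases t)
    case (real s)
    show ?thesis
    proof (cases "s \<le> l")
      case True then show ?thesis using real l by (simp add: ennreal_leI add_increasing)
    next
      case False
      then have "1 \<le> (s / l) powr (r - 1)" using l r by (intro ge_one_powr_ge_zero) auto
      then have "s \<le> s * (s / l) powr (r - 1)" using False l by simp
      also have "\<dots> = l powr (1 - r) * s powr r"
        using False l by (simp add: powr_divide powr_diff field_simps)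
      finally show ?thesis
        using real l by (simp add: ennpowr_ennreal add_increasing2 ennreal_leI flip: ennreal_mult)
    qed
  qed (use l in \<open>simp add: ennreal_mult_top\<close>)
  have le: "T u x \<le> 2 * ennreal l" if l: "0 < l" "a \<le> l powr r" for l
  proof -
    have "T u x \<le> T (\<lambda>y. ennreal (l powr (1 - r)) * ennpowr (u y) r + ennreal l) x"
      by (intro op_mono young l)
    also have "\<dots> = ennreal (l powr (1 - r)) * ennreal a + T (\<lambda>y. ennreal l) x"
      using x by (simp add: op_add op_cmult real)
    also have "\<dots> \<le> ennreal (l powr (1 - r)) * ennreal (l powr r) + ennreal l"
      using x l by (intro add_mono mult_left_mono op_const_le ennreal_leI) auto
    also have "\<dots> = 2 * ennreal l"
      using l by (simp flip: ennreal_mult powr_add add: mult_2)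
    finally show ?thesis .
  qed
  show ?thesis
  proof (cases "a = 0")
    case False
    then show ?thesis using le[of "a powr (1 / r)"] real r by (simp add: powr_powr ennpowr_ennreal)
  next
    case True
    have "T u x \<le> 0"
    proof (rule ennreal_le_epsilon)
      fix e :: real assume "0 < e"
      then show "T u x \<le> 0 + ennreal e"
        using le[of "e / 2"] True by (simp flip: ennreal_numeral ennreal_mult)
    qed
    then show ?thesis by simp
  qed
qed simp

text \<open>By symmetry \<open>\<integral>(T u) g = \<integral>u (T g)\<close>, so a bound for \<open>T\<close> on the associate space, which is the
  hypothesis \<open>dual\<close>, gives one for \<open>T u\<close> by duality.\<close>

lemma op_bounded_if_dual_bounded:
  assumes P: "function_quasinorm M P 1" and A: "0 < A"
    and dual: "\<And>g a h. g \<in> borel_measurable M \<Longrightarrow> (\<And>x. 0 \<le> g x) \<Longrightarrow> 0 < a \<Longrightarrow>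
      (\<And>h. h \<in> borel_measurable M \<Longrightarrow> P h \<le> 1 \<Longrightarrow> (\<integral>\<^sup>+x. h x * ennreal (g x) \<partial>M) \<le> ennreal a) \<Longrightarrow>
      h \<in> borel_measurable M \<Longrightarrow> P h \<le> 1 \<Longrightarrow> (\<integral>\<^sup>+x. h x * T (\<lambda>y. ennreal (g y)) x \<partial>M) \<le> ennreal (A * a)"
    and u [measurable]: "u \<in> borel_measurable M"
  shows "P (T u) \<le> ennreal A * P u"
proof (cases "P u")
  case top then show ?thesis using A by (simp add: ennreal_mult_top)
next
  case (real p0)
  interpret function_quasinorm M P 1 by (rule P)
  show ?thesis
  proof (rule norm_le_if_dual_le[OF P])
    show "sigma_finite_measure M" ..
    fix g :: "'a \<Rightarrow> real" and a assume [measurable]: "g \<in> borel_measurable M" and g: "\<And>x. 0 \<le> g x" and a: "0 < a"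
      and bd: "\<And>h. h \<in> borel_measurable M \<Longrightarrow> P h \<le> 1 \<Longrightarrow> (\<integral>\<^sup>+x. h x * ennreal (g x) \<partial>M) \<le> ennreal a"
    have le: "(\<integral>\<^sup>+x. u x * T (\<lambda>y. ennreal (g y)) x \<partial>M) \<le> ennreal (b * (A * a))" if b: "p0 < b" for b
    proof -
      have b0: "0 < b" using b real by simp
      have "(\<integral>\<^sup>+x. u x * T (\<lambda>y. ennreal (g y)) x \<partial>M)
          = (\<integral>\<^sup>+x. ennreal b * ((ennreal (1 / b) * u x) * T (\<lambda>y. ennreal (g y)) x) \<partial>M)"
        using b0 by (simp flip: mult.assoc ennreal_mult)
      also have "\<dots> = ennreal b * (\<integral>\<^sup>+x. (ennreal (1 / b) * u x) * T (\<lambda>y. ennreal (g y)) x \<partial>M)"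
        by (intro nn_integral_cmult) measurable
      also have "\<dots> \<le> ennreal b * ennreal (A * a)"
      proof (intro mult_left_mono dual g a bd)
        show "P (\<lambda>x. ennreal (1 / b) * u x) \<le> 1"
          using b b0 real by (simp add: scale flip: ennreal_mult)
      qed auto
      finally show ?thesis using b0 A a by (simp add: ennreal_mult)
    qed
    have "(\<integral>\<^sup>+x. u x * T (\<lambda>y. ennreal (g y)) x \<partial>M) \<le> ennreal (p0 * (A * a))"
    proof (rule ennreal_le_epsilon)
      fix e :: real assume e: "0 < e"
      have "(p0 + e / (A * a)) * (A * a) = p0 * (A * a) + e" using A a by (simp add: field_simps)
      then show "(\<integral>\<^sup>+x. u x * T (\<lambda>y. ennreal (g y)) x \<partial>M) \<le> ennreal (p0 * (A * a)) + ennreal e"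
        using le[of "p0 + e / (A * a)"] A a e real by simp
    qed
    then show "(\<integral>\<^sup>+x. T u x * ennreal (g x) \<partial>M) \<le> ennreal A * P u * ennreal a"
      using A a real by (subst op_symmetric) (auto simp: ennreal_mult ac_simps)
  qed auto
qed

text \<open>The maximal function itself need not be measurable; it serves only as a majorant of \<open>T g\<close>, which
  is measurable.\<close>

lemma op_bounded_if_maximal_bounded:
  assumes bb: "ball_banach M \<rho> N" and A: "0 < A" "hl_opnorm_assoc M \<rho> N \<le> ennreal A"
    and max: "\<And>g x. g \<in> borel_measurable M \<Longrightarrow> (\<And>x. 0 \<le> g x) \<Longrightarrow> x \<in> space M \<Longrightarrow>
      T (\<lambda>y. ennreal (g y)) x \<le> hl_maximal M \<rho> (\<lambda>y. complex_of_real (g y)) x"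
    and u [measurable]: "u \<in> borel_measurable M"
  shows "ext_norm N (T u) \<le> ennreal A * ext_norm N u"
proof -
  have bqb: "ball_quasi_banach M \<rho> N" using bb by (simp add: ball_banach_def)
  have P: "function_quasinorm M (ext_norm N) 1"
    using bb by (intro function_quasinorm_ext_norm_if[OF bqb]) (auto simp: ball_banach_def)
  interpret function_quasinorm M "ext_norm N" 1 by (rule P)
  show ?thesis
  proof (rule op_bounded_if_dual_bounded[OF P A(1) _ u])
    fix g :: "'a \<Rightarrow> real" and a :: real and h :: "'a \<Rightarrow> ennreal"
    assume [measurable]: "g \<in> borel_measurable M" and g: "\<And>x. 0 \<le> g x" and a: "0 < a"
      and bd: "\<And>h. h \<in> borel_measurable M \<Longrightarrow> ext_norm N h \<le> 1 \<Longrightarrow> (\<integral>\<^sup>+x. h x * ennreal (g x) \<partial>M) \<le> ennreal a"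
      and [measurable]: "h \<in> borel_measurable M" and h: "ext_norm N h \<le> 1"
    define f where "f x = complex_of_real (g x / a)" for x
    have [measurable]: "f \<in> borel_measurable M" unfolding f_def[abs_def] by measurable
    have ga: "ennreal (g x) = ennreal a * ennreal (g x / a)" for x
      using a g by (simp flip: ennreal_mult)
    have cf: "ennreal (cmod (f x)) = ennreal (g x / a)" for x
      using a g[of x] by (simp add: f_def norm_divide)
    have "assoc_norm M N (\<lambda>x. ennreal (cmod (f x))) \<le> 1"
      unfolding assoc_norm_def
    proof (rule SUP_least)
      fix v :: "'a \<Rightarrow> complex" assume v: "v \<in> {g \<in> borel_measurable M. N g \<le> 1}"
      then have [measurable]: "v \<in> borel_measurable M" by simp
      have "ennreal a * (\<integral>\<^sup>+x. ennreal (cmod (f x)) * ennreal (cmod (v x)) \<partial>M)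
          = (\<integral>\<^sup>+x. ennreal (cmod (v x)) * ennreal (g x) \<partial>M)"
        by (subst nn_integral_cmult[symmetric]) (auto simp: cf ga ac_simps)
      also have "\<dots> \<le> ennreal a" using v by (intro bd) (auto simp: ext_norm_cmod[OF bqb])
      finally have "ennreal a * (\<integral>\<^sup>+x. ennreal (cmod (f x)) * ennreal (cmod (v x)) \<partial>M) \<le> ennreal a * 1"
        by simp
      then show "(\<integral>\<^sup>+x. ennreal (cmod (f x)) * ennreal (cmod (v x)) \<partial>M) \<le> 1"
        using a by (subst (asm) ennreal_mult_le_mult_iff) auto
    qed
    then have opn: "assoc_norm M N (hl_maximal M \<rho> f) \<le> ennreal A"
      using A(2) unfolding hl_opnorm_assoc_def by (auto simp: SUP_le_iff)
    have dom: "T (\<lambda>y. ennreal (g y / a)) x \<le> hl_maximal M \<rho> f x" if "x \<in> space M" for x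
      unfolding f_def by (rule max) (use a g that in auto)
    have tr: "(\<integral>\<^sup>+x. ennreal (trunc h n x) * T (\<lambda>y. ennreal (g y / a)) x \<partial>M) \<le> ennreal A" for n
    proof -
      have "(\<integral>\<^sup>+x. ennreal (trunc h n x) * T (\<lambda>y. ennreal (g y / a)) x \<partial>M)
          \<le> (\<integral>\<^sup>+x. hl_maximal M \<rho> f x * ennreal (cmod (complex_of_real (trunc h n x))) \<partial>M)"
        by (intro nn_integral_mono) (simp add: mult.commute[of "ennreal (trunc h n _)"] mult_right_mono dom)
      also have "\<dots> \<le> assoc_norm M N (hl_maximal M \<rho> f)"
        unfolding assoc_norm_def
      proof (rule SUP_upper)
        have "N (\<lambda>x. complex_of_real (trunc h n x)) \<le> ext_norm N h"
          unfolding ext_norm_def by (rule SUP_upper) simp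
        with h show "(\<lambda>x. complex_of_real (trunc h n x)) \<in> {g \<in> borel_measurable M. N g \<le> 1}"
          by simp
      qed
      finally show ?thesis using opn by simp
    qed
    have "(\<integral>\<^sup>+x. h x * T (\<lambda>y. ennreal (g y)) x \<partial>M)
        = (\<integral>\<^sup>+x. ennreal a * (h x * T (\<lambda>y. ennreal (g y / a)) x) \<partial>M)"
      by (intro nn_integral_cong) (simp add: ga op_cmult ac_simps)
    also have "\<dots> = ennreal a * (\<integral>\<^sup>+x. (SUP n. ennreal (trunc h n x) * T (\<lambda>y. ennreal (g y / a)) x) \<partial>M)"
      by (subst nn_integral_cmult) (simp_all add: SUP_ennreal_trunc flip: SUP_mult_right_ennreal)
    also have "(\<integral>\<^sup>+x. (SUP n. ennreal (trunc h n x) * T (\<lambda>y. ennreal (g y / a)) x) \<partial>M)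
        = (SUP n. \<integral>\<^sup>+x. ennreal (trunc h n x) * T (\<lambda>y. ennreal (g y / a)) x \<partial>M)"
      by (intro nn_integral_monotone_convergence_SUP)
        (auto simp: incseq_def le_fun_def intro!: mult_right_mono ennreal_leI trunc_mono)
    also have "ennreal a * \<dots> \<le> ennreal a * ennreal A" by (intro mult_left_mono SUP_least tr) simp
    finally show "(\<integral>\<^sup>+x. h x * T (\<lambda>y. ennreal (g y)) x \<partial>M) \<le> ennreal (A * a)"
      using A a by (simp add: ennreal_mult mult.commute)
  qed
qed

end

section \<open>The endpoint\<close>

definition maximal_dominates ::
    "'a measure \<Rightarrow> ('a \<Rightarrow> 'a \<Rightarrow> real) \<Rightarrow> ('a \<Rightarrow> 'a \<Rightarrow> ennreal) \<Rightarrow> bool" where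
  "maximal_dominates M \<rho> k \<longleftrightarrow> (\<forall>g x. g \<in> borel_measurable M \<longrightarrow> (\<forall>x. 0 \<le> g x) \<longrightarrow> x \<in> space M \<longrightarrow>
      kernel_op M k (\<lambda>y. ennreal (g y)) x \<le> hl_maximal M \<rho> (\<lambda>y. complex_of_real (g y)) x)"

text \<open>The norm of \<open>Y\<^bsup>1/(p\<theta>)\<^esup>\<close> at \<open>h\<close> is a power of the norm of \<open>h\<^bsup>1/(p\<theta>)\<^esup>\<close> in \<open>Y\<close>. For \<open>u \<le> 1\<close> also \<open>T u \<le> 1\<close>,
  the function \<open>u\<^bsup>1/(p\<theta>)\<^esup>\<close> stays below \<open>u\<^bsup>1/p\<^esup>\<close>, and \<open>(T u)\<^bsup>1/(p\<theta>)\<^esup>\<close> converges to \<open>(T u)\<^bsup>1/p\<^esup>\<close>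
  as \<open>\<theta> \<rightarrow> 1\<close>, so the uniform bounds pass to the limit by Fatou's lemma. Homogeneity and monotone
  convergence remove the restriction \<open>u \<le> 1\<close>.\<close>

lemma op_bounded_if_endpoint_bounded:
  assumes bqb: "ball_quasi_banach M \<rho> N" and p: "0 < p" and ep: "hl_endpoint_bounded M \<rho> N p"
  obtains A where "0 < A"
    "\<And>k u. symmetric_submarkov M k \<Longrightarrow> maximal_dominates M \<rho> k \<Longrightarrow> u \<in> borel_measurable M \<Longrightarrow>
      ext_norm N (\<lambda>x. ennpowr (kernel_op M k u x) (1 / p)) \<le> ennreal A * ext_norm N (\<lambda>x. ennpowr (u x) (1 / p))"
proof -
  obtain K where "function_quasinorm M (ext_norm N) K"
    using function_quasinorm_ext_norm[OF bqb] by blast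
  then interpret function_quasinorm M "ext_norm N" K .
  obtain \<theta> L where \<theta>: "\<And>m::nat. 0 < \<theta> m" "\<And>m. \<theta> m < 1" "\<theta> \<longlonglongrightarrow> 1"
    and bb: "\<And>m. ball_banach M \<rho> (pow_norm (1 / (p * \<theta> m)) N)"
    and L: "L < \<infinity>" "(\<lambda>m. hl_opnorm_assoc M \<rho> (pow_norm (1 / (p * \<theta> m)) N)) \<longlonglongrightarrow> L"
    using ep unfolding hl_endpoint_bounded_def by blast
  obtain l where l: "L = ennreal l" "0 \<le> l" using L by (cases L) auto
  define B where "B = l + 1"
  have B: "1 \<le> B" using l by (simp add: B_def)
  have evB: "\<forall>\<^sub>F m in sequentially. hl_opnorm_assoc M \<rho> (pow_norm (1 / (p * \<theta> m)) N) \<le> ennreal B"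
  proof -
    have "L < ennreal B" using l by (simp add: B_def ennreal_less_iff)
    from order_tendstoD(2)[OF L(2) this] show ?thesis by eventually_elim simp
  qed
  have ev\<theta>: "\<forall>\<^sub>F m in sequentially. 1 / 2 < \<theta> m"
    using \<theta>(3) by (rule order_tendstoD) simp
  define t where "t m = 1 / (p * \<theta> m)" for m
  have t: "0 < t m" "1 / p \<le> t m" for m
    using p \<theta>(1)[of m] \<theta>(2)[of m] unfolding t_def by (auto intro!: divide_left_mono)
  have t_lim: "t \<longlonglongrightarrow> 1 / p"
    unfolding t_def[abs_def] using \<theta>(3) p by (auto intro!: tendsto_eq_intros)
  \<comment> \<open>as \<open>\<theta> m > 1/2\<close> eventually, \<open>t m < 2 / p\<close>\<close>
  define A where "A = B powr (2 / p)"
  have A: "0 < A" using B by (simp add: A_def)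
  show thesis
  proof (rule that[OF A])
    fix k and u :: "'a \<Rightarrow> ennreal"
    assume "symmetric_submarkov M k" and max: "maximal_dominates M \<rho> k" and u [measurable]: "u \<in> borel_measurable M"
    then interpret symmetric_submarkov M k by simp
    let ?P = "\<lambda>u. ext_norm N (\<lambda>x. ennpowr (u x) (1 / p))"
    have step: "\<forall>\<^sub>F m in sequentially. ext_norm N (\<lambda>x. ennpowr (T v x) (t m)) \<le> ennreal A * ext_norm N (\<lambda>x. ennpowr (v x) (t m))"
      if [measurable]: "v \<in> borel_measurable M" for v
      using evB ev\<theta>
    proof eventually_elim
      case (elim m)
      have "ext_norm (pow_norm (t m) N) (T v) \<le> ennreal B * ext_norm (pow_norm (t m) N) v"
      proof (rule op_bounded_if_maximal_bounded)
        show "ball_banach M \<rho> (pow_norm (t m) N)" unfolding t_def by (rule bb)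
        show "hl_opnorm_assoc M \<rho> (pow_norm (t m) N) \<le> ennreal B" unfolding t_def by (rule elim)
      qed (use B max in \<open>auto simp: maximal_dominates_def\<close>)
      then have "ennpowr (ennpowr (ext_norm N (\<lambda>x. ennpowr (T v x) (t m))) (1 / t m)) (t m)
          \<le> ennpowr (ennreal B * ennpowr (ext_norm N (\<lambda>x. ennpowr (v x) (t m))) (1 / t m)) (t m)"
        using t(1)[of m] by (intro ennpowr_mono) (simp_all add: ext_norm_pow_norm[OF bqb])
      also have "\<dots> = ennreal (B powr t m) * ext_norm N (\<lambda>x. ennpowr (v x) (t m))"
        using t(1)[of m] B by (simp add: ennpowr_mult ennpowr_ennreal)
      also have "\<dots> \<le> ennreal A * ext_norm N (\<lambda>x. ennpowr (v x) (t m))"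
      proof (intro mult_right_mono ennreal_leI)
        have "t m \<le> 2 / p" using elim p by (simp add: t_def field_simps)
        then show "B powr t m \<le> A" unfolding A_def using B by (rule powr_mono)
      qed simp
      finally show ?case using t(1)[of m] by simp
    qed
    have le1: "?P (T v) \<le> ennreal A * ?P v"
      if [measurable]: "v \<in> borel_measurable M" and v1: "\<And>x. v x \<le> 1" for v
    proof -
      have "liminf (\<lambda>m. ennpowr (T v x) (t m)) = ennpowr (T v x) (1 / p)" for x
        using p by (intro lim_imp_Liminf ennpowr_tendsto_exponent t_lim) auto
      then have "?P (T v) = ext_norm N (\<lambda>x. liminf (\<lambda>m. ennpowr (T v x) (t m)))"
        by simp
      also have "\<dots> \<le> liminf (\<lambda>m. ext_norm N (\<lambda>x. ennpowr (T v x) (t m)))"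
        by (rule Fatou) measurable
      also have "\<dots> \<le> liminf (\<lambda>m. ennreal A * ?P v)"
      proof (rule Liminf_mono)
        show "\<forall>\<^sub>F m in sequentially. ext_norm N (\<lambda>x. ennpowr (T v x) (t m)) \<le> ennreal A * ?P v"
          using step[OF that(1)]
        proof eventually_elim
          case (elim m)
          have "ext_norm N (\<lambda>x. ennpowr (v x) (t m)) \<le> ?P v"
            using v1 t[of m] p by (intro mono ennpowr_antimono_exponent) auto
          then show ?case using elim by (meson mult_left_mono order_trans zero_le)
        qed
      qed
      finally show ?thesis by (simp add: Liminf_const)
    qed
    have bounded: "?P (T v) \<le> ennreal A * ?P v"
      if [measurable]: "v \<in> borel_measurable M" and c: "0 < c" "\<And>x. v x \<le> ennreal c" for v c
    proof -
      define w where "w x = ennreal (1 / c) * v x" for x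
      have [measurable]: "w \<in> borel_measurable M" unfolding w_def[abs_def] by measurable
      have vw: "v x = ennreal c * w x" for x
        unfolding w_def using c by (simp flip: mult.assoc ennreal_mult)
      have "w x \<le> ennreal (1 / c) * ennreal c" for x
        unfolding w_def by (intro mult_left_mono c) simp
      then have w1: "w x \<le> 1" for x using c by (simp flip: ennreal_mult)
      have s: "ext_norm N (\<lambda>x. ennpowr (ennreal c * z x) (1 / p)) = ennreal (c powr (1 / p)) * ?P z"
        if [measurable]: "z \<in> borel_measurable M" for z
        using p c by (simp add: ennpowr_mult ennpowr_ennreal scale)
      have "?P (T v) \<le> ext_norm N (\<lambda>x. ennpowr (ennreal c * T w x) (1 / p))"
        by (intro mono) (simp_all add: vw[abs_def] op_cmult)
      also have "\<dots> = ennreal (c powr (1 / p)) * ?P (T w)" by (rule s) simp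
      also have "\<dots> \<le> ennreal (c powr (1 / p)) * (ennreal A * ?P w)"
        using w1 by (intro mult_left_mono le1) auto
      also have "\<dots> = ennreal A * ?P v"
        by (simp add: vw[abs_def] s ac_simps)
      finally show ?thesis .
    qed
    have inc: "incseq (\<lambda>n. ennreal (trunc u n x))" for x
      by (auto simp: incseq_def intro!: ennreal_leI trunc_mono)
    have "?P (T u) \<le> ext_norm N (\<lambda>x. SUP n. ennpowr (T (\<lambda>y. ennreal (trunc u n y)) x) (1 / p))"
    proof (rule mono)
      fix x assume x: "x \<in> space M"
      have "T u x = T (\<lambda>y. SUP n. ennreal (trunc u n y)) x" by (simp add: SUP_ennreal_trunc)
      also have "\<dots> = (SUP n. T (\<lambda>y. ennreal (trunc u n y)) x)" using x inc by (intro op_SUP) auto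
      finally show "ennpowr (T u x) (1 / p) \<le> (SUP n. ennpowr (T (\<lambda>y. ennreal (trunc u n y)) x) (1 / p))"
        using p by (simp add: ennpowr_SUP)
    qed measurable
    also have "\<dots> = (SUP n. ext_norm N (\<lambda>x. ennpowr (T (\<lambda>y. ennreal (trunc u n y)) x) (1 / p)))"
      using p by (intro SUP_eq) (auto simp: incseq_def intro!: ennpowr_mono op_mono ennreal_leI trunc_mono)
    also have "\<dots> \<le> ennreal A * ?P u"
    proof (rule SUP_least)
      fix n
      have "ext_norm N (\<lambda>x. ennpowr (T (\<lambda>y. ennreal (trunc u n y)) x) (1 / p))
          \<le> ennreal A * ext_norm N (\<lambda>x. ennpowr (ennreal (trunc u n x)) (1 / p))"
      proof (rule bounded)
        show "ennreal (trunc u n x) \<le> ennreal (real n + 1)" for x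
          using trunc_le[of u n x] by (intro ennreal_leI) linarith
      qed auto
      also have "\<dots> \<le> ennreal A * ?P u"
        using p by (intro mult_left_mono mono ennpowr_mono) (auto simp: ennreal_trunc)
      finally show "ext_norm N (\<lambda>x. ennpowr (T (\<lambda>y. ennreal (trunc u n y)) x) (1 / p))
          \<le> ennreal A * ?P u" .
    qed
    finally show "?P (T u) \<le> ennreal A * ?P u" .
  qed
qed

text \<open>By Jensen's inequality \<open>(T u\<^sup>q)\<^bsup>1/q\<^esup>\<close> is at most a constant times \<open>(T u\<^sup>p)\<^bsup>1/p\<^esup>\<close>.\<close>

lemma power_mean_bounded_if_endpoint_bounded:
  assumes bqb: "ball_quasi_banach M \<rho> N" and q: "0 < q" "q \<le> p" and ep: "hl_endpoint_bounded M \<rho> N p"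
  obtains A where "0 < A"
    "\<And>k u. symmetric_submarkov M k \<Longrightarrow> maximal_dominates M \<rho> k \<Longrightarrow> u \<in> borel_measurable M \<Longrightarrow>
      ext_norm N (\<lambda>x. ennpowr (kernel_op M k (\<lambda>y. ennpowr (u y) q) x) (1 / q)) \<le> ennreal A * ext_norm N u"
proof -
  obtain K where "function_quasinorm M (ext_norm N) K"
    using function_quasinorm_ext_norm[OF bqb] by blast
  then interpret function_quasinorm M "ext_norm N" K .
  have p: "0 < p" using q by simp
  obtain A where A: "0 < A"
    "\<And>k u. symmetric_submarkov M k \<Longrightarrow> maximal_dominates M \<rho> k \<Longrightarrow> u \<in> borel_measurable M \<Longrightarrow>
      ext_norm N (\<lambda>x. ennpowr (kernel_op M k u x) (1 / p)) \<le> ennreal A * ext_norm N (\<lambda>x. ennpowr (u x) (1 / p))"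
    using op_bounded_if_endpoint_bounded[OF bqb p ep] by metis
  show thesis
  proof (rule that)
    show "0 < 2 powr (1 / q) * A" using A by simp
    fix k and u :: "'a \<Rightarrow> ennreal"
    assume k: "symmetric_submarkov M k" "maximal_dominates M \<rho> k" and u [measurable]: "u \<in> borel_measurable M"
    interpret symmetric_submarkov M k by (rule k)
    have "ext_norm N (\<lambda>x. ennpowr (T (\<lambda>y. ennpowr (u y) q) x) (1 / q))
        \<le> ext_norm N (\<lambda>x. ennreal (2 powr (1 / q)) * ennpowr (T (\<lambda>y. ennpowr (u y) p) x) (1 / p))"
    proof (rule mono)
      fix x assume x: "x \<in> space M"
      have "ennpowr (T (\<lambda>y. ennpowr (u y) q) x) (1 / q)
          \<le> ennpowr (2 * ennpowr (T (\<lambda>y. ennpowr (ennpowr (u y) q) (p / q)) x) (1 / (p / q))) (1 / q)"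
        using q x by (intro ennpowr_mono op_Jensen) auto
      also have "\<dots> = ennreal (2 powr (1 / q)) * ennpowr (T (\<lambda>y. ennpowr (u y) p) x) (1 / p)"
        using q ennpowr_ennreal[of 2 "1 / q"] by (simp add: ennpowr_mult ennpowr_ennpowr)
      finally show "ennpowr (T (\<lambda>y. ennpowr (u y) q) x) (1 / q)
          \<le> ennreal (2 powr (1 / q)) * ennpowr (T (\<lambda>y. ennpowr (u y) p) x) (1 / p)" .
    qed measurable
    also have "\<dots> = ennreal (2 powr (1 / q)) * ext_norm N (\<lambda>x. ennpowr (T (\<lambda>y. ennpowr (u y) p) x) (1 / p))"
      by (intro scale) auto
    also have "\<dots> \<le> ennreal (2 powr (1 / q)) * (ennreal A * ext_norm N (\<lambda>x. ennpowr (ennpowr (u x) p) (1 / p)))"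
      by (intro mult_left_mono A(2) k) auto
    also have "\<dots> = ennreal (2 powr (1 / q) * A) * ext_norm N u"
      using A(1) p by (simp add: ennreal_mult mult.assoc)
    finally show "ext_norm N (\<lambda>x. ennpowr (T (\<lambda>y. ennpowr (u y) q) x) (1 / q)) \<le> ennreal (2 powr (1 / q) * A) * ext_norm N u" .
  qed
qed

section \<open>Kernels built from balls\<close>

text \<open>The averages over \<open>B(x, r)\<close> would have the kernel \<open>1\<^bsub>B(x,r)\<^esub>(y) / \<mu>(B(x, r))\<close>, which need not be
  measurable in \<open>x\<close>. Here the balls have fixed centres, and every summand is a product of
  functions of \<open>x\<close> and of \<open>y\<close>.\<close>

definition ball_kernel :: "'a measure \<Rightarrow> 'i set \<Rightarrow> ('i \<Rightarrow> 'a set) \<Rightarrow> ('i \<Rightarrow> ennreal) \<Rightarrow> 'a \<Rightarrow> 'a \<Rightarrow> ennreal" where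
  "ball_kernel M I F w x y =
     (\<integral>\<^sup>+i. w i * (indicator (F i) x * indicator (F i) y) / emeasure M (F i) \<partial>count_space I)"

lemma borel_measurable_nn_integral_count_space:
  fixes f :: "'i \<Rightarrow> 'a \<Rightarrow> ennreal"
  assumes "countable I" and [measurable]: "\<And>i. i \<in> I \<Longrightarrow> f i \<in> borel_measurable M"
  shows "(\<lambda>x. \<integral>\<^sup>+i. f i x \<partial>count_space I) \<in> borel_measurable M"
proof -
  interpret sigma_finite_measure "count_space I"
    using assms(1) by (rule sigma_finite_measure_count_space_countable)
  have "(\<lambda>(i, x). f i x) \<in> borel_measurable (count_space I \<Otimes>\<^sub>M M)"
    by (rule measurable_pair_measure_countable1) (use assms in auto)
  then have "(\<lambda>(x, i). f i x) \<in> borel_measurable (M \<Otimes>\<^sub>M count_space I)"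
    using measurable_pair_swap[of "\<lambda>(i, x). f i x"] by simp
  then show ?thesis by (intro borel_measurable_nn_integral) simp
qed

text \<open>The value of the operator at \<open>x\<close> is a combination, with weights of total at most \<open>1\<close>, of averages over balls that contain \<open>x\<close>.\<close>

lemma ball_kernel_averages:
  assumes "sigma_finite_measure M" and I: "countable I"
    and F: "\<And>i. i \<in> I \<Longrightarrow> \<exists>z\<in>space M. \<exists>r>0. F i = qball (space M) \<rho> z r"
    and F_sets: "\<And>i. i \<in> I \<Longrightarrow> F i \<in> sets M"
    and w: "\<And>x. x \<in> space M \<Longrightarrow> (\<integral>\<^sup>+i. w i * indicator (F i) x \<partial>count_space I) \<le> 1"
  shows "symmetric_submarkov M (ball_kernel M I F w)" "maximal_dominates M \<rho> (ball_kernel M I F w)"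
proof -
  interpret sigma_finite_measure M by fact
  have op: "kernel_op M (ball_kernel M I F w) g x
      = (\<integral>\<^sup>+i. w i * indicator (F i) x * ((\<integral>\<^sup>+y\<in>F i. g y \<partial>M) / emeasure M (F i)) \<partial>count_space I)"
    if [measurable]: "g \<in> borel_measurable M" for g x
  proof -
    have "kernel_op M (ball_kernel M I F w) g x
        = (\<integral>\<^sup>+y. \<integral>\<^sup>+i. w i * indicator (F i) x / emeasure M (F i) * (g y * indicator (F i) y) \<partial>count_space I \<partial>M)"
      unfolding kernel_op_def ball_kernel_def
      by (intro nn_integral_cong, subst nn_integral_multc[symmetric])
         (auto simp: divide_ennreal_def ac_simps intro!: nn_integral_cong)
    also have "\<dots> = (\<integral>\<^sup>+i. \<integral>\<^sup>+y. w i * indicator (F i) x / emeasure M (F i) * (g y * indicator (F i) y) \<partial>M \<partial>count_space I)"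
      by (rule nn_integral_count_space_nn_integral[OF I]) (use F_sets in measurable)
    also have "\<dots> = (\<integral>\<^sup>+i. w i * indicator (F i) x * ((\<integral>\<^sup>+y\<in>F i. g y \<partial>M) / emeasure M (F i)) \<partial>count_space I)"
      using F_sets by (intro nn_integral_cong, subst nn_integral_cmult) (auto simp: divide_ennreal_def ac_simps)
    finally show ?thesis .
  qed
  show "symmetric_submarkov M (ball_kernel M I F w)"
  proof
    show "case_prod (ball_kernel M I F w) \<in> borel_measurable (M \<Otimes>\<^sub>M M)"
      unfolding ball_kernel_def case_prod_beta
      by (intro borel_measurable_nn_integral_count_space I) (use F_sets in measurable)
    show "ball_kernel M I F w x y = ball_kernel M I F w y x" for x y
      by (simp add: ball_kernel_def ac_simps)
    fix x assume x: "x \<in> space M"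
    have "(\<integral>\<^sup>+y. ball_kernel M I F w x y \<partial>M) = kernel_op M (ball_kernel M I F w) (\<lambda>y. 1) x"
      by (simp add: kernel_op_def)
    also have "\<dots> \<le> (\<integral>\<^sup>+i. w i * indicator (F i) x \<partial>count_space I)"
    proof (subst op, simp, rule nn_integral_mono)
      fix i assume "i \<in> space (count_space I)"
      then have "(\<integral>\<^sup>+y\<in>F i. 1 \<partial>M) = emeasure M (F i)" using F_sets by simp
      then have "(\<integral>\<^sup>+y\<in>F i. 1 \<partial>M) / emeasure M (F i) \<le> 1"
        by (cases "emeasure M (F i) = 0"; cases "emeasure M (F i) = top") (auto simp: ennreal_divide_self less_top)
      then show "w i * indicator (F i) x * ((\<integral>\<^sup>+y\<in>F i. 1 \<partial>M) / emeasure M (F i)) \<le> w i * indicator (F i) x"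
        by (metis mult.right_neutral mult_left_mono zero_le)
    qed
    also have "\<dots> \<le> 1" by (rule w[OF x])
    finally show "(\<integral>\<^sup>+y. ball_kernel M I F w x y \<partial>M) \<le> 1" .
  qed
  show "maximal_dominates M \<rho> (ball_kernel M I F w)"
    unfolding maximal_dominates_def
  proof (intro allI impI)
    fix g :: "'a \<Rightarrow> real" and x assume [measurable]: "g \<in> borel_measurable M" and g: "\<forall>x. 0 \<le> g x" and x: "x \<in> space M"
    let ?m = "hl_maximal M \<rho> (\<lambda>y. complex_of_real (g y)) x"
    have "kernel_op M (ball_kernel M I F w) (\<lambda>y. ennreal (g y)) x \<le> (\<integral>\<^sup>+i. w i * indicator (F i) x * ?m \<partial>count_space I)"
    proof (subst op, simp, rule nn_integral_mono)
      fix i assume i: "i \<in> space (count_space I)"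
      show "w i * indicator (F i) x * ((\<integral>\<^sup>+y\<in>F i. ennreal (g y) \<partial>M) / emeasure M (F i)) \<le> w i * indicator (F i) x * ?m"
      proof (cases "x \<in> F i")
        case True
        obtain z r where zr: "z \<in> space M" "0 < r" "F i = qball (space M) \<rho> z r"
          using F[of i] i by auto
        have "(\<integral>\<^sup>+y\<in>F i. ennreal (cmod (complex_of_real (g y))) \<partial>M) / emeasure M (F i) \<le> ?m"
          unfolding hl_maximal_def by (rule SUP_upper) (use zr True in blast)
        then show ?thesis using g by (intro mult_left_mono) auto
      qed simp
    qed
    also have "\<dots> = (\<integral>\<^sup>+i. w i * indicator (F i) x \<partial>count_space I) * ?m"
      by (rule nn_integral_multc) simp
    also have "\<dots> \<le> 1 * ?m" using w[OF x] by (rule mult_right_mono) simp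
    finally show "kernel_op M (ball_kernel M I F w) (\<lambda>y. ennreal (g y)) x \<le> ?m" by simp
  qed
qed

section \<open>Geometry of spaces of homogeneous type\<close>

locale homogeneous_space =
  fixes M :: "'a measure" and \<rho> :: "'a \<Rightarrow> 'a \<Rightarrow> real" and K L :: real
  assumes space_nonempty: "space M \<noteq> {}"
    and dist_nonneg: "x \<in> space M \<Longrightarrow> y \<in> space M \<Longrightarrow> 0 \<le> \<rho> x y"
    and dist_eq_0_iff: "x \<in> space M \<Longrightarrow> y \<in> space M \<Longrightarrow> \<rho> x y = 0 \<longleftrightarrow> x = y"
    and dist_sym: "x \<in> space M \<Longrightarrow> y \<in> space M \<Longrightarrow> \<rho> x y = \<rho> y x"
    and K_ge_1: "1 \<le> K"
    and quasi_triangle: "x \<in> space M \<Longrightarrow> y \<in> space M \<Longrightarrow> z \<in> space M \<Longrightarrow> \<rho> x z \<le> K * (\<rho> x y + \<rho> y z)"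
    and L_ge_1: "1 \<le> L"
    and ball_sets: "x \<in> space M \<Longrightarrow> 0 < r \<Longrightarrow> qball (space M) \<rho> x r \<in> sets M"
    and ball_pos: "x \<in> space M \<Longrightarrow> 0 < r \<Longrightarrow> 0 < emeasure M (qball (space M) \<rho> x r)"
    and ball_finite: "x \<in> space M \<Longrightarrow> 0 < r \<Longrightarrow> emeasure M (qball (space M) \<rho> x r) < \<infinity>"
    and doubling: "x \<in> space M \<Longrightarrow> 0 < r \<Longrightarrow>
      emeasure M (qball (space M) \<rho> x (2 * r)) \<le> ennreal L * emeasure M (qball (space M) \<rho> x r)"

lemma homogeneous_typeE:
  assumes "homogeneous_type M \<rho>" obtains K L where "homogeneous_space M \<rho> K L"
proof -
  have qm: "quasi_metric (space M) \<rho>" using assms by (simp add: homogeneous_type_def)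
  obtain K where K: "K \<ge> 1" "\<forall>x\<in>space M. \<forall>y\<in>space M. \<forall>z\<in>space M. \<rho> x z \<le> K * (\<rho> x y + \<rho> y z)"
    using qm by (auto simp: quasi_metric_def)
  have sets: "\<And>x r. x \<in> space M \<Longrightarrow> 0 < r \<Longrightarrow> qball (space M) \<rho> x r \<in> sets M"
    using assms by (auto simp: homogeneous_type_def)
  obtain L :: real where L: "1 \<le> L" and dbl: "\<And>x r. x \<in> space M \<Longrightarrow> 0 < r \<Longrightarrow>
      0 < emeasure M (qball (space M) \<rho> x (2 * r)) \<and>
      emeasure M (qball (space M) \<rho> x (2 * r)) \<le> ennreal L * emeasure M (qball (space M) \<rho> x r) \<and>
      ennreal L * emeasure M (qball (space M) \<rho> x r) < \<infinity>"
    using assms unfolding homogeneous_type_def by blast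
  have "homogeneous_space M \<rho> K L"
  proof
    fix x r assume x: "x \<in> space M" and r: "0 < (r::real)"
    show "0 < emeasure M (qball (space M) \<rho> x r)" using dbl[OF x, of "r / 2"] r by simp
    have "1 * emeasure M (qball (space M) \<rho> x r) \<le> ennreal L * emeasure M (qball (space M) \<rho> x r)"
      using L by (intro mult_right_mono) auto
    then show "emeasure M (qball (space M) \<rho> x r) < \<infinity>" using dbl[OF x r] by auto
  qed (use qm K L sets dbl in \<open>auto simp: quasi_metric_def\<close>)
  then show thesis by (rule that)
qed

context homogeneous_space
begin

abbreviation X :: "'a set" where "X \<equiv> space M"
abbreviation B :: "'a \<Rightarrow> real \<Rightarrow> 'a set" where "B \<equiv> qball (space M) \<rho>"
abbreviation V :: "'a \<Rightarrow> real \<Rightarrow> ennreal" where "V x r \<equiv> emeasure M (B x r)"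

lemma ball_mono: "r \<le> s \<Longrightarrow> B x r \<subseteq> B x s"
  by (auto simp: qball_def)

lemma V_mono: "x \<in> X \<Longrightarrow> 0 < s \<Longrightarrow> r \<le> s \<Longrightarrow> V x r \<le> V x s"
  by (intro emeasure_mono ball_mono ball_sets)

lemma V_real:
  assumes "x \<in> X" "0 < r" obtains v where "0 < v" "V x r = ennreal v"
  using ball_pos[OF assms] ball_finite[OF assms] by (cases "V x r") auto

lemma V_doubling_power: "x \<in> X \<Longrightarrow> 0 < r \<Longrightarrow> V x (2 ^ n * r) \<le> ennreal (L ^ n) * V x r"
proof (induction n)
  case (Suc n)
  have "V x (2 ^ Suc n * r) \<le> ennreal L * V x (2 ^ n * r)"
    using doubling[of x "2 ^ n * r"] Suc by (simp add: mult.assoc)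
  also have "\<dots> \<le> ennreal L * (ennreal (L ^ n) * V x r)"
    using Suc by (intro mult_left_mono) auto
  also have "\<dots> = ennreal (L ^ Suc n) * V x r"
    using L_ge_1 by (simp add: ennreal_mult mult.assoc)
  finally show ?case .
qed simp

lemma ball_subset:
  assumes "x \<in> X" "y \<in> X" "\<rho> x y \<le> a" "K * (a + b) \<le> c"
  shows "B y b \<subseteq> B x c"
proof
  fix z assume "z \<in> B y b"
  then have z: "z \<in> X" "\<rho> y z < b" by (auto simp: qball_def)
  have "\<rho> x z \<le> K * (\<rho> x y + \<rho> y z)" using assms z by (intro quasi_triangle) auto
  also have "\<dots> < K * (a + b)" using K_ge_1 assms z by (intro mult_strict_left_mono) auto
  finally show "z \<in> B x c" using z assms by (simp add: qball_def)
qed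

lemma V_compare:
  assumes "x \<in> X" "y \<in> X" "\<rho> x y \<le> a" "0 < c" "K * (a + b) \<le> 2 ^ n * c"
  shows "V y b \<le> ennreal (L ^ n) * V x c"
proof -
  have "V y b \<le> V x (2 ^ n * c)"
    using assms by (intro emeasure_mono ball_subset ball_sets) auto
  also have "\<dots> \<le> ennreal (L ^ n) * V x c" using assms by (intro V_doubling_power)
  finally show ?thesis .
qed

lemma sigma_finite: "sigma_finite_measure M"
proof
  obtain x0 where x0: "x0 \<in> X" using space_nonempty by auto
  show "\<exists>A. countable A \<and> A \<subseteq> sets M \<and> \<Union>A = X \<and> (\<forall>a\<in>A. emeasure M a \<noteq> \<infinity>)"
  proof (intro exI[of _ "range (\<lambda>n. B x0 (real (Suc n)))"] conjI)
    show "\<Union> (range (\<lambda>n. B x0 (real (Suc n)))) = X"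
    proof (intro antisym subsetI)
      fix x assume x: "x \<in> X"
      obtain n where "\<rho> x0 x < real n" using reals_Archimedean2 by blast
      with x have "x \<in> B x0 (real (Suc n))" by (simp add: qball_def)
      then show "x \<in> \<Union> (range (\<lambda>n. B x0 (real (Suc n))))" by blast
    qed (auto simp: qball_def)
    show "\<forall>a\<in>range (\<lambda>n. B x0 (real (Suc n))). emeasure M a \<noteq> \<infinity>"
      using ball_finite[OF x0] by (auto simp: less_top[symmetric])
  qed (use x0 ball_sets in auto)
qed

text \<open>The balls of radius \<open>r / (2K)\<close> around the points of \<open>A\<close> are disjoint, lie in one ball around
  \<open>x\<close>, and by doubling each of them has at least the fraction \<open>L\<^bsup>-n\<^esup>\<close> of its measure.\<close>

lemma separated_card:
  assumes A: "A \<subseteq> X" "\<And>z z'. z \<in> A \<Longrightarrow> z' \<in> A \<Longrightarrow> z \<noteq> z' \<Longrightarrow> r \<le> \<rho> z z'"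
    and x: "x \<in> X" and r: "0 < r" and t: "0 < t"
    and n: "K * (t + K * (t + r)) \<le> 2 ^ n * (r / (2 * K))"
  shows "finite {z\<in>A. \<rho> z x < t} \<and> real (card {z\<in>A. \<rho> z x < t}) \<le> L ^ n"
proof -
  have K0: "0 < K" using K_ge_1 by simp
  define e where "e = r / (2 * K)"
  have e: "0 < e" "e \<le> r" "2 * K * e = r"
    using r K_ge_1 K0 unfolding e_def by (auto simp: field_simps)
  define R where "R = K * (t + r)"
  have R: "0 < R" using K0 t r by (simp add: R_def)
  have card: "real (card G) \<le> L ^ n" if G: "G \<subseteq> {z\<in>A. \<rho> z x < t}" "finite G" for G
  proof -
    have GX: "z \<in> X" "\<rho> x z \<le> t" if "z \<in> G" for z
    proof -
      have z: "z \<in> A" "\<rho> z x < t" using that G by auto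
      then show "z \<in> X" using A by auto
      then show "\<rho> x z \<le> t" using z x dist_sym[of x z] by simp
    qed
    have disj: "disjoint_family_on (\<lambda>z. B z e) G"
      unfolding disjoint_family_on_def
    proof (intro ballI impI)
      fix z z' assume z: "z \<in> G" "z' \<in> G" "z \<noteq> z'"
      show "B z e \<inter> B z' e = {}"
      proof (rule ccontr)
        assume "B z e \<inter> B z' e \<noteq> {}"
        then obtain y where y: "y \<in> X" "\<rho> z y < e" "\<rho> z' y < e" by (auto simp: qball_def)
        have "\<rho> z z' \<le> K * (\<rho> z y + \<rho> y z')" using z y GX by (intro quasi_triangle) auto
        also have "\<dots> < K * (e + e)" using y z GX K0 by (intro mult_strict_left_mono) (auto simp: dist_sym)
        finally have "\<rho> z z' < r" using e by simp
        moreover have "r \<le> \<rho> z z'" using z G A by blast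
        ultimately show False by simp
      qed
    qed
    obtain v where v: "0 < v" "V x R = ennreal v" using V_real[OF x R] .
    have "ennreal (real (card G) * v) = (\<Sum>z\<in>G. V x R)"
      using v by (simp add: ennreal_mult ennreal_of_nat_eq_real_of_nat)
    also have "\<dots> \<le> (\<Sum>z\<in>G. ennreal (L ^ n) * V z e)"
    proof (rule sum_mono)
      fix z assume z: "z \<in> G"
      show "V x R \<le> ennreal (L ^ n) * V z e"
        using z GX[OF z] x n e(1) dist_sym[of x z] by (intro V_compare[where a=t]) (auto simp: R_def e_def)
    qed
    also have "\<dots> = ennreal (L ^ n) * emeasure M (\<Union>z\<in>G. B z e)"
      using disj G(2) GX e by (subst sum_emeasure[symmetric]) (auto simp: sum_distrib_left intro!: ball_sets)
    also have "\<dots> \<le> ennreal (L ^ n) * V x R"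
    proof (intro mult_left_mono emeasure_mono UN_least ball_sets x R)
      fix z assume "z \<in> G"
      then show "B z e \<subseteq> B x R"
        using x GX e K0 by (intro ball_subset[where a=t]) (auto simp: R_def)
    qed simp
    also have "\<dots> = ennreal (L ^ n * v)" using v L_ge_1 by (simp add: ennreal_mult)
    finally have "real (card G) * v \<le> L ^ n * v" using v L_ge_1 by (subst (asm) ennreal_le_iff) auto
    then show ?thesis using v by simp
  qed
  have "finite {z\<in>A. \<rho> z x < t} \<and> card {z\<in>A. \<rho> z x < t} \<le> nat \<lfloor>L ^ n\<rfloor>"
    using card by (intro finite_if_finite_subsets_card_bdd) (simp add: le_nat_floor)
  then show ?thesis using card[of "{z\<in>A. \<rho> z x < t}"] by auto
qed

lemma separated_countable:
  assumes A: "A \<subseteq> X" "\<And>z z'. z \<in> A \<Longrightarrow> z' \<in> A \<Longrightarrow> z \<noteq> z' \<Longrightarrow> r \<le> \<rho> z z'" and r: "0 < r"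
  shows "countable A"
proof -
  obtain x0 where x0: "x0 \<in> X" using space_nonempty by auto
  have "A = (\<Union>m. {z\<in>A. \<rho> z x0 < real (Suc m)})"
  proof (intro antisym subsetI)
    fix z assume "z \<in> A"
    moreover obtain m where "\<rho> z x0 < real m" using reals_Archimedean2 by blast
    ultimately have "z \<in> {z\<in>A. \<rho> z x0 < real (Suc m)}" by simp
    then show "z \<in> (\<Union>m. {z\<in>A. \<rho> z x0 < real (Suc m)})" by blast
  qed auto
  moreover have "finite {z\<in>A. \<rho> z x0 < t}" if t: "0 < t" for t
  proof -
    obtain n where "K * (t + K * (t + r)) / (r / (2 * K)) < 2 ^ n"
      using real_arch_pow[of 2] by auto
    then have "K * (t + K * (t + r)) \<le> 2 ^ n * (r / (2 * K))"
      using r K_ge_1 by (subst (asm) pos_divide_less_eq) auto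
    from separated_card[OF A x0 r t this] show ?thesis by simp
  qed
  ultimately show ?thesis
  proof -
    assume eq: "A = (\<Union>m. {z\<in>A. \<rho> z x0 < real (Suc m)})"
      and fin: "\<And>t. 0 < t \<Longrightarrow> finite {z\<in>A. \<rho> z x0 < t}"
    have "countable (\<Union>m. {z\<in>A. \<rho> z x0 < real (Suc m)})"
      by (intro countable_UN countableI_type countable_finite[OF fin]) simp
    then show ?thesis by (subst eq)
  qed
qed

lemma maximal_separated_exists:
  assumes r: "0 < r"
  obtains A where "A \<subseteq> X" "\<And>z z'. z \<in> A \<Longrightarrow> z' \<in> A \<Longrightarrow> z \<noteq> z' \<Longrightarrow> r \<le> \<rho> z z'"
    "\<And>x. x \<in> X \<Longrightarrow> \<exists>z\<in>A. \<rho> x z < r"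
proof -
  define \<A> where "\<A> = {A. A \<subseteq> X \<and> (\<forall>z\<in>A. \<forall>z'\<in>A. z \<noteq> z' \<longrightarrow> r \<le> \<rho> z z')}"
  have "\<exists>A\<in>\<A>. \<forall>Y\<in>\<A>. A \<subseteq> Y \<longrightarrow> Y = A"
  proof (rule subset_Zorn_nonempty)
    have "{} \<in> \<A>" by (simp add: \<A>_def)
    then show "\<A> \<noteq> {}" by blast
    fix C assume C: "C \<noteq> {}" "subset.chain \<A> C"
    have "r \<le> \<rho> z z'" if zz: "z \<in> \<Union>C" "z' \<in> \<Union>C" "z \<noteq> z'" for z z'
    proof -
      obtain Y Y' where Y: "z \<in> Y" "Y \<in> C" "z' \<in> Y'" "Y' \<in> C" using zz by blast
      then have "Y \<subseteq> Y' \<or> Y' \<subseteq> Y" using C by (auto simp: subset_chain_def)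
      then obtain Z where Z: "Z \<in> C" "z \<in> Z" "z' \<in> Z" using Y by blast
      then have "Z \<in> \<A>" using C by (auto simp: subset_chain_def)
      then show ?thesis using Z zz(3) by (simp add: \<A>_def)
    qed
    moreover have "\<Union>C \<subseteq> X" using C by (auto simp: subset_chain_def \<A>_def)
    ultimately show "\<Union>C \<in> \<A>" by (auto simp: \<A>_def)
  qed
  then obtain A where A: "A \<in> \<A>" "\<And>Y. Y \<in> \<A> \<Longrightarrow> A \<subseteq> Y \<Longrightarrow> Y = A" by blast
  show thesis
  proof (rule that)
    show "A \<subseteq> X" "\<And>z z'. z \<in> A \<Longrightarrow> z' \<in> A \<Longrightarrow> z \<noteq> z' \<Longrightarrow> r \<le> \<rho> z z'"
      using A(1) by (auto simp: \<A>_def)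
    fix x assume x: "x \<in> X"
    show "\<exists>z\<in>A. \<rho> x z < r"
    proof (rule ccontr)
      assume neg: "\<not> (\<exists>z\<in>A. \<rho> x z < r)"
      have "r \<le> \<rho> x z \<and> r \<le> \<rho> z x" if "z \<in> A" for z
      proof -
        have "z \<in> X" using that A(1) by (auto simp: \<A>_def)
        then show ?thesis using that neg x dist_sym[of x z] by (auto simp: not_less)
      qed
      then have "insert x A \<in> \<A>" using A(1) x by (auto simp: \<A>_def)
      then have "x \<in> A" using A(2)[of "insert x A"] by blast
      moreover have "\<rho> x x = 0" using x by (simp add: dist_eq_0_iff)
      ultimately show False using neg r by auto
    qed
  qed
qed

lemma dyadic_scale:
  fixes t :: real assumes "1 \<le> t" obtains k :: nat where "2 ^ k \<le> t" "t < 2 ^ Suc k"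
proof -
  define m where "m = (LEAST m. t < 2 ^ m)"
  have ex: "\<exists>m. t < 2 ^ m" using real_arch_pow[of 2 t] by auto
  have m: "t < 2 ^ m" unfolding m_def using ex by (rule LeastI_ex)
  then have "m \<noteq> 0" using assms by (intro notI) simp
  then obtain k where k: "m = Suc k" by (cases m) auto
  have "\<not> t < 2 ^ k" using not_less_Least[of k "\<lambda>m. t < 2 ^ m"] k by (simp add: m_def)
  with m k show thesis by (intro that[of k]) auto
qed

text \<open>The kernel of the Gagliardo function with \<open>\<sigma> = s q\<close>.\<close>

abbreviation decay :: "real \<Rightarrow> 'a \<Rightarrow> 'a \<Rightarrow> ennreal" where
  "decay \<sigma> x y \<equiv> 1 / (U_kernel M \<rho> x y * ennreal (\<rho> x y powr \<sigma>))"

text \<open>At each scale \<open>2\<^sup>k\<close>, balls of radius \<open>3K 2\<^sup>k\<close> around a maximal \<open>2\<^sup>k\<close>-separated set overlap boundedly, and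
  one of them contains both \<open>x\<close> and \<open>y\<close> when \<open>2\<^sup>k \<le> \<rho>(x, y) < 2\<^bsup>k+1\<^esup>\<close>. It gets the weight
  \<open>2\<^bsup>-k\<sigma>\<^esup>\<close>. Normalizing the total weight costs the factor \<open>\<Sum>\<^sub>k 2\<^bsup>-k\<sigma>\<^esup>\<close>, which is at most
  \<open>1 + 1 / (\<sigma> ln 2)\<close>.\<close>

lemma far_kernel_dominated:
  obtains D where "0 < D"
    "\<And>\<sigma>. 0 < \<sigma> \<Longrightarrow> \<exists>k. symmetric_submarkov M k \<and> maximal_dominates M \<rho> k \<and>
      (\<forall>x\<in>X. \<forall>y\<in>X. 1 \<le> \<rho> x y \<longrightarrow>
        decay \<sigma> x y \<le> ennreal (D * (1 + 1 / (\<sigma> * ln 2))) * k x y)"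
proof -
  have K0: "0 < K" using K_ge_1 by simp
  obtain n1 where n1: "2 * K * (K * (3 * K + K * (3 * K + 1))) < 2 ^ n1" using real_arch_pow[of 2] by auto
  obtain n2 where n2: "K * (3 * K + 3 * K) < 2 ^ n2" using real_arch_pow[of 2] by auto
  define J where "J = L ^ n1"
  have J: "1 \<le> J" using L_ge_1 by (simp add: J_def)
  define cov where "cov k A \<longleftrightarrow> A \<subseteq> X \<and> countable A \<and> (\<forall>x\<in>X. \<exists>z\<in>A. \<rho> x z < 2 ^ k) \<and>
      (\<forall>x\<in>X. finite {z\<in>A. \<rho> z x < 3 * K * 2 ^ k} \<and> real (card {z\<in>A. \<rho> z x < 3 * K * 2 ^ k}) \<le> J)"
    for k :: nat and A
  have "\<exists>A. cov k A" for k
  proof -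
    have r: "(0::real) < 2 ^ k" by simp
    obtain A where A: "A \<subseteq> X" "\<And>z z'. z \<in> A \<Longrightarrow> z' \<in> A \<Longrightarrow> z \<noteq> z' \<Longrightarrow> 2 ^ k \<le> \<rho> z z'"
      "\<And>x. x \<in> X \<Longrightarrow> \<exists>z\<in>A. \<rho> x z < 2 ^ k"
      using maximal_separated_exists[OF r] by metis
    have "K * (3 * K * 2 ^ k + K * (3 * K * 2 ^ k + 2 ^ k)) \<le> 2 ^ n1 * (2 ^ k / (2 * K))"
    proof -
      have "2 * K * (K * (3 * K + K * (3 * K + 1))) * (2 ^ k / (2 * K)) \<le> 2 ^ n1 * (2 ^ k / (2 * K))"
        using n1 K0 by (intro mult_right_mono) auto
      moreover have "2 * K * (K * (3 * K + K * (3 * K + 1))) * (2 ^ k / (2 * K)) = K * (3 * K * 2 ^ k + K * (3 * K * 2 ^ k + 2 ^ k))"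
        using K0 by (simp add: field_simps)
      ultimately show ?thesis by simp
    qed
    then have "finite {z\<in>A. \<rho> z x < 3 * K * 2 ^ k} \<and> real (card {z\<in>A. \<rho> z x < 3 * K * 2 ^ k}) \<le> J" if "x \<in> X" for x
      unfolding J_def using A(1,2) that K0 by (intro separated_card[where r = "2 ^ k"]) simp_all
    moreover have "countable A" by (rule separated_countable[OF A(1,2) r])
    ultimately have "cov k A"
      unfolding cov_def using A(1,3) by (intro conjI ballI) simp_all
    then show ?thesis by (rule exI)
  qed
  then obtain A where "\<And>k. cov k (A k)" by metis
  then have A: "\<And>k. A k \<subseteq> X" "\<And>k. countable (A k)" "\<And>k x. x \<in> X \<Longrightarrow> \<exists>z\<in>A k. \<rho> x z < 2 ^ k"
    and fin: "\<And>k x. x \<in> X \<Longrightarrow> finite {z\<in>A k. \<rho> z x < 3 * K * 2 ^ k}"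
    and cardJ: "\<And>k x. x \<in> X \<Longrightarrow> real (card {z\<in>A k. \<rho> z x < 3 * K * 2 ^ k}) \<le> J"
    unfolding cov_def by simp_all
  define I :: "(nat \<times> 'a) set" where "I = (SIGMA k:UNIV. A k)"
  define F :: "nat \<times> 'a \<Rightarrow> 'a set" where "F i = B (snd i) (3 * K * 2 ^ fst i)" for i
  have I: "countable I" unfolding I_def using A by (intro countable_SIGMA) auto
  show thesis
  proof (rule that)
    show "0 < L ^ n2 * J" using L_ge_1 J by simp
    fix \<sigma> :: real assume \<sigma>: "0 < \<sigma>"
    define b where "b = 2 powr (- \<sigma>)"
    have b: "0 < b" "b < 1" using \<sigma> by (auto simp: b_def powr_less_one)
    define w :: "nat \<times> 'a \<Rightarrow> ennreal" where "w i = ennreal (b ^ fst i * (1 - b) / J)" for i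
    have w1: "(\<integral>\<^sup>+i. w i * indicator (F i) x \<partial>count_space I) \<le> 1" if x: "x \<in> X" for x
    proof -
      have "(\<integral>\<^sup>+i. w i * indicator (F i) x \<partial>count_space I)
          = (\<integral>\<^sup>+i. w i * indicator (F i) x * indicator I i \<partial>count_space UNIV)"
        by (rule nn_integral_count_space_indicator) simp
      also have "\<dots> = (\<integral>\<^sup>+k. \<integral>\<^sup>+z. w (k, z) * indicator (F (k, z)) x * indicator I (k, z) \<partial>count_space UNIV \<partial>count_space UNIV)"
        by (rule nn_integral_fst_count_space[symmetric])
      also have "\<dots> = (\<integral>\<^sup>+k. \<integral>\<^sup>+z. ennreal (b ^ k * (1 - b) / J) * indicator {z\<in>A k. \<rho> z x < 3 * K * 2 ^ k} z \<partial>count_space UNIV \<partial>count_space UNIV)"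
        using x by (intro nn_integral_cong) (auto simp: w_def F_def I_def qball_def indicator_def)
      also have "\<dots> = (\<integral>\<^sup>+k. ennreal (b ^ k * (1 - b) / J) * of_nat (card {z\<in>A k. \<rho> z x < 3 * K * 2 ^ k}) \<partial>count_space UNIV)"
        using fin[OF x] by (simp add: nn_integral_cmult_indicator)
      also have "\<dots> \<le> (\<integral>\<^sup>+k. ennreal (b ^ k * (1 - b)) \<partial>count_space UNIV)"
      proof (rule nn_integral_mono)
        fix k
        have "ennreal (b ^ k * (1 - b) / J) * of_nat (card {z\<in>A k. \<rho> z x < 3 * K * 2 ^ k}) \<le> ennreal (b ^ k * (1 - b) / J) * ennreal J"
          using cardJ[OF x, of k] by (intro mult_left_mono) (auto simp: ennreal_of_nat_eq_real_of_nat intro: ennreal_leI)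
        also have "\<dots> = ennreal (b ^ k * (1 - b))" using b J by (simp flip: ennreal_mult)
        finally show "ennreal (b ^ k * (1 - b) / J) * of_nat (card {z\<in>A k. \<rho> z x < 3 * K * 2 ^ k}) \<le> ennreal (b ^ k * (1 - b))" .
      qed
      also have "\<dots> = (\<Sum>k. ennreal (b ^ k * (1 - b)))" by (rule nn_integral_count_space_nat)
      also have "\<dots> = ennreal ((1 / (1 - b)) * (1 - b))"
        using b by (intro suminf_ennreal_eq sums_mult2 geometric_sums) auto
      finally show ?thesis using b by simp
    qed
    let ?k = "ball_kernel M I F w"
    have avg: "symmetric_submarkov M ?k" "maximal_dominates M \<rho> ?k"
    proof (rule_tac [!] ball_kernel_averages[OF sigma_finite I _ _ w1])
      show "\<exists>z\<in>X. \<exists>r>0. F i = B z r" "\<exists>z\<in>X. \<exists>r>0. F i = B z r" "F i \<in> sets M" "F i \<in> sets M" if "i \<in> I" for i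
      proof -
        have "snd i \<in> X" using that A(1)[of "fst i"] by (auto simp: I_def)
        moreover have "0 < 3 * K * 2 ^ fst i" using K0 by simp
        ultimately show "\<exists>z\<in>X. \<exists>r>0. F i = B z r" "\<exists>z\<in>X. \<exists>r>0. F i = B z r" "F i \<in> sets M" "F i \<in> sets M"
          unfolding F_def by (blast intro: ball_sets)+
      qed
    qed auto
    have geo: "1 / (1 - b) \<le> 1 + 1 / (\<sigma> * ln 2)"
    proof -
      have u: "0 < \<sigma> * ln 2" using \<sigma> by simp
      have "1 / b = exp (\<sigma> * ln 2)" by (simp add: b_def powr_def exp_minus field_simps)
      then have "1 + \<sigma> * ln 2 \<le> 1 / b" using exp_ge_add_one_self[of "\<sigma> * ln 2"] by simp
      then have "b * (1 + \<sigma> * ln 2) \<le> 1" using b by (simp add: field_simps)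
      then have "\<sigma> * ln 2 \<le> (1 - b) * (1 + \<sigma> * ln 2)" by (simp add: algebra_simps)
      then have "1 * (\<sigma> * ln 2) \<le> (1 + \<sigma> * ln 2) * (1 - b)" by (simp add: mult.commute)
      then have "1 / (1 - b) \<le> (1 + \<sigma> * ln 2) / (\<sigma> * ln 2)"
        using u b by (simp add: frac_le_eq divide_simps mult.commute)
      also have "\<dots> = 1 + 1 / (\<sigma> * ln 2)" using \<sigma> by (simp add: add_divide_distrib)
      finally show ?thesis .
    qed
    have "decay \<sigma> x y \<le> ennreal (L ^ n2 * J * (1 + 1 / (\<sigma> * ln 2))) * ?k x y"
      if x: "x \<in> X" and y: "y \<in> X" and far: "1 \<le> \<rho> x y" for x y
    proof -
      obtain k where k: "2 ^ k \<le> \<rho> x y" "\<rho> x y < 2 ^ Suc k" using dyadic_scale[OF far] .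
      obtain z where z: "z \<in> A k" "\<rho> x z < 2 ^ k" using A(3)[OF x] by blast
      have zX: "z \<in> X" using z A(1) by auto
      have zx: "\<rho> z x < 2 ^ k" using z zX x dist_sym[of x z] by simp
      have r0: "0 < 3 * K * 2 ^ k" using K0 by simp
      have xF: "x \<in> F (k, z)"
      proof -
        have "(1::real) * 2 ^ k \<le> 3 * K * 2 ^ k" using K_ge_1 by (intro mult_right_mono) auto
        then have "\<rho> z x < 3 * K * 2 ^ k" using zx by linarith
        then show ?thesis using x by (simp add: F_def qball_def)
      qed
      have zy: "\<rho> z y < 3 * K * 2 ^ k"
      proof -
        have "\<rho> z y \<le> K * (\<rho> z x + \<rho> x y)" using zX x y by (intro quasi_triangle)
        also have "\<dots> < K * (2 ^ k + 2 ^ Suc k)" using K0 zx k by (intro mult_strict_left_mono add_strict_mono) auto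
        finally show ?thesis by (simp add: algebra_simps)
      qed
      then have yF: "y \<in> F (k, z)" using y by (auto simp: F_def qball_def)
      obtain m where m: "0 < m" "emeasure M (F (k, z)) = ennreal m"
        using V_real[OF zX r0] by (auto simp: F_def)
      have \<rho>0: "0 < \<rho> x y" using far by simp
      obtain vx where vx: "0 < vx" "V x (\<rho> x y) = ennreal vx" using V_real[OF x \<rho>0] .
      obtain vy where vy: "0 < vy" "V y (\<rho> x y) = ennreal vy" using V_real[OF y \<rho>0] .
      have cmp: "V z (3 * K * 2 ^ k) \<le> ennreal (L ^ n2) * V x' (\<rho> x y)"
        if x': "x' \<in> X" "\<rho> x' z \<le> 3 * K * 2 ^ k" for x'
      proof (rule V_compare[OF x'(1) zX x'(2) \<rho>0])
        have "K * (3 * K * 2 ^ k + 3 * K * 2 ^ k) = K * (3 * K + 3 * K) * 2 ^ k" by (simp add: algebra_simps)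
        also have "\<dots> \<le> 2 ^ n2 * \<rho> x y" using n2 by (intro mult_mono k) auto
        finally show "K * (3 * K * 2 ^ k + 3 * K * 2 ^ k) \<le> 2 ^ n2 * \<rho> x y" .
      qed
      have "\<rho> x z \<le> 3 * K * 2 ^ k" "\<rho> y z \<le> 3 * K * 2 ^ k"
        using xF zy dist_sym[OF x zX] dist_sym[OF y zX] by (auto simp: F_def qball_def)
      from cmp[OF x this(1)] cmp[OF y this(2)]
      have mx: "m \<le> L ^ n2 * vx" and my: "m \<le> L ^ n2 * vy"
        using m vx vy L_ge_1 by (simp_all add: F_def flip: ennreal_mult)
      define u where "u = min vx vy"
      have u: "0 < u" "m \<le> L ^ n2 * u" using vx vy mx my by (auto simp: u_def min_def)
      have U: "U_kernel M \<rho> x y = ennreal u"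
        using vx vy by (simp add: U_kernel_def u_def min_ennreal)
      have bk: "1 / b ^ k \<le> \<rho> x y powr \<sigma>"
      proof -
        have "1 / b ^ k = (2 ^ k) powr \<sigma>"
          by (simp add: b_def powr_powr powr_minus divide_inverse power_inverse mult.commute flip: powr_realpow)
        also have "\<dots> \<le> \<rho> x y powr \<sigma>" using k \<sigma> by (intro powr_mono2) auto
        finally show ?thesis .
      qed
      have "decay \<sigma> x y = ennreal (1 / (u * \<rho> x y powr \<sigma>))"
        using u \<rho>0 by (simp add: U divide_ennreal flip: ennreal_mult ennreal_1)
      also have "\<dots> \<le> ennreal (L ^ n2 * (b ^ k / m))"
      proof (rule ennreal_leI)
        have "m * (1 / b ^ k) \<le> (L ^ n2 * u) * (\<rho> x y powr \<sigma>)"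
          using u m b bk L_ge_1 by (intro mult_mono) auto
        then show "1 / (u * \<rho> x y powr \<sigma>) \<le> L ^ n2 * (b ^ k / m)"
          using u m b \<rho>0 L_ge_1 by (simp add: field_simps)
      qed
      also have "\<dots> = ennreal (L ^ n2 * J * (1 / (1 - b))) * (w (k, z) / ennreal m)"
        using b J L_ge_1 m by (simp add: w_def divide_ennreal flip: ennreal_mult) 
      also have "\<dots> \<le> ennreal (L ^ n2 * J * (1 + 1 / (\<sigma> * ln 2))) * ?k x y"
      proof (intro mult_mono ennreal_leI mult_left_mono geo)
        have "w (k, z) * (indicator (F (k, z)) x * indicator (F (k, z)) y) / emeasure M (F (k, z)) \<le> ?k x y"
          unfolding ball_kernel_def by (rule nn_integral_ge_point) (use z in \<open>simp add: I_def\<close>)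
        then show "w (k, z) / ennreal m \<le> ?k x y" using xF yF m by simp
      qed (use J L_ge_1 b in auto)
      finally show ?thesis .
    qed
    with avg show "\<exists>k. symmetric_submarkov M k \<and> maximal_dominates M \<rho> k \<and>
      (\<forall>x\<in>X. \<forall>y\<in>X. 1 \<le> \<rho> x y \<longrightarrow>
        decay \<sigma> x y \<le> ennreal (L ^ n2 * J * (1 + 1 / (\<sigma> * ln 2))) * k x y)"
      by blast
  qed
qed

end

section \<open>Mass of the kernel at infinity\<close>

lemma less_Liminf_ratio:
  fixes a b :: "real \<Rightarrow> ennreal"
  assumes "ennreal C \<le> Liminf at_top (\<lambda>r. a r / b r)" and c: "0 \<le> c" "c < C"
    and b: "\<And>r. 0 < r \<Longrightarrow> 0 < b r \<and> b r < \<infinity>"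
  shows "\<exists>r0\<ge>1. \<forall>r\<ge>r0. ennreal c * b r \<le> a r"
proof -
  have "ennreal c < Liminf at_top (\<lambda>r. a r / b r)"
    using assms by (intro less_le_trans[OF _ assms(1)]) (simp add: ennreal_less_iff)
  then have "\<forall>\<^sub>F r in at_top. ennreal c < a r / b r" by (rule less_LiminfD)
  then obtain r1 where r1: "\<And>r. r1 \<le> r \<Longrightarrow> ennreal c < a r / b r"
    by (auto simp: eventually_at_top_linorder)
  show ?thesis
  proof (intro exI[of _ "max 1 r1"] conjI allI impI)
    fix r assume r: "max 1 r1 \<le> r"
    then have br: "b r \<noteq> 0" "b r < top" using b[of r] by auto
    have "ennreal c * b r \<le> a r / b r * b r"
      using r1[of r] r by (intro mult_right_mono) auto
    also have "\<dots> = a r" using br by (simp add: ennreal_divide_times less_top)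
    finally show "ennreal c * b r \<le> a r" .
  qed simp
qed

context homogeneous_space
begin

text \<open>Reverse doubling makes balls grow geometrically, so that for a large enough ratio the inner
  ball of an annulus is negligible against the part of \<open>\<Omega>\<close> in the outer ball.\<close>

lemma annuli_meet:
  assumes wrd: "weak_reverse_doubling M \<rho>" and wmd: "weak_measure_density M \<rho> \<Omega>"
    and \<Omega> [measurable]: "\<Omega> \<in> sets M"
  obtains x0 lam \<delta> r0 where "x0 \<in> X" "1 < lam" "0 < \<delta>" "1 \<le> r0"
    "\<And>r. r0 \<le> r \<Longrightarrow> ennreal \<delta> * V x0 (lam * r) \<le> emeasure M (\<Omega> \<inter> (B x0 (lam * r) - B x0 r))"
proof -
  have K0: "0 < K" using K_ge_1 by simp
  obtain x0 l C where x0: "x0 \<in> X" and l: "1 < l" and C: "(1::real) < C"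
    and lim0: "ennreal C \<le> Liminf at_top (\<lambda>r. V x0 (l * r) / V x0 r)"
    using wrd by (auto simp: weak_reverse_doubling_def)
  obtain x1 C0 where x1: "x1 \<in> X" and C0: "0 < C0"
    and lim1: "ennreal C0 \<le> Liminf at_top (\<lambda>r. emeasure M (B x1 r \<inter> \<Omega>) / V x1 r)"
    using wmd by (auto simp: weak_measure_density_def)
  \<comment> \<open>any number strictly between \<open>1\<close> and \<open>C\<close> would do\<close>
  define c where "c = (1 + C) / 2"
  have c: "1 < c" "c < C" using C by (auto simp: c_def field_simps)
  obtain r1 where r1: "1 \<le> r1" "\<And>r. r1 \<le> r \<Longrightarrow> ennreal c * V x0 r \<le> V x0 (l * r)"
    using less_Liminf_ratio[OF lim0, of c] c ball_pos[OF x0] ball_finite[OF x0] by auto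
  obtain r2 where r2: "1 \<le> r2" "\<And>r. r2 \<le> r \<Longrightarrow> ennreal (C0 / 2) * V x1 r \<le> emeasure M (B x1 r \<inter> \<Omega>)"
    using less_Liminf_ratio[OF lim1, of "C0 / 2"] C0 ball_pos[OF x1] ball_finite[OF x1] by auto
  obtain n where n: "4 * K * K < 2 ^ n" using real_arch_pow[of 2] by auto
  define \<eta> where "\<eta> = C0 / 2 / L ^ n"
  have \<eta>: "0 < \<eta>" using C0 L_ge_1 by (simp add: \<eta>_def)
  \<comment> \<open>with this many steps of reverse doubling the inner ball has at most \<open>\<eta> / 2\<close> times the measure of the outer one\<close>
  obtain m where m: "2 / \<eta> < c ^ m" using real_arch_pow[OF c(1)] by auto
  define lam where "lam = l ^ Suc m"
  have lam1: "1 < lam" using l by (simp add: lam_def one_less_power del: power_Suc)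
  define d where "d = 2 * K * (\<rho> x0 x1 + r2)"
  have dx: "0 \<le> \<rho> x0 x1" using x0 x1 by (rule dist_nonneg)
  have dens: "ennreal \<eta> * V x0 r \<le> emeasure M (B x0 r \<inter> \<Omega>)" if r: "d \<le> r" for r
  proof -
    have r0: "0 < r" using r dx r2 K0 unfolding d_def by (smt (verit) mult_pos_pos)
    have rr: "\<rho> x0 x1 + r2 \<le> r / (2 * K)" using r K0 unfolding d_def by (simp add: field_simps)
    have pos: "0 < r / (2 * K)" using r0 K0 by simp
    have le_r: "r / (2 * K) \<le> r" using r0 K_ge_1 by (simp add: field_simps)
    have "V x0 r \<le> ennreal (L ^ n) * V x1 (r / (2 * K))"
    proof (rule V_compare[where a = r])
      have "K * (r + r) = 4 * K * K * (r / (2 * K))" using K0 by (simp add: field_simps)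
      also have "\<dots> \<le> 2 ^ n * (r / (2 * K))" using n pos by (intro mult_right_mono) auto
      finally show "K * (r + r) \<le> 2 ^ n * (r / (2 * K))" .
      show "\<rho> x1 x0 \<le> r" using rr le_r r2 dist_sym[OF x0 x1] by simp
    qed (use x0 x1 pos in auto)
    then have "ennreal \<eta> * V x0 r \<le> ennreal \<eta> * (ennreal (L ^ n) * V x1 (r / (2 * K)))"
      by (rule mult_left_mono) simp
    also have "\<dots> = ennreal (C0 / 2) * V x1 (r / (2 * K))"
      using C0 L_ge_1 by (simp add: \<eta>_def flip: mult.assoc ennreal_mult)
    also have "\<dots> \<le> emeasure M (B x1 (r / (2 * K)) \<inter> \<Omega>)"
      using rr dx by (intro r2) auto
    also have "\<dots> \<le> emeasure M (B x0 r \<inter> \<Omega>)"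
    proof (intro emeasure_mono Int_mono ball_subset[where a = "r / (2 * K)"])
      show "\<rho> x0 x1 \<le> r / (2 * K)" using rr r2 by simp
      show "K * (r / (2 * K) + r / (2 * K)) \<le> r" using K0 by (simp add: field_simps)
    qed (use x0 x1 r0 ball_sets in auto)
    finally show ?thesis .
  qed
  have grow: "ennreal (c ^ k) * V x0 r \<le> V x0 (l ^ k * r)" if r: "r1 \<le> r" for k r
  proof (induction k)
    case (Suc k)
    have "1 * r \<le> l ^ k * r" using r r1 l by (intro mult_right_mono) auto
    then have k: "r1 \<le> l ^ k * r" using r by simp
    have "ennreal (c ^ Suc k) * V x0 r = ennreal c * (ennreal (c ^ k) * V x0 r)"
      using c by (simp add: ennreal_mult mult.assoc)
    also have "\<dots> \<le> ennreal c * V x0 (l ^ k * r)" using Suc by (rule mult_left_mono) simp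
    also have "\<dots> \<le> V x0 (l * (l ^ k * r))" by (rule r1(2)[OF k])
    finally show ?case by (simp add: mult.assoc)
  qed simp
  show thesis
  proof (rule that[OF x0 lam1])
    show "0 < \<eta> / 2" using \<eta> by simp
    show "1 \<le> max r1 d" using r1 by simp
    fix r assume r: "max r1 d \<le> r"
    have r0: "0 < r" using r r1 by simp
    have lr: "r \<le> lam * r" using lam1 r0 by simp
    have lr0: "0 < lam * r" using lr r0 by simp
    obtain v where v: "0 < v" "V x0 (lam * r) = ennreal v" using V_real[OF x0 lr0] .
    obtain u where u: "0 < u" "V x0 r = ennreal u" using V_real[OF x0 r0] .
    have cm: "2 / \<eta> < c ^ Suc m" 
    proof -
      have "1 * c ^ m \<le> c * c ^ m" using c by (intro mult_right_mono) auto
      then show ?thesis using m by simp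
    qed
    have "ennreal (c ^ Suc m) * V x0 r \<le> V x0 (lam * r)"
      using grow[of r "Suc m"] r by (simp add: lam_def del: power_Suc)
    then have "c ^ Suc m * u \<le> v" using c u v by (simp flip: ennreal_mult del: power_Suc)
    moreover have "2 / \<eta> * u \<le> c ^ Suc m * u" using cm u by (intro mult_right_mono) auto
    ultimately have "2 / \<eta> * u \<le> v" by simp
    then have uv: "u \<le> \<eta> / 2 * v" using \<eta> by (simp add: field_simps)
    let ?a = "emeasure M (\<Omega> \<inter> (B x0 (lam * r) - B x0 r))"
    have [measurable]: "B x0 (lam * r) \<in> sets M" "B x0 r \<in> sets M"
      using x0 r0 lr0 by (auto intro: ball_sets)
    have "?a \<le> V x0 (lam * r)" by (intro emeasure_mono) auto
    then obtain a where a: "0 \<le> a" "?a = ennreal a" using v by (cases ?a) (auto simp: top_unique)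
    have "ennreal (\<eta> * v) = ennreal \<eta> * V x0 (lam * r)" using v \<eta> by (simp add: ennreal_mult)
    also have "\<dots> \<le> emeasure M (B x0 (lam * r) \<inter> \<Omega>)" using r lr by (intro dens) auto
    also have "\<dots> \<le> emeasure M ((\<Omega> \<inter> (B x0 (lam * r) - B x0 r)) \<union> B x0 r)"
      by (intro emeasure_mono) auto
    also have "\<dots> \<le> ?a + V x0 r" by (intro emeasure_subadditive) auto
    also have "\<dots> = ennreal (a + u)" using a u by simp
    finally have "\<eta> * v \<le> a + u" using a u by (subst (asm) ennreal_le_iff) auto
    with uv have "\<eta> / 2 * v \<le> a" by (simp add: field_simps)
    then have "ennreal (\<eta> / 2 * v) \<le> ennreal a" by (rule ennreal_leI)
    moreover have "ennreal (\<eta> / 2) * V x0 (lam * r) = ennreal (\<eta> / 2 * v)"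
      unfolding v(2) using v(1) \<eta> by (intro ennreal_mult[symmetric]) auto
    ultimately show "ennreal (\<eta> / 2) * V x0 (lam * r) \<le> ?a" using a(2) by simp
  qed
qed

text \<open>A minorant \<open>\<kappa>\<close> of the Gagliardo kernel that does not depend on the point \<open>x\<close> of the ball
  \<open>B x0 R\<close>, is supported in the part of \<open>\<Omega>\<close> outside this ball, and has mass at least \<open>m\<close>.\<close>

definition far_minorant :: "'a set \<Rightarrow> 'a \<Rightarrow> real \<Rightarrow> real \<Rightarrow> real \<Rightarrow> ('a \<Rightarrow> ennreal) \<Rightarrow> bool" where
  "far_minorant \<Omega> x0 R \<sigma> m \<kappa> \<longleftrightarrow> \<kappa> \<in> borel_measurable M \<and> ennreal m \<le> (\<integral>\<^sup>+y. \<kappa> y \<partial>M) \<and>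
     (\<forall>y\<in>X. \<kappa> y \<noteq> 0 \<longrightarrow> y \<in> \<Omega> \<and> R \<le> \<rho> x0 y) \<and>
     (\<forall>x\<in>B x0 R. \<forall>y\<in>X. \<kappa> y \<noteq> 0 \<longrightarrow> 1 \<le> \<rho> x y \<and>
        \<kappa> y \<le> decay \<sigma> x y)"

text \<open>Give the part of \<open>\<Omega>\<close> in the \<open>j\<close>-th of a sequence of annuli of ratio \<open>lam\<close> the value that the
  kernel takes there up to constants. By \<open>annuli_meet\<close> its mass is at least a constant times
  \<open>lam\<^bsup>-j\<sigma>\<^esup>\<close> times a factor that tends to \<open>1\<close> as \<open>\<sigma> \<rightarrow> 0\<close>, and \<open>\<Sum>\<^sub>j lam\<^bsup>-j\<sigma>\<^esup>\<close> is of order \<open>1 / \<sigma>\<close>. The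
  constant \<open>c\<close> does not depend on \<open>R\<close>; only the threshold for \<open>\<sigma>\<close> does.\<close>

lemma far_kernel_minorant:
  assumes wrd: "weak_reverse_doubling M \<rho>" and wmd: "weak_measure_density M \<rho> \<Omega>"
    and \<Omega> [measurable]: "\<Omega> \<in> sets M"
  obtains x0 c where "x0 \<in> X" "0 < c"
    "\<And>R. 1 \<le> R \<Longrightarrow> \<exists>\<sigma>0>0. \<forall>\<sigma>. 0 < \<sigma> \<and> \<sigma> < \<sigma>0 \<longrightarrow> (\<exists>\<kappa>. far_minorant \<Omega> x0 R \<sigma> (c / \<sigma>) \<kappa>)"
proof -
  have K0: "0 < K" using K_ge_1 by simp
  obtain x0 lam \<delta> r0 where x0: "x0 \<in> X" and lam: "1 < lam" and \<delta>: "0 < \<delta>" and r0: "1 \<le> r0"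
    and ann: "\<And>r. r0 \<le> r \<Longrightarrow> ennreal \<delta> * V x0 (lam * r) \<le> emeasure M (\<Omega> \<inter> (B x0 (lam * r) - B x0 r))"
    using annuli_meet[OF wrd wmd \<Omega>] by metis
  obtain n where n: "K * (1 + 2 * K) < 2 ^ n" using real_arch_pow[of 2] by auto
  define c where "c = \<delta> / (2 * L ^ n * ln lam)"
  have lnl: "0 < ln lam" using lam by simp
  have c: "0 < c" using \<delta> L_ge_1 lnl by (simp add: c_def)
  show thesis
  proof (rule that[OF x0 c])
    fix R :: real assume R: "1 \<le> R"
    define S where "S = max r0 (K * (R + 1))"
    have SR: "R + 1 \<le> S / K" using K0 by (simp add: S_def field_simps)
    have "R \<le> R + 1" by simp
    also have "R + 1 \<le> K * (R + 1)" using K_ge_1 R by (simp add: mult_le_cancel_right1)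
    finally have RS: "R \<le> S" by (simp add: S_def)
    have S1: "1 \<le> S" using RS R by simp
    define d where "d j = 2 * K * (lam ^ Suc j * S)" for j
    have lS: "S \<le> lam ^ j * S" for j
    proof -
      have "1 * S \<le> lam ^ j * S" using S1 lam by (intro mult_right_mono) auto
      then show ?thesis by simp
    qed
    have d1: "1 < d j" for j
    proof -
      have "1 \<le> lam ^ Suc j * S" using lS[of "Suc j"] S1 by linarith
      then have "1 * 1 \<le> K * (lam ^ Suc j * S)" using K_ge_1 by (intro mult_mono) auto
      then show ?thesis by (simp add: d_def)
    qed
    \<comment> \<open>for \<open>\<sigma> < \<sigma>0\<close> the factor \<open>(d 0)\<^bsup>-\<sigma>\<^esup>\<close> is at least \<open>1/2\<close>\<close>
    define \<sigma>0 where "\<sigma>0 = ln 2 / ln (d 0)"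
    have \<sigma>0: "0 < \<sigma>0" using d1[of 0] by (simp add: \<sigma>0_def)
    show "\<exists>\<sigma>0>0. \<forall>\<sigma>. 0 < \<sigma> \<and> \<sigma> < \<sigma>0 \<longrightarrow> (\<exists>\<kappa>. far_minorant \<Omega> x0 R \<sigma> (c / \<sigma>) \<kappa>)"
    proof (intro exI[of _ \<sigma>0] conjI allI impI \<sigma>0)
      fix \<sigma> assume "0 < \<sigma> \<and> \<sigma> < \<sigma>0"
      then have \<sigma>: "0 < \<sigma>" "\<sigma> < \<sigma>0" by auto
      define A where "A j = \<Omega> \<inter> (B x0 (lam * (lam ^ j * S)) - B x0 (lam ^ j * S))" for j
      have Sj: "0 < lam ^ j * S" for j using lS[of j] S1 by linarith
      have Sj': "0 < lam * (lam ^ j * S)" for j using Sj[of "Suc j"] by (simp add: mult.assoc)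
      have [measurable]: "A j \<in> sets M" for j
        unfolding A_def using x0 Sj Sj' by (intro sets.Int \<Omega> sets.Diff ball_sets) auto
      obtain v where v: "\<And>j. 0 < v j" "\<And>j. V x0 (lam * (lam ^ j * S)) = ennreal (v j)"
      proof -
        have "\<exists>v. 0 < v \<and> V x0 (lam * (lam ^ j * S)) = ennreal v" for j
          using V_real[OF x0 Sj'[of j]] by blast
        then show thesis using that by metis
      qed
      define e where "e j = 1 / (L ^ n * v j * d j powr \<sigma>)" for j
      have e0: "0 < e j" for j using v[of j] d1[of j] L_ge_1 by (simp add: e_def)
      define \<kappa> where "\<kappa> y = (\<Sum>j. ennreal (e j) * indicator (A j) y)" for y
      have [measurable]: "\<kappa> \<in> borel_measurable M" unfolding \<kappa>_def[abs_def] by measurable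
      have disj: "disjoint_family A"
      proof -
        have "A i \<inter> A j = {}" if "i < j" for i j
        proof -
          have "lam ^ Suc i \<le> lam ^ j" using that lam by (intro power_increasing) auto
          then have "lam * (lam ^ i * S) \<le> lam ^ j * S" using S1 by (simp add: mult_right_mono flip: mult.assoc)
          from ball_mono[OF this, of x0] show ?thesis by (auto simp: A_def)
        qed
        then show ?thesis
          unfolding disjoint_family_on_def by (metis inf_commute linorder_neq_iff)
      qed
      have \<kappa>_eq: "\<kappa> y = ennreal (e j)" if "y \<in> A j" for y j
        unfolding \<kappa>_def by (rule suminf_cmult_indicator[OF disj that])
      have \<kappa>_ex: "\<exists>j. y \<in> A j" if "\<kappa> y \<noteq> 0" for y
      proof (rule ccontr)
        assume "\<not> (\<exists>j. y \<in> A j)"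
        then have "\<kappa> y = 0" by (simp add: \<kappa>_def)
        with that show False by simp
      qed
      have near: "lam ^ j * S \<le> \<rho> x0 y" "\<rho> x0 y < lam * (lam ^ j * S)" "y \<in> X" "y \<in> \<Omega>" if "y \<in> A j" for y j
        using that by (auto simp: A_def qball_def)
      have mass: "ennreal (c / \<sigma>) \<le> (\<integral>\<^sup>+y. \<kappa> y \<partial>M)"
      proof -
        define b where "b = lam powr (- \<sigma>)"
        have b: "0 < b" "b < 1" using \<sigma> lam by (auto simp: b_def powr_less_one)
        define a where "a = \<delta> / L ^ n * d 0 powr (- \<sigma>)"
        have a: "0 < a" using \<delta> L_ge_1 d1[of 0] by (simp add: a_def)
        have summand: "ennreal (a * b ^ j) \<le> ennreal (e j) * emeasure M (A j)" for j
        proof -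
          have "d j = lam ^ j * d 0" by (simp add: d_def)
          then have "d j powr (- \<sigma>) = (lam ^ j) powr (- \<sigma>) * d 0 powr (- \<sigma>)"
            using lam d1[of 0] by (simp add: powr_mult)
          also have "(lam ^ j) powr (- \<sigma>) = b ^ j"
            using lam by (simp add: b_def powr_powr mult.commute flip: powr_realpow)
          finally have dj: "d j powr (- \<sigma>) = b ^ j * d 0 powr (- \<sigma>)" .
          have "e j * (\<delta> * v j) = \<delta> / L ^ n * d j powr (- \<sigma>)"
            using v(1)[of j] L_ge_1 d1[of j] by (simp add: e_def powr_minus field_simps)
          also have "\<dots> = a * b ^ j" by (simp add: dj a_def)
          finally have "ennreal (a * b ^ j) = ennreal (e j) * (ennreal \<delta> * V x0 (lam * (lam ^ j * S)))"
            using e0[of j] v[of j] \<delta> by (simp flip: ennreal_mult)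
          also have "\<dots> \<le> ennreal (e j) * emeasure M (A j)"
          proof -
            have "r0 \<le> lam ^ j * S" using lS[of j] by (simp add: S_def)
            then show ?thesis unfolding A_def by (intro mult_left_mono ann) auto
          qed
          finally show ?thesis .
        qed
        have "c / \<sigma> \<le> a * (1 / (1 - b))"
        proof -
          have "1 + (- (\<sigma> * ln lam)) \<le> exp (- (\<sigma> * ln lam))" by (rule exp_ge_add_one_self)
          then have "1 - b \<le> \<sigma> * ln lam" using lam by (simp add: b_def powr_def)
          then have 1: "1 / (\<sigma> * ln lam) \<le> 1 / (1 - b)" using b by (intro divide_left_mono) (auto simp: lnl \<sigma>)
          have "d 0 powr \<sigma> \<le> d 0 powr \<sigma>0" using d1[of 0] \<sigma> by (intro powr_mono) auto
          also have "\<dots> = 2" using d1[of 0] by (simp add: \<sigma>0_def powr_def)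
          finally have "1 / 2 \<le> d 0 powr (- \<sigma>)" using d1[of 0] by (simp add: powr_minus field_simps)
          then have 2: "\<delta> / L ^ n * (1 / 2) \<le> a"
            unfolding a_def using \<delta> L_ge_1 by (intro mult_left_mono) auto
          have "c / \<sigma> = (\<delta> / L ^ n * (1 / 2)) * (1 / (\<sigma> * ln lam))" by (simp add: c_def)
          also have "\<dots> \<le> a * (1 / (1 - b))" using 1 2 a \<sigma> lnl by (intro mult_mono) auto
          finally show ?thesis .
        qed
        then have "ennreal (c / \<sigma>) \<le> ennreal (a * (1 / (1 - b)))" by (rule ennreal_leI)
        also have "\<dots> = (\<Sum>j. ennreal (a * b ^ j))"
          using a b by (intro suminf_ennreal_eq[symmetric] sums_mult geometric_sums) auto
        also have "\<dots> \<le> (\<Sum>j. ennreal (e j) * emeasure M (A j))"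
          by (intro suminf_le summand) auto
        also have "\<dots> = (\<integral>\<^sup>+y. \<kappa> y \<partial>M)"
          unfolding \<kappa>_def by (subst nn_integral_suminf) (auto simp: nn_integral_cmult_indicator)
        finally show ?thesis .
      qed
      have upper: "1 \<le> \<rho> x y \<and> \<kappa> y \<le> decay \<sigma> x y"
        if x: "x \<in> B x0 R" and y: "y \<in> A j" for x y j
      proof -
        have xX: "x \<in> X" and x0x: "\<rho> x0 x < R" using x by (auto simp: qball_def)
        have xx0: "\<rho> x x0 < R" using x0x dist_sym[OF x0 xX] by simp
        note yA = near[OF y]
        have "S \<le> \<rho> x0 y" using yA(1) lS[of j] by linarith
        also have "\<dots> \<le> K * (\<rho> x0 x + \<rho> x y)" using x0 xX yA by (intro quasi_triangle)
        finally have "S / K \<le> \<rho> x0 x + \<rho> x y" using K0 by (simp add: field_simps)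
        then have far: "1 \<le> \<rho> x y" using SR x0x by linarith
        have R': "R \<le> lam * (lam ^ j * S)" using RS lS[of "Suc j"] by (simp add: mult.assoc)
        have "\<rho> x y \<le> K * (\<rho> x x0 + \<rho> x0 y)" using x0 xX yA by (intro quasi_triangle)
        also have "\<dots> \<le> K * (lam * (lam ^ j * S) + lam * (lam ^ j * S))"
          using xx0 R' yA K0 by (intro mult_left_mono add_mono) auto
        finally have close: "\<rho> x y \<le> d j" by (simp add: d_def algebra_simps)
        have "V x (d j) \<le> ennreal (L ^ n) * V x0 (lam * (lam ^ j * S))"
        proof (rule V_compare[where a = "lam * (lam ^ j * S)"])
          have "K * (lam * (lam ^ j * S) + d j) = K * (1 + 2 * K) * (lam * (lam ^ j * S))"
            by (simp add: d_def algebra_simps)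
          also have "\<dots> \<le> 2 ^ n * (lam * (lam ^ j * S))"
            using n Sj'[of j] by (intro mult_right_mono) auto
          finally show "K * (lam * (lam ^ j * S) + d j) \<le> 2 ^ n * (lam * (lam ^ j * S))" .
        qed (use x0 xX x0x R' Sj' in auto)
        moreover have "V x (\<rho> x y) \<le> V x (d j)" using xX close d1[of j] by (intro V_mono) auto
        moreover obtain vx where vx: "0 < vx" "V x (\<rho> x y) = ennreal vx"
          using V_real[OF xX, of "\<rho> x y"] far by auto
        ultimately have "ennreal vx \<le> ennreal (L ^ n * v j)"
          using v(1)[of j] v(2)[of j] L_ge_1 by (simp add: ennreal_mult)
        then have vxv: "vx \<le> L ^ n * v j" using v(1)[of j] L_ge_1 by simp
        obtain vy where vy: "0 < vy" "V y (\<rho> x y) = ennreal vy"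
          using V_real[OF yA(3), of "\<rho> x y"] far by auto
        define u where "u = min vx vy"
        have u: "0 < u" "u \<le> L ^ n * v j" using vx vy vxv by (auto simp: u_def)
        have U: "U_kernel M \<rho> x y = ennreal u"
          using vx vy by (simp add: U_kernel_def u_def min_ennreal)
        have "\<kappa> y = ennreal (e j)" by (rule \<kappa>_eq[OF y])
        also have "\<dots> \<le> ennreal (1 / (u * \<rho> x y powr \<sigma>))"
          unfolding e_def
        proof (intro ennreal_leI divide_left_mono mult_mono u powr_mono2)
          show "0 < L ^ n * v j * d j powr \<sigma> * (u * \<rho> x y powr \<sigma>)"
            using L_ge_1 v(1)[of j] d1[of j] u far by simp
        qed (use L_ge_1 v(1)[of j] close \<sigma> far u in auto)
        also have "\<dots> = decay \<sigma> x y"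
          using u far by (simp add: U divide_ennreal flip: ennreal_mult ennreal_1)
        finally show ?thesis using far by simp
      qed
      show "\<exists>\<kappa>. far_minorant \<Omega> x0 R \<sigma> (c / \<sigma>) \<kappa>"
        unfolding far_minorant_def
      proof (intro exI[of _ \<kappa>] conjI ballI impI mass)
        fix y assume "\<kappa> y \<noteq> 0"
        then obtain j where j: "y \<in> A j" using \<kappa>_ex by blast
        show "y \<in> \<Omega>" "R \<le> \<rho> x0 y" using near[OF j] lS[of j] RS by auto
      next
        fix x y assume x: "x \<in> B x0 R" and "\<kappa> y \<noteq> 0"
        then obtain j where j: "y \<in> A j" using \<kappa>_ex by blast
        show "1 \<le> \<rho> x y" "\<kappa> y \<le> decay \<sigma> x y"
          using upper[OF x j] by auto
      qed measurable
    qed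
  qed
qed

end

section \<open>Restricted norms\<close>

lemma zero_extension_measurable:
  fixes f :: "'a \<Rightarrow> complex"
  assumes "\<Omega> \<in> sets M" "f \<in> borel_measurable (restrict_space M \<Omega>)"
  shows "(\<lambda>x. if x \<in> \<Omega> then f x else 0) \<in> borel_measurable M"
proof -
  have "\<Omega> \<inter> space M \<in> sets M" using assms by auto
  show ?thesis
    by (rule iffD1[OF measurable_restrict_space_iff[OF \<open>\<Omega> \<inter> space M \<in> sets M\<close>] assms(2)]) simp
qed

definition abs_on :: "'a set \<Rightarrow> ('a \<Rightarrow> complex) \<Rightarrow> 'a \<Rightarrow> ennreal" where
  "abs_on \<Omega> f x = ennreal (cmod (f x)) * indicator \<Omega> x"

lemma abs_on_measurable:
  assumes "\<Omega> \<in> sets M" "f \<in> borel_measurable (restrict_space M \<Omega>)"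
  shows "abs_on \<Omega> f \<in> borel_measurable M"
proof -
  have "abs_on \<Omega> f = (\<lambda>x. ennreal (cmod (if x \<in> \<Omega> then f x else 0)))"
    by (auto simp: abs_on_def)
  with zero_extension_measurable[OF assms] show ?thesis by simp
qed

text \<open>Among the extensions of \<open>f\<close> to the whole space the extension by zero has the smallest norm.\<close>

lemma restr_norm_eq:
  assumes bqb: "ball_quasi_banach M \<rho> N" and \<Omega>: "\<Omega> \<in> sets M"
    and f: "f \<in> borel_measurable (restrict_space M \<Omega>)"
  shows "restr_norm M N \<Omega> f = ext_norm N (abs_on \<Omega> f)"
proof -
  define f0 where "f0 x = (if x \<in> \<Omega> then f x else 0)" for x
  have [measurable]: "f0 \<in> borel_measurable M"
    unfolding f0_def[abs_def] by (rule zero_extension_measurable[OF \<Omega> f])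
  have "abs_on \<Omega> f = (\<lambda>x. ennreal (cmod (f0 x)))" by (auto simp: abs_on_def f0_def)
  then have "ext_norm N (abs_on \<Omega> f) = N f0" by (simp add: ext_norm_cmod[OF bqb])
  also have "N f0 = restr_norm M N \<Omega> f"
  proof (rule antisym)
    show "N f0 \<le> restr_norm M N \<Omega> f"
      unfolding restr_norm_def
    proof (rule INF_greatest)
      fix g assume "g \<in> {g \<in> fspace M N. \<forall>x\<in>\<Omega>. g x = f x}"
      then show "N f0 \<le> N g"
        by (intro ball_norm_mono[OF bqb]) (auto simp: fspace_def f0_def)
    qed
    show "restr_norm M N \<Omega> f \<le> N f0"
    proof (cases "N f0 < \<infinity>")
      case True then show ?thesis
        unfolding restr_norm_def by (intro INF_lower) (auto simp: fspace_def f0_def)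
    qed (simp add: not_less top_unique)
  qed
  finally show ?thesis by simp
qed

lemma restr_norm_ext_le:
  assumes bqb: "ball_quasi_banach M \<rho> N" and \<Omega>: "\<Omega> \<in> sets M"
    and H [measurable]: "H \<in> borel_measurable M" and le: "AE x in M. x \<in> \<Omega> \<longrightarrow> h x \<le> H x"
  shows "restr_norm_ext M N \<Omega> h \<le> ext_norm N H"
proof (cases "ext_norm N H < \<infinity>")
  case True
  have \<Omega>': "\<Omega> \<inter> space M \<in> sets M" using \<Omega> by auto
  define k where "k x = complex_of_real (enn2real (H x))" for x
  have k: "k \<in> borel_measurable M" unfolding k_def[abs_def] by measurable
  have kr: "k \<in> borel_measurable (restrict_space M \<Omega>)" using k by (rule measurable_restrict_space1)
  have "AE x in restrict_space M \<Omega>. h x \<le> ennreal (cmod (k x))"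
    unfolding AE_restrict_space_iff[OF \<Omega>']
    using ext_norm_finite_imp_AE[OF bqb H True] le by eventually_elim (auto simp: k_def)
  with kr have "restr_norm_ext M N \<Omega> h \<le> restr_norm M N \<Omega> k"
    unfolding restr_norm_ext_def by (intro INF_lower) auto
  also have "\<dots> = ext_norm N (abs_on \<Omega> k)" by (rule restr_norm_eq[OF bqb \<Omega> kr])
  also have "\<dots> \<le> ext_norm N H"
    using abs_on_measurable[OF \<Omega> kr]
    by (intro ext_norm_mono_AE[OF bqb]) (auto simp: abs_on_def k_def ennreal_enn2real_if indicator_def)
  finally show ?thesis .
qed (simp add: not_less top_unique)

lemma restr_norm_ext_less_imp:
  assumes bqb: "ball_quasi_banach M \<rho> N" and \<Omega>: "\<Omega> \<in> sets M"
    and less: "restr_norm_ext M N \<Omega> h < b"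
  obtains H where "H \<in> borel_measurable M" "AE x in M. x \<in> \<Omega> \<longrightarrow> h x \<le> H x" "ext_norm N H < b"
proof -
  have \<Omega>': "\<Omega> \<inter> space M \<in> sets M" using \<Omega> by auto
  obtain k where k: "k \<in> borel_measurable (restrict_space M \<Omega>)"
      "AE x in restrict_space M \<Omega>. h x \<le> ennreal (cmod (k x))" "restr_norm M N \<Omega> k < b"
    using less unfolding restr_norm_ext_def INF_less_iff by auto
  show thesis
  proof (rule that)
    show "abs_on \<Omega> k \<in> borel_measurable M" by (rule abs_on_measurable[OF \<Omega> k(1)])
    show "AE x in M. x \<in> \<Omega> \<longrightarrow> h x \<le> abs_on \<Omega> k x"
      using k(2) unfolding AE_restrict_space_iff[OF \<Omega>'] by eventually_elim (simp add: abs_on_def)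
    show "ext_norm N (abs_on \<Omega> k) < b" using k(3) by (simp add: restr_norm_eq[OF bqb \<Omega> k(1)])
  qed
qed

section \<open>The estimate from above\<close>

lemma ennreal_inverse_antimono: "c \<le> d \<Longrightarrow> inverse d \<le> inverse (c::ennreal)"
  by (cases "c = 0"; cases c; cases d) (auto simp: inverse_ennreal ennreal_leI top_unique)

lemma ennreal_divide_antimono: "c \<le> d \<Longrightarrow> a / d \<le> a / (c::ennreal)"
  by (simp add: divide_ennreal_def mult_left_mono ennreal_inverse_antimono)

lemma ennpowr_norm_diff_le:
  fixes a b :: complex
  assumes "0 < q"
  shows "ennreal (cmod (a - b) powr q) \<le> ennreal (2 powr q) * (ennpowr (ennreal (cmod a)) q + ennpowr (ennreal (cmod b)) q)"
    and "ennpowr (ennreal (cmod a)) q \<le> ennreal (2 powr q) * (ennreal (cmod (a - b) powr q) + ennpowr (ennreal (cmod b)) q)"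
proof -
  have "ennpowr (ennreal (cmod (a - b))) q \<le> ennpowr (ennreal (cmod a) + ennreal (cmod b)) q"
    using assms norm_triangle_ineq4[of a b] by (intro ennpowr_mono) (simp_all add: ennreal_leI flip: ennreal_plus)
  also note ennpowr_add_le[OF assms]
  finally show "ennreal (cmod (a - b) powr q) \<le> ennreal (2 powr q) * (ennpowr (ennreal (cmod a)) q + ennpowr (ennreal (cmod b)) q)"
    by (simp add: ennpowr_ennreal)
  have "ennpowr (ennreal (cmod a)) q \<le> ennpowr (ennreal (cmod (a - b)) + ennreal (cmod b)) q"
    using assms norm_triangle_ineq[of "a - b" b] by (intro ennpowr_mono) (simp_all add: ennreal_leI flip: ennreal_plus)
  also note ennpowr_add_le[OF assms]
  finally show "ennpowr (ennreal (cmod a)) q \<le> ennreal (2 powr q) * (ennreal (cmod (a - b) powr q) + ennpowr (ennreal (cmod b)) q)"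
    by (simp add: ennpowr_ennreal)
qed

definition gagliardo_integrand ::
    "'a measure \<Rightarrow> ('a \<Rightarrow> 'a \<Rightarrow> real) \<Rightarrow> real \<Rightarrow> real \<Rightarrow> ('a \<Rightarrow> complex) \<Rightarrow> 'a \<Rightarrow> 'a \<Rightarrow> ennreal" where
  "gagliardo_integrand M \<rho> s q f x y = (if y = x then 0
     else ennreal (cmod (f x - f y) powr q) / (U_kernel M \<rho> x y * ennreal (\<rho> x y powr (s * q))))"

lemma gagliardo_fun_eq:
  "gagliardo_fun M \<rho> \<Omega> s q f x = ennpowr (\<integral>\<^sup>+y\<in>\<Omega>. gagliardo_integrand M \<rho> s q f x y \<partial>M) (1 / q)"
  by (simp add: gagliardo_fun_def gagliardo_integrand_def)

lemma powr_tendsto_0_at_right: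
  fixes a :: real assumes "0 < a" shows "((\<lambda>s. s powr a) \<longlongrightarrow> 0) (at_right 0)"
proof -
  have "((\<lambda>s. s powr a) \<longlongrightarrow> 0 powr a) (at_right 0)"
    using assms by (intro tendsto_powr') (auto simp: eventually_at_right_field intro!: tendsto_ident_at exI[of _ 1])
  then show ?thesis by simp
qed

locale restricted_function_space =
  homogeneous_space M \<rho> K L + norm: function_quasinorm M "ext_norm N" Q
  for M :: "'a measure" and \<rho> K L N Q +
  fixes \<Omega> :: "'a set" and p q :: real
  assumes q: "0 < q" "q \<le> p"
    and Y: "ball_quasi_banach M \<rho> N"
    and \<Omega> [measurable]: "\<Omega> \<in> sets M"
    and endpoint: "hl_endpoint_bounded M \<rho> N p"
begin

abbreviation P :: "('a \<Rightarrow> ennreal) \<Rightarrow> ennreal" where "P \<equiv> ext_norm N"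
abbreviation G :: "real \<Rightarrow> ('a \<Rightarrow> complex) \<Rightarrow> 'a \<Rightarrow> ennreal" where "G s f \<equiv> gagliardo_fun M \<rho> \<Omega> s q f"
text \<open>The quantity whose lower and upper limits at \<open>0\<close> the theorem is about.\<close>

abbreviation energy :: "('a \<Rightarrow> complex) \<Rightarrow> real \<Rightarrow> ennreal" where
  "energy f \<equiv> \<lambda>s. ennreal (s powr (1 / q)) * sobolev_seminorm M \<rho> N \<Omega> s q f"

text \<open>What both estimates use of the kernel \<open>k\<close>: away from the diagonal it dominates the Gagliardo kernel
  up to a factor of order \<open>1 / s\<close>, and its power means are bounded with \<open>A\<close> independent of \<open>s\<close>.\<close>

definition far_averaging :: "real \<Rightarrow> real \<Rightarrow> real \<Rightarrow> ('a \<Rightarrow> 'a \<Rightarrow> ennreal) \<Rightarrow> bool" where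
  "far_averaging D A s k \<longleftrightarrow> symmetric_submarkov M k \<and>
     (\<forall>x\<in>X. \<forall>y\<in>X. 1 \<le> \<rho> x y \<longrightarrow>
        decay (s * q) x y \<le> ennreal (D * (1 + 1 / (s * q * ln 2))) * k x y) \<and>
     (\<forall>u\<in>borel_measurable M.
        P (\<lambda>x. ennpowr (kernel_op M k (\<lambda>y. ennpowr (u y) q) x) (1 / q)) \<le> ennreal A * P u)"

lemma far_averages:
  obtains D A where "0 < D" "0 < A"
    "\<And>s. 0 < s \<Longrightarrow> \<exists>k. far_averaging D A s k"
proof -
  obtain D where D: "0 < D"
    "\<And>\<sigma>. 0 < \<sigma> \<Longrightarrow> \<exists>k. symmetric_submarkov M k \<and> maximal_dominates M \<rho> k \<and>
      (\<forall>x\<in>X. \<forall>y\<in>X. 1 \<le> \<rho> x y \<longrightarrow>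
        decay \<sigma> x y \<le> ennreal (D * (1 + 1 / (\<sigma> * ln 2))) * k x y)"
    using far_kernel_dominated by blast
  obtain A where A: "0 < A"
    "\<And>k u. symmetric_submarkov M k \<Longrightarrow> maximal_dominates M \<rho> k \<Longrightarrow> u \<in> borel_measurable M \<Longrightarrow>
      P (\<lambda>x. ennpowr (kernel_op M k (\<lambda>y. ennpowr (u y) q) x) (1 / q)) \<le> ennreal A * P u"
    using power_mean_bounded_if_endpoint_bounded[OF Y q endpoint] by metis
  show thesis
  proof (rule that[OF D(1) A(1)])
    fix s :: real assume "0 < s"
    then have "0 < s * q" using q by simp
    from D(2)[OF this] show "\<exists>k. far_averaging D A s k"
      using A(2) unfolding far_averaging_def by blast
  qed
qed

text \<open>The factor \<open>s\<^bsup>1/q\<^esup>\<close> compensates the weight of order \<open>1 / s\<close> in front of the averaging kernel.\<close>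

lemma weight_bounded:
  assumes "0 < D" "0 < s" "s < 1"
  shows "s powr (1 / q) * (D * (1 + 1 / (s * q * ln 2))) powr (1 / q) \<le> (D * (1 + 1 / (q * ln 2))) powr (1 / q)"
proof -
  have ql: "0 < q * ln 2" using q by simp
  have W: "0 < D * (1 + 1 / (s * q * ln 2))" using assms q by (intro mult_pos_pos add_pos_pos divide_pos_pos) auto
  have "s * (D * (1 + 1 / (s * q * ln 2))) = D * (s + 1 / (q * ln 2))"
    using assms q by (simp add: field_simps)
  also have "\<dots> \<le> D * (1 + 1 / (q * ln 2))" using assms by (intro mult_left_mono) auto
  finally have "(s * (D * (1 + 1 / (s * q * ln 2)))) powr (1 / q) \<le> (D * (1 + 1 / (q * ln 2))) powr (1 / q)"
    using q W assms by (intro powr_mono2) auto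
  then show ?thesis using W assms by (simp add: powr_mult)
qed

text \<open>For \<open>s < s0\<close> the integrand at \<open>\<rho>(x, y) < 1\<close> is at most the one for \<open>s0\<close>, and at \<open>\<rho>(x, y) \<ge> 1\<close> it is
  bounded by the averaging kernel of order \<open>1 / s\<close> times \<open>\<bar>f(x)\<bar>\<^sup>q + \<bar>f(y)\<bar>\<^sup>q\<close>.\<close>

lemma Limsup_le:
  obtains C where "0 < C"
    "\<And>f s0. f \<in> sobolev_space M \<rho> N \<Omega> s0 q \<Longrightarrow> 0 < s0 \<Longrightarrow> s0 < 1 \<Longrightarrow>
      Limsup (at_right 0) (energy f)
        \<le> ennreal C * restr_norm M N \<Omega> f"
proof -
  obtain D A where D: "0 < D" and A: "0 < A" and far:
    "\<And>s. 0 < s \<Longrightarrow> \<exists>k. far_averaging D A s k"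
    using far_averages by blast
  define b where "b = 2 powr (1 / q)"
  define E where "E = (D * (1 + 1 / (q * ln 2))) powr (1 / q)"
  have "0 < D * (1 + 1 / (q * ln 2))" using D q by (intro mult_pos_pos add_pos_pos divide_pos_pos) auto
  then have E: "0 < E" unfolding E_def powr_gt_zero by (rule not_sym[OF less_imp_neq])
  have b: "0 < b" by (simp add: b_def)
  have Q: "1 \<le> Q" by (rule norm.K_ge_1)
  define C where "C = b * b * Q * Q * (2 * E * (1 + A))"
  show thesis
  proof (rule that)
    show "0 < C" using b E A Q by (simp add: C_def)
    fix f s0 assume f0: "f \<in> sobolev_space M \<rho> N \<Omega> s0 q" and s0: "0 < s0" "s0 < 1"
    then have f: "f \<in> borel_measurable (restrict_space M \<Omega>)"
      and fin: "restr_norm_ext M N \<Omega> (gagliardo_fun M \<rho> \<Omega> s0 q f) < \<infinity>"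
      by (auto simp: sobolev_space_def sobolev_seminorm_def)
    obtain H where [measurable]: "H \<in> borel_measurable M"
      and H: "AE x in M. x \<in> \<Omega> \<longrightarrow> G s0 f x \<le> H x" "P H < \<infinity>"
      using restr_norm_ext_less_imp[OF Y \<Omega> fin] by blast
    define F where "F = abs_on \<Omega> f"
    have Fm [measurable]: "F \<in> borel_measurable M" unfolding F_def by (rule abs_on_measurable[OF \<Omega> f])
    have F: "F x = ennreal (cmod (f x))" if "x \<in> \<Omega>" for x using that by (simp add: F_def abs_on_def)
    have step: "ennreal (s powr (1 / q)) * sobolev_seminorm M \<rho> N \<Omega> s q f
        \<le> ennreal (b * b * Q * Q) * (ennreal (s powr (1 / q)) * P H) + ennreal C * P F"
      if s: "0 < s" "s < s0" for s
    proof -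
      obtain k where k: "far_averaging D A s k" using far[OF s(1)] by blast
      then have "symmetric_submarkov M k" and kfar: "\<And>x y. x \<in> X \<Longrightarrow> y \<in> X \<Longrightarrow> 1 \<le> \<rho> x y \<Longrightarrow>
          decay (s * q) x y \<le> ennreal (D * (1 + 1 / (s * q * ln 2))) * k x y"
        and kA: "\<And>u. u \<in> borel_measurable M \<Longrightarrow>
          P (\<lambda>x. ennpowr (kernel_op M k (\<lambda>y. ennpowr (u y) q) x) (1 / q)) \<le> ennreal A * P u"
        unfolding far_averaging_def by simp_all
      then interpret symmetric_submarkov M k by simp
      define W where "W = D * (1 + 1 / (s * q * ln 2))"
      have W: "0 < W" unfolding W_def using D q s by (intro mult_pos_pos add_pos_pos divide_pos_pos) auto
      define TF where "TF x = ennpowr (T (\<lambda>y. ennpowr (F y) q) x) (1 / q)" for x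
      have [measurable]: "TF \<in> borel_measurable M" unfolding TF_def[abs_def] by measurable
      define w where "w = 2 * W powr (1 / q)"
      have w: "0 < w" using W by (simp add: w_def)
      have point: "G s f x \<le> ennreal (b * b) * (G s0 f x + ennreal w * F x + ennreal w * TF x)"
        if x: "x \<in> X" "x \<in> \<Omega>" for x
      proof -
        define v where "v y = ennreal (2 powr q * W) * (k x y * (ennpowr (F x) q + ennpowr (F y) q))" for y
        have [measurable]: "v \<in> borel_measurable M" unfolding v_def[abs_def] using x by measurable
        have le: "gagliardo_integrand M \<rho> s q f x y * indicator \<Omega> y \<le> gagliardo_integrand M \<rho> s0 q f x y * indicator \<Omega> y + v y"
          if y: "y \<in> X" for y
        proof (cases "y = x \<or> y \<notin> \<Omega>")
          case False
          then have yx: "y \<noteq> x" "y \<in> \<Omega>" by auto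
          have pos: "0 < \<rho> x y" using dist_nonneg[OF x(1) y] dist_eq_0_iff[OF x(1) y] yx by auto
          show ?thesis
          proof (cases "1 \<le> \<rho> x y")
            case True
            have "gagliardo_integrand M \<rho> s q f x y
                = ennreal (cmod (f x - f y) powr q) * decay (s * q) x y"
              using yx by (simp add: gagliardo_integrand_def ennreal_times_divide)
            also have "\<dots> \<le> (ennreal (2 powr q) * (ennpowr (F x) q + ennpowr (F y) q)) * (ennreal W * k x y)"
              unfolding W_def F[OF x(2)] F[OF yx(2)] by (intro mult_mono ennpowr_norm_diff_le(1) q kfar x y True) auto
            also have "\<dots> = v y" using W by (simp add: v_def ennreal_mult ac_simps)
            finally show ?thesis using yx by (simp add: add_increasing)
          next
            case False
            have "\<rho> x y powr (s0 * q) \<le> \<rho> x y powr (s * q)"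
              using pos False s q by (intro powr_mono') (auto intro: mult_right_mono)
            then have "gagliardo_integrand M \<rho> s q f x y \<le> gagliardo_integrand M \<rho> s0 q f x y"
              using yx unfolding gagliardo_integrand_def
              by (simp add: ennreal_divide_antimono mult_left_mono ennreal_leI)
            then show ?thesis using yx by (simp add: add_increasing2)
          qed
        qed (auto simp: gagliardo_integrand_def)
        have v_int: "(\<integral>\<^sup>+y. v y \<partial>M) \<le> ennreal (2 powr q * W) * (ennpowr (F x) q + T (\<lambda>y. ennpowr (F y) q) x)"
        proof -
          have "(\<integral>\<^sup>+y. v y \<partial>M) = ennreal (2 powr q * W) * T (\<lambda>y. ennpowr (F x) q + ennpowr (F y) q) x"
            unfolding v_def kernel_op_def using x by (intro nn_integral_cmult) measurable
          also have "T (\<lambda>y. ennpowr (F x) q + ennpowr (F y) q) x = T (\<lambda>y. ennpowr (F x) q) x + T (\<lambda>y. ennpowr (F y) q) x"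
            using x by (intro op_add) auto
          also have "ennreal (2 powr q * W) * \<dots> \<le> ennreal (2 powr q * W) * (ennpowr (F x) q + T (\<lambda>y. ennpowr (F y) q) x)"
            using x by (intro mult_left_mono add_right_mono op_const_le) auto
          finally show ?thesis .
        qed
        let ?E = "ennreal (2 powr q * W) * ennpowr (F x) q + ennreal (2 powr q * W) * T (\<lambda>y. ennpowr (F y) q) x"
        let ?G = "\<lambda>s. \<integral>\<^sup>+y\<in>\<Omega>. gagliardo_integrand M \<rho> s q f x y \<partial>M"
        have "?G s \<le> (\<integral>\<^sup>+y. gagliardo_integrand M \<rho> s0 q f x y * indicator \<Omega> y + v y \<partial>M)"
          by (intro nn_integral_mono le) auto
        also have "\<dots> \<le> ?G s0 + (\<integral>\<^sup>+y. v y \<partial>M)"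
          by (intro nn_integral_add_le) auto
        also have "\<dots> \<le> ?G s0 + ?E"
          using v_int by (intro add_left_mono) (simp add: distrib_left)
        finally have G_le: "?G s \<le> ?G s0 + ?E" .
        have q1: "0 < 1 / q" using q by simp
        have cw: "ennpowr (ennreal (2 powr q * W) * u) (1 / q) = ennreal w * ennpowr u (1 / q)" for u
          using q W by (simp add: ennpowr_mult ennpowr_ennreal powr_mult powr_powr w_def)
        have "G s f x \<le> ennpowr (?G s0 + ?E) (1 / q)"
          unfolding gagliardo_fun_eq using G_le q1 by (intro ennpowr_mono) auto
        also have "\<dots> \<le> ennreal b * (ennpowr (?G s0) (1 / q) + ennpowr ?E (1 / q))"
          unfolding b_def by (rule ennpowr_add_le[OF q1])
        also have "\<dots> \<le> ennreal b * (ennreal b * G s0 f x + ennreal b * (ennreal w * F x + ennreal w * TF x))"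
        proof (intro mult_left_mono add_mono)
          have "1 \<le> b" using q by (simp add: b_def ge_one_powr_ge_zero)
          then have "1 * ennpowr (?G s0) (1 / q) \<le> ennreal b * ennpowr (?G s0) (1 / q)" by (intro mult_right_mono) auto
          then show "ennpowr (?G s0) (1 / q) \<le> ennreal b * G s0 f x"
            by (simp add: gagliardo_fun_eq)
          have "ennpowr ?E (1 / q)
              \<le> ennreal b * (ennpowr (ennreal (2 powr q * W) * ennpowr (F x) q) (1 / q) + ennpowr (ennreal (2 powr q * W) * T (\<lambda>y. ennpowr (F y) q) x) (1 / q))"
            unfolding b_def by (rule ennpowr_add_le[OF q1])
          then show "ennpowr ?E (1 / q)
              \<le> ennreal b * (ennreal w * F x + ennreal w * TF x)"
            using q by (simp add: cw TF_def)
        qed auto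
        also have "\<dots> = ennreal (b * b) * (G s0 f x + ennreal w * F x + ennreal w * TF x)"
          using b by (simp add: ennreal_mult distrib_left mult.assoc add.assoc)
        finally show ?thesis .
      qed
      have "sobolev_seminorm M \<rho> N \<Omega> s q f \<le> P (\<lambda>x. ennreal (b * b) * (H x + ennreal w * F x + ennreal w * TF x))"
        unfolding sobolev_seminorm_def
      proof (rule restr_norm_ext_le[OF Y \<Omega>])
        show "AE x in M. x \<in> \<Omega> \<longrightarrow> G s f x \<le> ennreal (b * b) * (H x + ennreal w * F x + ennreal w * TF x)"
          using H(1) AE_space
        proof eventually_elim
          case (elim x)
          show ?case
          proof
            assume x: "x \<in> \<Omega>"
            have "ennreal (b * b) * (G s0 f x + ennreal w * F x + ennreal w * TF x)
                \<le> ennreal (b * b) * (H x + ennreal w * F x + ennreal w * TF x)"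
              using elim x by (intro mult_left_mono add_right_mono) auto
            with point[OF elim(2) x] show "G s f x \<le> ennreal (b * b) * (H x + ennreal w * F x + ennreal w * TF x)"
              by (rule order_trans)
          qed
        qed
      qed measurable
      also have "\<dots> = ennreal (b * b) * P (\<lambda>x. H x + ennreal w * F x + ennreal w * TF x)"
        using b by (intro norm.scale) auto
      also have "\<dots> \<le> ennreal (b * b) * (ennreal (Q * Q) * (P H + P (\<lambda>x. ennreal w * F x) + P (\<lambda>x. ennreal w * TF x)))"
        by (intro mult_left_mono norm.add3_le) auto
      also have "\<dots> \<le> ennreal (b * b) * (ennreal (Q * Q) * (P H + ennreal w * P F + ennreal w * (ennreal A * P F)))"
        using w kA[OF Fm] by (intro mult_left_mono add_mono) (auto simp: norm.scale TF_def[abs_def] intro: mult_left_mono)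
      also have "\<dots> = ennreal (b * b * Q * Q) * (P H + ennreal (w * (1 + A)) * P F)"
        using w A b Q by (simp add: ennreal_mult distrib_left distrib_right ac_simps)
      finally have "ennreal (s powr (1 / q)) * sobolev_seminorm M \<rho> N \<Omega> s q f
          \<le> ennreal (s powr (1 / q)) * (ennreal (b * b * Q * Q) * (P H + ennreal (w * (1 + A)) * P F))"
        by (rule mult_left_mono) simp
      also have "\<dots> = ennreal (b * b * Q * Q) * (ennreal (s powr (1 / q)) * P H)
            + ennreal (b * b * Q * Q * (s powr (1 / q) * w * (1 + A))) * P F"
      proof -
        have "ennreal (b * b * Q * Q * (s powr (1 / q) * w * (1 + A)))
            = ennreal (s powr (1 / q)) * (ennreal (b * b * Q * Q) * ennreal (w * (1 + A)))"
          using w A b Q by (simp add: ac_simps flip: ennreal_mult)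
        then show ?thesis by (simp only: distrib_left ac_simps)
      qed
      also have "\<dots> \<le> ennreal (b * b * Q * Q) * (ennreal (s powr (1 / q)) * P H) + ennreal C * P F"
      proof (intro add_left_mono mult_right_mono ennreal_leI)
        have "s powr (1 / q) * w \<le> 2 * E"
          using weight_bounded[OF D s(1)] s s0 by (simp add: w_def W_def E_def)
        then show "b * b * Q * Q * (s powr (1 / q) * w * (1 + A)) \<le> C"
          unfolding C_def using b Q A by (intro mult_left_mono mult_right_mono) auto
      qed auto
      finally show ?thesis .
    qed
    obtain h where h: "0 \<le> h" "P H = ennreal h" using H(2) by (cases "P H") auto
    have lim: "((\<lambda>s. ennreal (b * b * Q * Q) * (ennreal (s powr (1 / q)) * P H) + ennreal C * P F)
        \<longlongrightarrow> 0 + ennreal C * P F) (at_right 0)"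
    proof (intro tendsto_add tendsto_const)
      have "((\<lambda>s. b * b * Q * Q * (s powr (1 / q) * h)) \<longlongrightarrow> b * b * Q * Q * (0 * h)) (at_right 0)"
        using q by (intro tendsto_mult tendsto_const powr_tendsto_0_at_right) auto
      then have "((\<lambda>s. ennreal (b * b * Q * Q * (s powr (1 / q) * h))) \<longlongrightarrow> ennreal (b * b * Q * Q * (0 * h))) (at_right 0)"
        by (rule tendsto_ennrealI)
      moreover have "ennreal (b * b * Q * Q * (s powr (1 / q) * h)) = ennreal (b * b * Q * Q) * (ennreal (s powr (1 / q)) * P H)" for s
        using h b Q by (simp add: ennreal_mult)
      ultimately show "((\<lambda>s. ennreal (b * b * Q * Q) * (ennreal (s powr (1 / q)) * P H)) \<longlongrightarrow> 0) (at_right 0)"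
        by simp
    qed
    have "Limsup (at_right 0) (energy f)
        \<le> Limsup (at_right 0) (\<lambda>s. ennreal (b * b * Q * Q) * (ennreal (s powr (1 / q)) * P H) + ennreal C * P F)"
    proof (rule Limsup_mono)
      show "\<forall>\<^sub>F s in at_right 0. ennreal (s powr (1 / q)) * sobolev_seminorm M \<rho> N \<Omega> s q f
          \<le> ennreal (b * b * Q * Q) * (ennreal (s powr (1 / q)) * P H) + ennreal C * P F"
        unfolding eventually_at_right_field using step s0 by blast
    qed
    also have "\<dots> = ennreal C * P F"
      using lim by (subst lim_imp_Limsup) auto
    finally show "Limsup (at_right 0) (energy f)
        \<le> ennreal C * restr_norm M N \<Omega> f"
      by (simp add: restr_norm_eq[OF Y \<Omega> f] F_def)
  qed
qed

end

section \<open>The estimate from below\<close>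

lemma ennreal_le_affine_if_above:
  fixes r t d :: ennreal
  assumes c: "0 < c" and le: "\<And>b. r < b \<Longrightarrow> t \<le> ennreal c * b + d"
  shows "t \<le> ennreal c * r + d"
proof (cases r)
  case (real r')
  show ?thesis
  proof (rule ennreal_le_epsilon)
    fix e :: real assume e: "0 < e"
    have "r < ennreal (r' + e / c)" using real c e by (simp add: ennreal_less_iff)
    from le[OF this] have "t \<le> ennreal c * ennreal (r' + e / c) + d" .
    also have "ennreal c * ennreal (r' + e / c) = ennreal c * r + ennreal e"
      using real c e by (simp add: distrib_left flip: ennreal_mult ennreal_plus)
    finally show "t \<le> ennreal c * r + d + ennreal e" by (simp add: ac_simps)
  qed
qed (use c in \<open>simp add: ennreal_mult_top\<close>)

context restricted_function_space
begin

text \<open>Integrate \<open>\<bar>f(x)\<bar>\<^sup>q \<le> 2\<^sup>q (\<bar>f(x) - f(y)\<bar>\<^sup>q + \<bar>f(y)\<bar>\<^sup>q)\<close> against the far minorant of the kernel, whose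
  mass is \<open>c / (s q)\<close>. The first term is controlled by the Gagliardo function, the second one by an
  average of the part of \<open>f\<close> outside the ball.\<close>

lemma Liminf_ge:
  assumes wrd: "weak_reverse_doubling M \<rho>" and wmd: "weak_measure_density M \<rho> \<Omega>"
  obtains x0 C where "x0 \<in> X" "0 < C"
    "\<And>f. f \<in> borel_measurable (restrict_space M \<Omega>) \<Longrightarrow>
      (\<lambda>n. P (\<lambda>x. abs_on \<Omega> f x * indicator (X - B x0 (real (Suc n))) x)) \<longlonglongrightarrow> 0 \<Longrightarrow>
      ennreal C * restr_norm M N \<Omega> f
        \<le> Liminf (at_right 0) (energy f)"
proof -
  obtain D A where D: "0 < D" and A: "0 < A" and far:
    "\<And>s. 0 < s \<Longrightarrow> \<exists>k. far_averaging D A s k"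
    using far_averages by blast
  obtain x0 c where x0: "x0 \<in> X" and c: "0 < c" and minorant:
    "\<And>R. 1 \<le> R \<Longrightarrow> \<exists>\<sigma>0>0. \<forall>\<sigma>. 0 < \<sigma> \<and> \<sigma> < \<sigma>0 \<longrightarrow> (\<exists>\<kappa>. far_minorant \<Omega> x0 R \<sigma> (c / \<sigma>) \<kappa>)"
    using far_kernel_minorant[OF wrd wmd \<Omega>] by blast
  define b where "b = 2 powr (1 / q)"
  define E where "E = (D * (1 + 1 / (q * ln 2))) powr (1 / q)"
  have "0 < D * (1 + 1 / (q * ln 2))" using D q by (intro mult_pos_pos add_pos_pos divide_pos_pos) auto
  then have E: "0 < E" unfolding E_def powr_gt_zero by (rule not_sym[OF less_imp_neq])
  have b: "0 < b" by (simp add: b_def)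
  have Q: "1 \<le> Q" by (rule norm.K_ge_1)
  define c2 where "c2 = 2 * (q / c) powr (1 / q)"
  have c2: "0 < c2" using q c by (simp add: c2_def)
  define c7 where "c7 = c2 * b * Q"
  have c7: "0 < c7" using c2 b Q by (simp add: c7_def)
  show thesis
  proof (rule that[OF x0])
    show "0 < 1 / c7" using c7 by simp
    fix f :: "'a \<Rightarrow> complex" assume f: "f \<in> borel_measurable (restrict_space M \<Omega>)"
    define F where "F = abs_on \<Omega> f"
    have Fm [measurable]: "F \<in> borel_measurable M" unfolding F_def by (rule abs_on_measurable[OF \<Omega> f])
    have F: "F x = ennreal (cmod (f x))" if "x \<in> \<Omega>" for x using that by (simp add: F_def abs_on_def)
    define Fn where "Fn n x = F x * indicator (B x0 (real (Suc n))) x" for n x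
    define Ff where "Ff n x = F x * indicator (X - B x0 (real (Suc n))) x" for n x
    have [measurable]: "B x0 (real (Suc n)) \<in> sets M" for n using x0 by (intro ball_sets) auto
    have Fnm [measurable]: "Fn n \<in> borel_measurable M" for n unfolding Fn_def[abs_def] by measurable
    have Ffm [measurable]: "Ff n \<in> borel_measurable M" for n unfolding Ff_def[abs_def] by measurable
    define \<phi> where "\<phi> s = ennreal (s powr (1 / q)) * sobolev_seminorm M \<rho> N \<Omega> s q f" for s
    assume "(\<lambda>n. P (\<lambda>x. abs_on \<Omega> f x * indicator (X - B x0 (real (Suc n))) x)) \<longlonglongrightarrow> 0"
    then have tail: "(\<lambda>n. P (Ff n)) \<longlonglongrightarrow> 0" by (simp add: Ff_def[abs_def] F_def)
    have step: "\<exists>s1>0. \<forall>s. 0 < s \<and> s < s1 \<longrightarrow>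
        P (Fn n) \<le> ennreal c7 * (\<phi> s + ennreal (E * A) * P (Ff n))" for n
    proof -
      define R where "R = real (Suc n)"
      have R: "1 \<le> R" by (simp add: R_def)
      obtain \<sigma>0 where \<sigma>0: "0 < \<sigma>0" and min\<sigma>: "\<And>\<sigma>. 0 < \<sigma> \<Longrightarrow> \<sigma> < \<sigma>0 \<Longrightarrow>
        \<exists>\<kappa>. far_minorant \<Omega> x0 R \<sigma> (c / \<sigma>) \<kappa>"
        using minorant[OF R] by blast
      show ?thesis
      proof (intro exI[of _ "min 1 (\<sigma>0 / q)"] conjI allI impI)
        show "0 < min 1 (\<sigma>0 / q)" using \<sigma>0 q by simp
        fix s assume "0 < s \<and> s < min 1 (\<sigma>0 / q)"
        then have s: "0 < s" "s < 1" "s * q < \<sigma>0" using q by (auto simp: field_simps)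
        have sq: "0 < s * q" using s q by simp
        obtain \<kappa> where \<kappa>_min: "far_minorant \<Omega> x0 R (s * q) (c / (s * q)) \<kappa>"
          using min\<sigma>[OF sq s(3)] by blast
        have [measurable]: "\<kappa> \<in> borel_measurable M" and mass: "ennreal (c / (s * q)) \<le> (\<integral>\<^sup>+y. \<kappa> y \<partial>M)"
          and supp: "\<And>y. y \<in> X \<Longrightarrow> \<kappa> y \<noteq> 0 \<Longrightarrow> y \<in> \<Omega> \<and> R \<le> \<rho> x0 y"
          and \<kappa>: "\<And>x y. x \<in> B x0 R \<Longrightarrow> y \<in> X \<Longrightarrow> \<kappa> y \<noteq> 0 \<Longrightarrow> 1 \<le> \<rho> x y \<and>
            \<kappa> y \<le> decay (s * q) x y"
          using \<kappa>_min unfolding far_minorant_def by simp_all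
        obtain k where k: "far_averaging D A s k" using far[OF s(1)] by blast
        then have "symmetric_submarkov M k" and kfar: "\<And>x y. x \<in> X \<Longrightarrow> y \<in> X \<Longrightarrow> 1 \<le> \<rho> x y \<Longrightarrow>
          decay (s * q) x y \<le> ennreal (D * (1 + 1 / (s * q * ln 2))) * k x y"
        and kA: "\<And>u. u \<in> borel_measurable M \<Longrightarrow>
          P (\<lambda>x. ennpowr (kernel_op M k (\<lambda>y. ennpowr (u y) q) x) (1 / q)) \<le> ennreal A * P u"
          unfolding far_averaging_def by simp_all
        then interpret symmetric_submarkov M k by simp
        define W where "W = D * (1 + 1 / (s * q * ln 2))"
        have W: "0 < W" unfolding W_def using D q s by (intro mult_pos_pos add_pos_pos divide_pos_pos) auto
        define TF where "TF x = ennpowr (T (\<lambda>y. ennpowr (Ff n y) q) x) (1 / q)" for x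
        have [measurable]: "TF \<in> borel_measurable M" unfolding TF_def[abs_def] by measurable
        define S where "S = s powr (1 / q)"
        have S: "0 < S" using s by (simp add: S_def)
        have q1: "0 < 1 / q" using q by simp
        have point: "F x \<le> ennreal (c2 * b * S) * (G s f x + ennreal (W powr (1 / q)) * TF x)"
          if x: "x \<in> X" "x \<in> \<Omega>" "x \<in> B x0 R" for x
        proof -
          let ?I = "\<lambda>y. gagliardo_integrand M \<rho> s q f x y * indicator \<Omega> y"
          define v where "v y = ennreal (2 powr q * W) * (k x y * ennpowr (Ff n y) q)" for y
          have [measurable]: "v \<in> borel_measurable M" unfolding v_def[abs_def] using x by measurable
          have le: "ennpowr (F x) q * \<kappa> y \<le> ennreal (2 powr q) * ?I y + v y" if y: "y \<in> X" for y
          proof (cases "\<kappa> y = 0")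
            case False
            have y\<Omega>: "y \<in> \<Omega>" and yR: "R \<le> \<rho> x0 y" using supp[OF y False] by auto
            have far: "1 \<le> \<rho> x y" and \<kappa>y: "\<kappa> y \<le> decay (s * q) x y"
              using \<kappa>[OF x(3) y False] by auto
            have yx: "y \<noteq> x" using far dist_eq_0_iff[OF x(1) y] by auto
            have Fy: "Ff n y = ennreal (cmod (f y))"
              using yR y y\<Omega> by (simp add: Ff_def F qball_def R_def)
            have "ennpowr (F x) q * \<kappa> y \<le> ennreal (2 powr q) * (ennreal (cmod (f x - f y) powr q) + ennpowr (Ff n y) q) * \<kappa> y"
              unfolding F[OF x(2)] Fy by (intro mult_right_mono ennpowr_norm_diff_le(2) q) simp
            also have "\<dots> = ennreal (2 powr q) * (ennreal (cmod (f x - f y) powr q) * \<kappa> y) + ennreal (2 powr q) * (ennpowr (Ff n y) q * \<kappa> y)"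
              by (simp add: distrib_left distrib_right mult.assoc)
            also have "\<dots> \<le> ennreal (2 powr q) * ?I y + ennreal (2 powr q) * (ennpowr (Ff n y) q * (ennreal W * k x y))"
            proof (intro add_mono mult_left_mono)
              have "ennreal (cmod (f x - f y) powr q) * \<kappa> y
                  \<le> ennreal (cmod (f x - f y) powr q) * decay (s * q) x y"
                using \<kappa>y by (rule mult_left_mono) simp
              also have "\<dots> = ?I y" using yx y\<Omega> by (simp add: gagliardo_integrand_def ennreal_times_divide)
              finally show "ennreal (cmod (f x - f y) powr q) * \<kappa> y \<le> ?I y" .
              show "\<kappa> y \<le> ennreal W * k x y"
                using \<kappa>y kfar[OF x(1) y far] unfolding W_def by (rule order_trans)
            qed auto
            also have "\<dots> = ennreal (2 powr q) * ?I y + v y" using W by (simp add: v_def ennreal_mult ac_simps)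
            finally show ?thesis .
          qed simp
          let ?G = "\<integral>\<^sup>+y\<in>\<Omega>. gagliardo_integrand M \<rho> s q f x y \<partial>M"
          let ?t = "T (\<lambda>y. ennpowr (Ff n y) q) x"
          have "ennpowr (F x) q * ennreal (c / (s * q)) \<le> ennpowr (F x) q * (\<integral>\<^sup>+y. \<kappa> y \<partial>M)"
            using mass by (rule mult_left_mono) simp
          also have "\<dots> = (\<integral>\<^sup>+y. ennpowr (F x) q * \<kappa> y \<partial>M)" by (rule nn_integral_cmult[symmetric]) simp
          also have "\<dots> \<le> (\<integral>\<^sup>+y. ennreal (2 powr q) * ?I y + v y \<partial>M)" by (intro nn_integral_mono le) auto
          also have "\<dots> \<le> (\<integral>\<^sup>+y. ennreal (2 powr q) * ?I y \<partial>M) + (\<integral>\<^sup>+y. v y \<partial>M)" by (intro nn_integral_add_le) auto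
          also have "\<dots> \<le> ennreal (2 powr q) * ?G + ennreal (2 powr q * W) * ?t"
          proof (intro add_mono nn_integral_cmult_le)
            show "(\<integral>\<^sup>+y. v y \<partial>M) \<le> ennreal (2 powr q * W) * ?t"
              unfolding v_def kernel_op_def using x by (subst nn_integral_cmult) auto
          qed simp
          also have "\<dots> = ennreal (2 powr q) * (?G + ennreal W * ?t)"
            using W by (simp add: ennreal_mult distrib_left mult.assoc)
          finally have main: "ennpowr (F x) q * ennreal (c / (s * q)) \<le> ennreal (2 powr q) * (?G + ennreal W * ?t)" .
          have "ennpowr (F x) q = ennreal (s * q / c) * (ennpowr (F x) q * ennreal (c / (s * q)))"
          proof -
            have "ennreal (s * q / c) * ennreal (c / (s * q)) = 1" using c s q by (simp flip: ennreal_mult)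
            then show ?thesis by (metis mult.left_commute mult.right_neutral)
          qed
          also have "\<dots> \<le> ennreal (s * q / c) * (ennreal (2 powr q) * (?G + ennreal W * ?t))"
            using main by (rule mult_left_mono) simp
          finally have "ennpowr (ennpowr (F x) q) (1 / q) \<le> ennpowr (ennreal (s * q / c) * (ennreal (2 powr q) * (?G + ennreal W * ?t))) (1 / q)"
            using q by (intro ennpowr_mono) auto
          also have "\<dots> = ennreal (c2 * S) * ennpowr (?G + ennreal W * ?t) (1 / q)"
          proof -
            have "(s * q / c) powr (1 / q) * (2 powr q) powr (1 / q) = c2 * S"
            proof -
              have "(s * q / c) powr (1 / q) = s powr (1 / q) * (q / c) powr (1 / q)"
                using s q c powr_mult[of s "q / c" "1 / q"] by simp
              then show ?thesis using q by (simp add: powr_powr c2_def S_def)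
            qed
            then have "ennreal (c2 * S) = ennreal ((s * q / c) powr (1 / q)) * ennreal ((2 powr q) powr (1 / q))"
              by (simp flip: ennreal_mult)
            then show ?thesis
              using q1 s q c by (simp add: ennpowr_mult[OF q1] ennpowr_ennreal mult.assoc)
          qed
          also have "\<dots> \<le> ennreal (c2 * S) * (ennreal b * (ennpowr ?G (1 / q) + ennpowr (ennreal W * ?t) (1 / q)))"
            unfolding b_def by (intro mult_left_mono ennpowr_add_le q1) simp
          also have "\<dots> = ennreal (c2 * b * S) * (G s f x + ennreal (W powr (1 / q)) * TF x)"
            using q1 W c2 b S by (simp add: gagliardo_fun_eq TF_def ennpowr_mult ennpowr_ennreal ennreal_mult ac_simps)
          finally show ?thesis using q by simp
        qed
        have above: "P (Fn n) \<le> ennreal (c2 * b * S * Q) * r + ennreal c7 * (ennreal (E * A) * P (Ff n))"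
          if r: "sobolev_seminorm M \<rho> N \<Omega> s q f < r" for r
        proof -
          obtain H where [measurable]: "H \<in> borel_measurable M"
            and H: "AE x in M. x \<in> \<Omega> \<longrightarrow> G s f x \<le> H x" "P H < r"
            using restr_norm_ext_less_imp[OF Y \<Omega> r[unfolded sobolev_seminorm_def]] by blast
          have "P (Fn n) \<le> P (\<lambda>x. ennreal (c2 * b * S) * (H x + ennreal (W powr (1 / q)) * TF x))"
          proof (rule norm.mono_AE)
            show "AE x in M. Fn n x \<le> ennreal (c2 * b * S) * (H x + ennreal (W powr (1 / q)) * TF x)"
              using H(1) AE_space
            proof eventually_elim
              case (elim x)
              show ?case
              proof (cases "x \<in> \<Omega> \<and> x \<in> B x0 R")
                case True
                then have "F x \<le> ennreal (c2 * b * S) * (G s f x + ennreal (W powr (1 / q)) * TF x)"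
                  using elim by (intro point) auto
                also have "\<dots> \<le> ennreal (c2 * b * S) * (H x + ennreal (W powr (1 / q)) * TF x)"
                  using elim True by (intro mult_left_mono add_right_mono) auto
                finally show ?thesis using True by (simp add: Fn_def R_def)
              qed (auto simp: Fn_def F_def abs_on_def R_def)
            qed
          qed measurable
          also have "\<dots> = ennreal (c2 * b * S) * P (\<lambda>x. H x + ennreal (W powr (1 / q)) * TF x)"
            using c2 b S by (intro norm.scale) auto
          also have "\<dots> \<le> ennreal (c2 * b * S) * (ennreal Q * (P H + P (\<lambda>x. ennreal (W powr (1 / q)) * TF x)))"
            by (intro mult_left_mono norm.add_le) auto
          also have "\<dots> \<le> ennreal (c2 * b * S) * (ennreal Q * (r + ennreal (W powr (1 / q)) * (ennreal A * P (Ff n))))"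
            using H(2) kA[OF Ffm] by (intro mult_left_mono add_mono) (auto simp: norm.scale TF_def[abs_def] intro: mult_left_mono)
          also have "\<dots> = ennreal (c2 * b * S * Q) * r + ennreal (c7 * (S * W powr (1 / q) * A)) * P (Ff n)"
          proof -
            have 1: "ennreal (c2 * b * S * Q) = ennreal (c2 * b * S) * ennreal Q"
              using c2 b S Q by (intro ennreal_mult) auto
            have 2: "ennreal (c7 * (S * W powr (1 / q) * A)) = ennreal (c2 * b * S) * (ennreal Q * (ennreal (W powr (1 / q)) * ennreal A))"
              using c2 b S Q A by (simp add: c7_def ac_simps flip: ennreal_mult)
            show ?thesis unfolding 1 2 by (simp only: distrib_left ac_simps)
          qed
          also have "\<dots> \<le> ennreal (c2 * b * S * Q) * r + ennreal (c7 * (E * A)) * P (Ff n)"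
          proof (intro add_left_mono mult_right_mono ennreal_leI mult_left_mono)
            show "S * W powr (1 / q) \<le> E"
              using weight_bounded[OF D s(1,2)] by (simp add: S_def W_def E_def)
          qed (use A c7 in auto)
          finally show ?thesis using c7 E A by (simp add: ennreal_mult mult.assoc)
        qed
        have "P (Fn n) \<le> ennreal (c2 * b * S * Q) * sobolev_seminorm M \<rho> N \<Omega> s q f + ennreal c7 * (ennreal (E * A) * P (Ff n))"
        proof (rule ennreal_le_affine_if_above)
          show "0 < c2 * b * S * Q" using c2 b S Q by simp
        qed (rule above)
        also have "\<dots> = ennreal c7 * (\<phi> s + ennreal (E * A) * P (Ff n))"
        proof -
          have 1: "ennreal (c2 * b * S * Q) = ennreal c7 * ennreal S"
            using c7 S by (simp add: c7_def ac_simps flip: ennreal_mult)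
          show ?thesis unfolding \<phi>_def S_def[symmetric] 1 by (simp only: distrib_left mult.assoc)
        qed
        finally show "P (Fn n) \<le> ennreal c7 * (\<phi> s + ennreal (E * A) * P (Ff n))" .
      qed
    qed
    let ?l = "Liminf (at_right 0) \<phi>"
    have inv: "ennreal (1 / c7) * (ennreal c7 * t) = t" for t
      using c7 by (simp flip: mult.assoc ennreal_mult)
    have tail': "(\<lambda>n. ennreal (E * A) * P (Ff n)) \<longlonglongrightarrow> 0"
      using ennreal_tendsto_cmult[OF _ tail, of "ennreal (E * A)"] by simp
    have tail_small: "\<forall>\<^sub>F n in sequentially. ennreal (E * A) * P (Ff n) < 1"
      using order_tendstoD(2)[OF tail', of 1] by simp
    have le_n: "\<forall>\<^sub>F n in sequentially. ennreal (1 / c7) * P (Fn n) \<le> ?l + ennreal (E * A) * P (Ff n)"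
      using tail_small
    proof eventually_elim
      case (elim n)
      let ?e = "ennreal (E * A) * P (Ff n)"
      have fin: "?e \<noteq> top" using elim by auto
      obtain s1 where s1: "0 < s1" "\<And>s. 0 < s \<Longrightarrow> s < s1 \<Longrightarrow> P (Fn n) \<le> ennreal c7 * (\<phi> s + ?e)"
        using step[of n] by blast
      have "ennreal (1 / c7) * P (Fn n) - ?e \<le> ?l"
      proof (rule Liminf_bounded)
        have "ennreal (1 / c7) * P (Fn n) - ?e \<le> \<phi> s" if "0 < s" "s < s1" for s
        proof -
          have "ennreal (1 / c7) * P (Fn n) \<le> ennreal (1 / c7) * (ennreal c7 * (\<phi> s + ?e))"
            using s1(2)[OF that] by (rule mult_left_mono) simp
          also have "\<dots> = ?e + \<phi> s" by (simp add: inv add.commute)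
          finally show ?thesis using fin by (simp add: ennreal_minus_le_iff)
        qed
        then show "\<forall>\<^sub>F s in at_right 0. ennreal (1 / c7) * P (Fn n) - ?e \<le> \<phi> s"
          unfolding eventually_at_right_field using s1(1) by blast
      qed
      then show ?case by (simp add: ennreal_minus_le_iff add.commute)
    qed
    have "ennreal (1 / c7) * P F \<le> ?l + 0"
    proof (rule tendsto_le[OF _ _ _ le_n])
      have "P F = P (\<lambda>x. SUP n. Fn n x)"
      proof (intro antisym norm.mono)
        fix x assume x: "x \<in> X"
        obtain n where "\<rho> x0 x < real n" using reals_Archimedean2 by blast
        then have "Fn n x = F x" using x by (simp add: Fn_def qball_def)
        then show "F x \<le> (SUP n. Fn n x)" by (metis SUP_upper UNIV_I)
        show "(SUP n. Fn n x) \<le> F x" by (intro SUP_least) (simp add: Fn_def indicator_def)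
      qed auto
      also have inc: "\<dots> = (SUP n. P (Fn n))"
        by (rule norm.SUP_eq[OF Fnm]) (auto simp: incseq_def Fn_def qball_def indicator_def)
      finally have SUP: "P F = (SUP n. P (Fn n))" .
      have "(\<lambda>n. P (Fn n)) \<longlonglongrightarrow> P F"
        unfolding SUP
      proof (rule LIMSEQ_SUP, rule monoI)
        fix m n :: nat assume "m \<le> n"
        then show "P (Fn m) \<le> P (Fn n)"
          by (intro norm.mono Fnm) (auto simp: Fn_def qball_def indicator_def)
      qed
      then show "(\<lambda>n. ennreal (1 / c7) * P (Fn n)) \<longlonglongrightarrow> ennreal (1 / c7) * P F"
        by (intro ennreal_tendsto_cmult) auto
      show "(\<lambda>n. ?l + ennreal (E * A) * P (Ff n)) \<longlonglongrightarrow> ?l + 0"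
        by (intro tendsto_add tendsto_const tail')
    qed simp
    then show "ennreal (1 / c7) * restr_norm M N \<Omega> f
        \<le> Liminf (at_right 0) (energy f)"
      by (simp add: restr_norm_eq[OF Y \<Omega> f] F_def \<phi>_def[abs_def])
  qed
qed

lemma tail_tendsto_0_if_bounded_support:
  assumes f: "f \<in> holder_bs_on X \<rho> \<Omega> \<beta>" and x0: "x0 \<in> X"
  shows "(\<lambda>n. P (\<lambda>x. abs_on \<Omega> f x * indicator (X - B x0 (real (Suc n))) x)) \<longlonglongrightarrow> 0"
proof -
  obtain g x r where g: "{y\<in>X. g y \<noteq> 0} \<subseteq> B x r" "x \<in> X" "0 < r" and gf: "\<forall>x\<in>\<Omega>. g x = f x"
    using f by (auto simp: holder_bs_on_def holder_bs_def)
  obtain m where m: "K * (\<rho> x0 x + r) < real m" using reals_Archimedean2 by blast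
  have "P (\<lambda>x. abs_on \<Omega> f x * indicator (X - B x0 (real (Suc n))) x) = 0" if "m \<le> n" for n
  proof -
    have "B x r \<subseteq> B x0 (real (Suc n))"
      using x0 g(2) m that by (intro ball_subset[where a = "\<rho> x0 x"]) auto
    then have "(\<lambda>y. abs_on \<Omega> f y * indicator (X - B x0 (real (Suc n))) y) = (\<lambda>y. 0)"
      using g(1) gf by (intro ext) (auto simp: abs_on_def indicator_def)
    then show ?thesis by (simp only: norm.zero)
  qed
  then have "\<forall>\<^sub>F n in sequentially. 0 = P (\<lambda>x. abs_on \<Omega> f x * indicator (X - B x0 (real (Suc n))) x)"
    unfolding eventually_sequentially by (intro exI[of _ m]) simp
  then show ?thesis by (rule Lim_transform_eventually[OF tendsto_const])
qed

lemma tail_tendsto_0_if_abs_cont: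
  assumes ac: "abs_cont_norm M N" and x0: "x0 \<in> X"
    and f: "f \<in> borel_measurable (restrict_space M \<Omega>)" and fin: "restr_norm M N \<Omega> f < \<infinity>"
  shows "(\<lambda>n. P (\<lambda>x. abs_on \<Omega> f x * indicator (X - B x0 (real (Suc n))) x)) \<longlonglongrightarrow> 0"
proof -
  define f0 where "f0 x = (if x \<in> \<Omega> then f x else 0)" for x
  have [measurable]: "f0 \<in> borel_measurable M"
    unfolding f0_def[abs_def] by (rule zero_extension_measurable[OF \<Omega> f])
  have abs: "abs_on \<Omega> f = (\<lambda>x. ennreal (cmod (f0 x)))" by (auto simp: abs_on_def f0_def)
  then have "N f0 = restr_norm M N \<Omega> f" by (simp add: restr_norm_eq[OF Y \<Omega> f] ext_norm_cmod[OF Y])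
  then have f0: "f0 \<in> fspace M N" using fin by (simp add: fspace_def)
  define A where "A n = X - B x0 (real (Suc n))" for n
  have A [measurable]: "A n \<in> sets M" for n unfolding A_def using x0 by (intro sets.Diff ball_sets) auto
  have "(\<lambda>n. indicator (A n) x :: real) \<longlonglongrightarrow> 0" for x
  proof -
    obtain m where "\<rho> x0 x < real m" using reals_Archimedean2 by blast
    then have "\<forall>\<^sub>F n in sequentially. 0 = (indicator (A n) x :: real)"
      unfolding eventually_sequentially by (intro exI[of _ m]) (auto simp: A_def qball_def indicator_def)
    then show ?thesis by (rule Lim_transform_eventually[OF tendsto_const])
  qed
  then have "(\<lambda>n. N (\<lambda>x. f0 x * indicator (A n) x)) \<longlonglongrightarrow> 0"
    using ac f0 A unfolding abs_cont_norm_def by auto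
  moreover have "N (\<lambda>x. f0 x * indicator (A n) x) = P (\<lambda>x. abs_on \<Omega> f x * indicator (A n) x)" for n
  proof -
    have "(\<lambda>x. abs_on \<Omega> f x * indicator (A n) x) = (\<lambda>x. ennreal (cmod (f0 x * indicator (A n) x)))"
      unfolding abs by (auto simp: indicator_def)
    then show ?thesis by (simp add: ext_norm_cmod[OF Y])
  qed
  ultimately show ?thesis by (simp add: A_def)
qed

end

section \<open>Equivalence of the norms\<close>

lemma gagliardo_fun_add_const: "gagliardo_fun M \<rho> \<Omega> s q (\<lambda>x. f x + c) = gagliardo_fun M \<rho> \<Omega> s q f"
  unfolding gagliardo_fun_def[abs_def] add_diff_cancel_right ..

theorem theorem1p13:
  fixes M :: "'a measure" and \<rho> :: "'a \<Rightarrow> 'a \<Rightarrow> real"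
    and N :: "('a \<Rightarrow> complex) \<Rightarrow> ennreal" and \<Omega> :: "'a set" and p q :: real
  assumes "0 < q" and "q \<le> p"
    and "homogeneous_type M \<rho>" and "weak_reverse_doubling M \<rho>"
    and "ball_quasi_banach M \<rho> N"
    and "\<Omega> \<in> sets M" and "weak_measure_density M \<rho> \<Omega>"
    and "ball_banach M \<rho> (pow_norm (1 / p) N)"
    and "hl_endpoint_bounded M \<rho> N p"
  shows "\<exists>C C' :: real. 0 < C \<and> 0 < C' \<and>
    (\<forall>\<beta>>0. \<forall>f \<in> holder_bs_on (space M) \<rho> \<Omega> \<beta> \<inter> (\<Union>s\<in>{0<..<1}. sobolev_space M \<rho> N \<Omega> s q).
       ennreal C * restr_norm M N \<Omega> f
         \<le> Liminf (at_right 0) (\<lambda>s. ennreal (s powr (1 / q)) * sobolev_seminorm M \<rho> N \<Omega> s q f) \<and>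
       Liminf (at_right 0) (\<lambda>s. ennreal (s powr (1 / q)) * sobolev_seminorm M \<rho> N \<Omega> s q f)
         \<le> Limsup (at_right 0) (\<lambda>s. ennreal (s powr (1 / q)) * sobolev_seminorm M \<rho> N \<Omega> s q f) \<and>
       Limsup (at_right 0) (\<lambda>s. ennreal (s powr (1 / q)) * sobolev_seminorm M \<rho> N \<Omega> s q f)
         \<le> ennreal C' * restr_norm M N \<Omega> f) \<and>
    (abs_cont_norm M N \<and> borel_semiregular M \<rho> \<longrightarrow>
     (\<forall>f \<in> restr_quot_space M N \<Omega> \<inter> (\<Union>s\<in>{0<..<1}. sobolev_space M \<rho> N \<Omega> s q).
       ennreal C * restr_quot_norm M N \<Omega> f
         \<le> Liminf (at_right 0) (\<lambda>s. ennreal (s powr (1 / q)) * sobolev_seminorm M \<rho> N \<Omega> s q f) \<and>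
       Liminf (at_right 0) (\<lambda>s. ennreal (s powr (1 / q)) * sobolev_seminorm M \<rho> N \<Omega> s q f)
         \<le> Limsup (at_right 0) (\<lambda>s. ennreal (s powr (1 / q)) * sobolev_seminorm M \<rho> N \<Omega> s q f) \<and>
       Limsup (at_right 0) (\<lambda>s. ennreal (s powr (1 / q)) * sobolev_seminorm M \<rho> N \<Omega> s q f)
         \<le> ennreal C' * restr_quot_norm M N \<Omega> f))"
proof -
  obtain K L where "homogeneous_space M \<rho> K L" using homogeneous_typeE[OF assms(3)] .
  moreover obtain Q where "function_quasinorm M (ext_norm N) Q"
    using function_quasinorm_ext_norm[OF assms(5)] by blast
  ultimately interpret restricted_function_space M \<rho> K L N Q \<Omega> p q
    using assms by (intro restricted_function_space.intro restricted_function_space_axioms.intro)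
  obtain C' where C': "0 < C'" and upper: "\<And>f s0. f \<in> sobolev_space M \<rho> N \<Omega> s0 q \<Longrightarrow> 0 < s0 \<Longrightarrow> s0 < 1 \<Longrightarrow>
      Limsup (at_right 0) (energy f)
        \<le> ennreal C' * restr_norm M N \<Omega> f"
    using Limsup_le by blast
  obtain x0 C where x0: "x0 \<in> X" and C: "0 < C" and lower: "\<And>f. f \<in> borel_measurable (restrict_space M \<Omega>) \<Longrightarrow>
      (\<lambda>n. ext_norm N (\<lambda>x. abs_on \<Omega> f x * indicator (X - B x0 (real (Suc n))) x)) \<longlonglongrightarrow> 0 \<Longrightarrow>
      ennreal C * restr_norm M N \<Omega> f
        \<le> Liminf (at_right 0) (energy f)"
    using Liminf_ge[OF assms(4) assms(7)] by blast
  have meas: "f \<in> borel_measurable (restrict_space M \<Omega>)" if "f \<in> sobolev_space M \<rho> N \<Omega> s q" for f s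
    using that by (simp add: sobolev_space_def)
  have shift: "sobolev_seminorm M \<rho> N \<Omega> s q (\<lambda>x. f x + c) = sobolev_seminorm M \<rho> N \<Omega> s q f" for f s c
    by (simp add: sobolev_seminorm_def gagliardo_fun_add_const)
  have middle: "Liminf (at_right 0) h \<le> Limsup (at_right 0) h" for h :: "real \<Rightarrow> ennreal"
    by (rule Liminf_le_Limsup) simp
  show ?thesis
  proof (rule exI[of _ C], rule exI[of _ C'], intro conjI allI impI ballI C C' middle)
    fix \<beta> :: real and f
    assume f: "f \<in> holder_bs_on X \<rho> \<Omega> \<beta> \<inter> (\<Union>s\<in>{0<..<1}. sobolev_space M \<rho> N \<Omega> s q)"
    then obtain s0 where s0: "0 < s0" "s0 < 1" "f \<in> sobolev_space M \<rho> N \<Omega> s0 q" by auto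
    show "ennreal C * restr_norm M N \<Omega> f
         \<le> Liminf (at_right 0) (energy f)"
      using f by (intro lower meas[OF s0(3)] tail_tendsto_0_if_bounded_support[OF _ x0]) auto
    show "Limsup (at_right 0) (energy f)
         \<le> ennreal C' * restr_norm M N \<Omega> f"
      by (rule upper[OF s0(3,1,2)])
  next
    fix f
    assume ac: "abs_cont_norm M N \<and> borel_semiregular M \<rho>"
      and f: "f \<in> restr_quot_space M N \<Omega> \<inter> (\<Union>s\<in>{0<..<1}. sobolev_space M \<rho> N \<Omega> s q)"
    then obtain s0 where s0: "0 < s0" "s0 < 1" "f \<in> sobolev_space M \<rho> N \<Omega> s0 q" by auto
    let ?f = "\<lambda>(a::real) x. f x + complex_of_real a"
    have fa: "?f a \<in> sobolev_space M \<rho> N \<Omega> s0 q" for a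
      using s0(3) unfolding sobolev_space_def by (auto simp: shift intro!: borel_measurable_add)
    have "restr_quot_norm M N \<Omega> f < \<infinity>" using f by (simp add: restr_quot_space_def)
    then obtain a where a: "restr_norm M N \<Omega> (?f a) < \<infinity>"
      unfolding restr_quot_norm_def INF_less_iff by auto
    have "ennreal C * restr_quot_norm M N \<Omega> f \<le> ennreal C * restr_norm M N \<Omega> (?f a)"
      unfolding restr_quot_norm_def by (intro mult_left_mono INF_lower) auto
    also have "\<dots> \<le> Liminf (at_right 0) (energy (?f a))"
      using ac by (intro lower meas[OF fa] tail_tendsto_0_if_abs_cont[OF _ x0 meas[OF fa] a]) auto
    finally show "ennreal C * restr_quot_norm M N \<Omega> f
         \<le> Liminf (at_right 0) (energy f)"
      by (simp add: shift)
    have "ennreal (1 / C') * Limsup (at_right 0) (energy f)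
        \<le> restr_quot_norm M N \<Omega> f"
      unfolding restr_quot_norm_def
    proof (rule INF_greatest)
      fix a :: real
      have "ennreal (1 / C') * Limsup (at_right 0) (energy f)
          \<le> ennreal (1 / C') * (ennreal C' * restr_norm M N \<Omega> (?f a))"
        using upper[OF fa s0(1,2), of a] by (intro mult_left_mono) (simp_all add: shift)
      also have "\<dots> = restr_norm M N \<Omega> (?f a)" using C' by (simp flip: mult.assoc ennreal_mult)
      finally show "ennreal (1 / C') * Limsup (at_right 0) (energy f)
          \<le> restr_norm M N \<Omega> (?f a)" .
    qed
    then have "ennreal C' * (ennreal (1 / C') * Limsup (at_right 0) (energy f))
        \<le> ennreal C' * restr_quot_norm M N \<Omega> f" by (rule mult_left_mono) simp
    then show "Limsup (at_right 0) (energy f)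
         \<le> ennreal C' * restr_quot_norm M N \<Omega> f"
      using C' by (simp flip: mult.assoc ennreal_mult)
  qed
qed

end
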